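(* Let $d\geq1$, $1 \leq p, q \leq \infty$ with $1/p + 1/q = 1$ and $s > d / p$. Then, for a QMC method $Q[X_N]$ with node set $X_N = \{ \mathbf{x}_1,\ldots,\mathbf{x}_N \} \subset \mathbb{S}^d$, $$\operatorname{wce}(Q[X_N]; \mathbb{W}_p^s(\mathbb{S}^d)) = \left\| \int_{\mathbb{S}^d} B^{(s)}( \mathbf{x} \cdot \boldsymbol{\cdot}\, ) \, d\mu_N( \mathbf{x} ) \right\|_q = \left\| \mathcal{B}_N^{(s)} \right\|_q.$$
   Context: $\mathbb{S}^d$ is the unit sphere in $\mathbb{R}^{d+1}$, $\sigma_d$ its normalized surface area measure, and $\mathbb{L}_p(\mathbb{S}^d)$ the real $L_p$ space with respect to $\sigma_d$, with norm $\|\cdot\|_p$. Convention: $1/\infty = 0$. Sobolev space: for $f \in \mathbb{L}_1(\mathbb{S}^d)$ let $Y_\ell[f]$ be the projection of $f$ onto the spherical harmonics of exact degree $\ell$ on $\mathbb{S}^d$ (defined by integrating $f$ against the zonal reproducing kernel of that space), and let $\lambda_\ell = \ell(\ell+d-1)$ be the corresponding eigenvalue of the negative Laplace–Beltrami operator $-\Delta_d^*$. For $s \geq 0$, $1 \leq p \leq \infty$, $\mathbb{W}_p^s(\mathbb{S}^d)$ is the set of $f \in \mathbb{L}_p(\mathbb{S}^d)$ for which $(1-\Delta_d^* )^{s/2} f = \sum_{\ell\ge 0} (1+\lambda_\ell)^{s/2} Y_\ell[f]$ is in $\mathbb{L}_p(\mathbb{S}^d)$ (i.e. there is $g\in \mathbb{L}_p(\mathbb{S}^d)$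 with $Y_\ell[g] = (1+\lambda_\ell)^{s/2} Y_\ell[f]$ for all $\ell$), with norm $\|f\|_{\mathbb{W}_p^s(\mathbb{S}^d)} = \|(1-\Delta_d^* )^{s/2} f\|_p$. For $s > d/p$ this space embeds continuously into $C(\mathbb{S}^d)$, and its elements are identified with their continuous representatives. Worst-case error: for $X_N = \{\mathbf{x}_1,\dots,\mathbf{x}_N\}\subset \mathbb{S}^d$, $Q[X_N](f) = \frac1N \sum_{k=1}^N f(\mathbf{x}_k)$, $I(f) = \int_{\mathbb{S}^d} f\, d\sigma_d$, and for $s>d/p$ $$\operatorname{wce}(Q[X_N]; \mathbb{W}_p^s(\mathbb{S}^d)) = \sup\{ |Q[X_N](f) - I(f)| : f \in \mathbb{W}_p^s(\mathbb{S}^d),\ \|f\|_{\mathbb{W}_p^s(\mathbb{S}^d)} \leq 1\}.$$ Bessel kernel: $B^{(s)}(\mathbf{x}\cdot\mathbf{y}) = \sum_{\ell=0}^\infty (1+\lambda_\ell)^{-s/2} Z(d,\ell) P_\ell^{(d)}(\mathbf{x}\cdot\mathbf{y})$, where $Z(d,\ell)$ is the dimension of the space of spherical harmonics of exact degree $\ell$ on $\mathbb{S}^d$ and $P_\ell^{(d)}$ is the Gegenbauer polynomial of degree $\ell$, orthogonal on $[-1,1]$ with respect to the weight $(1-t^2)^{d/2-1}$ and normalized by $P_\ell^{(d)}(1)=1$; for $s>0$ it is understood as the integrable zonal function with this expansion. Signed measure: $\mu_N = \frac1N\sum_{j=1}^N \delta_{\mathbf{x}_j} - \sigma_d$ (with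 $\delta_{\mathbf{x}}$ the unit point mass at $\mathbf{x}$). The function $\mathcal{B}_N^{(s)}$ on $\mathbb{S}^d$ is $$\mathcal{B}_N^{(s)}(\mathbf{y}) = \frac1N\sum_{j=1}^N B^{(s)}(\mathbf{x}_j\cdot\mathbf{y}) - 1.$$ *)

theory Defs
  imports
    "HOL-Probability.Essential_Supremum"
    "HOL-Computational_Algebra.Polynomial"
    "HOL-Library.Function_Algebras"
begin

text \<open>
  The ambient space is a Euclidean space \<open>'a\<close> of dimension \<open>d + 1\<close>, and the sphere of dimension
  \<open>d\<close> is \<^term>\<open>sphere (0::'a::euclidean_space) 1\<close>. Objects that depend on \<open>d\<close> only, such as real
  functions of \<open>x \<bullet> y\<close>, take the type \<open>'a\<close> as an explicit argument.
\<close>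

definition sphere_dim :: "'a::euclidean_space itself \<Rightarrow> nat" where
  "sphere_dim _ = DIM('a) - 1"

text \<open>
  Normalized surface area, as the cone measure: the measure of \<open>A\<close> is the fraction of the volume of
  the unit ball taken up by the cone over \<open>A\<close>. The origin, where \<^const>\<open>sgn\<close> leaves the sphere,
  is a null set.
\<close>

definition sphere_measure :: "'a::euclidean_space measure" where
  "sphere_measure = restrict_space (distr (uniform_measure lborel (ball 0 1)) borel sgn) (sphere 0 1)"

text \<open>
  \<open>L\<^sub>p\<close> norm for \<open>1 \<le> p \<le> \<infinity>\<close>, with the value \<open>\<infinity>\<close> for functions that are not in \<open>L\<^sub>p\<close>.
\<close>

definition lp_norm :: "ereal \<Rightarrow> 'a measure \<Rightarrow> ('a \<Rightarrow> real) \<Rightarrow> ennreal" where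
  "lp_norm p M f =
    (if p = \<infinity> then esssup M (\<lambda>x. ennreal \<bar>f x\<bar>)
     else let I = (\<integral>\<^sup>+ x. ennreal (\<bar>f x\<bar> powr real_of_ereal p) \<partial>M)
       in if I = \<infinity> then \<infinity> else ennreal (enn2real I powr (1 / real_of_ereal p)))"

definition lp_space :: "ereal \<Rightarrow> 'a measure \<Rightarrow> ('a \<Rightarrow> real) set" where
  "lp_space p M = {f \<in> borel_measurable M. lp_norm p M f < \<infinity>}"

subsection \<open>Spherical harmonics\<close>

definition harmonic :: "('a::euclidean_space \<Rightarrow> real) \<Rightarrow> bool" where
  "harmonic u \<longleftrightarrow> (\<forall>x. (\<Sum>b\<in>Basis. (deriv ^^ 2) (\<lambda>t. u (x + t *\<^sub>R b)) 0) = 0)"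

text \<open>
  Spherical harmonics are functions on the sphere; here they are extended by \<open>0\<close> to the whole space,
  so that they form a linear subspace of \<^typ>\<open>'a \<Rightarrow> real\<close>.
\<close>

definition spherical_harmonics :: "nat \<Rightarrow> ('a::euclidean_space \<Rightarrow> real) set" where
  "spherical_harmonics l =
    {(\<lambda>x. indicator (sphere 0 1) x * u x) | u.
       real_polynomial_function u \<and> (\<forall>c x. u (c *\<^sub>R x) = c ^ l * u x) \<and> harmonic u}"

lemma vector_space_function_scale:
  "vector_space (\<lambda>(c::real) (f::'a \<Rightarrow> real) x. c * f x)"
  by unfold_locales (auto simp: fun_eq_iff algebra_simps)

definition harmonic_dim :: "'a::euclidean_space itself \<Rightarrow> nat \<Rightarrow> nat" where
  "harmonic_dim _ l =
    vector_space.dim (\<lambda>(c::real) f x. c * f x) (spherical_harmonics l :: ('a \<Rightarrow> real) set)"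

definition gegenbauer :: "nat \<Rightarrow> nat \<Rightarrow> real poly" where
  "gegenbauer d l = (THE P. degree P = l \<and> poly P 1 = 1 \<and>
     (\<forall>Q. degree Q < l \<longrightarrow>
       (LINT t:{-1..1}|lborel. poly P t * poly Q t * (1 - t\<^sup>2) powr (real d / 2 - 1)) = 0))"

text \<open>
  By the addition theorem, \<open>zonal_kernel TYPE('a) l (x \<bullet> y)\<close> is the reproducing kernel of the
  spherical harmonics of degree \<open>l\<close>.
\<close>

definition zonal_kernel :: "'a::euclidean_space itself \<Rightarrow> nat \<Rightarrow> real \<Rightarrow> real" where
  "zonal_kernel T l t = real (harmonic_dim T l) * poly (gegenbauer (sphere_dim T) l) t"

definition harmonic_proj :: "nat \<Rightarrow> ('a::euclidean_space \<Rightarrow> real) \<Rightarrow> 'a \<Rightarrow> real" where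
  "harmonic_proj l f x = (\<integral>y. zonal_kernel TYPE('a) l (x \<bullet> y) * f y \<partial>sphere_measure)"

definition eigenvalue :: "'a::euclidean_space itself \<Rightarrow> nat \<Rightarrow> real" where
  "eigenvalue T l = real l * (real l + real (sphere_dim T) - 1)"

subsection \<open>Sobolev spaces and worst-case error\<close>

text \<open>
  \<open>g\<close> represents \<open>(1 - \<Delta>\<^sup>*)\<^bsup>s/2\<^esup> f\<close> in \<open>L\<^sub>p\<close>. Such a \<open>g\<close> is determined by \<open>f\<close> up to a null set, so
  the choice made in \<open>sobolev_norm\<close> below does not affect its value.
\<close>

definition is_bessel_image ::
  "ereal \<Rightarrow> real \<Rightarrow> ('a::euclidean_space \<Rightarrow> real) \<Rightarrow> ('a \<Rightarrow> real) \<Rightarrow> bool" where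
  "is_bessel_image p s f g \<longleftrightarrow> g \<in> lp_space p sphere_measure \<and>
    (\<forall>l. \<forall>y\<in>sphere 0 1. harmonic_proj l g y =
       (1 + eigenvalue TYPE('a) l) powr (s / 2) * harmonic_proj l f y)"

definition sobolev_space :: "ereal \<Rightarrow> real \<Rightarrow> ('a::euclidean_space \<Rightarrow> real) set" where
  "sobolev_space p s = {f \<in> lp_space p sphere_measure. \<exists>g. is_bessel_image p s f g}"

definition sobolev_norm :: "ereal \<Rightarrow> real \<Rightarrow> ('a::euclidean_space \<Rightarrow> real) \<Rightarrow> ennreal" where
  "sobolev_norm p s f = lp_norm p sphere_measure (SOME g. is_bessel_image p s f g)"

definition qmc :: "nat \<Rightarrow> (nat \<Rightarrow> 'a) \<Rightarrow> ('a \<Rightarrow> real) \<Rightarrow> real" where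
  "qmc N x f = (\<Sum>k=1..N. f (x k)) / real N"

text \<open>
  Point evaluation requires continuous representatives. For \<open>s > d/p\<close> every element of the Sobolev
  space has exactly one, so the supremum is over the whole unit ball.
\<close>

definition wce ::
  "nat \<Rightarrow> (nat \<Rightarrow> 'a::euclidean_space) \<Rightarrow> ereal \<Rightarrow> real \<Rightarrow> ennreal" where
  "wce N x p s =
    (SUP f \<in> {f \<in> sobolev_space p s. continuous_on (sphere 0 1) f \<and> sobolev_norm p s f \<le> 1}.
       ennreal \<bar>qmc N x f - (\<integral>y. f y \<partial>sphere_measure)\<bar>)"

subsection \<open>Bessel kernel\<close>

text \<open>
  The expansion \<open>\<Sum>\<^sub>l (1 + \<lambda>\<^sub>l)\<^bsup>-s/2\<^esup> Z(d,l) P\<^sub>l(x \<bullet> y)\<close> need not converge pointwise. It is read as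
  prescribing the projections of the integrable function \<open>y \<mapsto> B (x \<bullet> y)\<close>. This determines \<open>B\<close>
  up to a null set of \<open>[-1, 1]\<close>; \<open>bessel_kernel\<close> is one representative.
\<close>

definition is_bessel_kernel :: "'a::euclidean_space itself \<Rightarrow> real \<Rightarrow> (real \<Rightarrow> real) \<Rightarrow> bool" where
  "is_bessel_kernel T s B \<longleftrightarrow> B \<in> borel_measurable borel \<and>
    (\<forall>x\<in>sphere (0::'a) 1. integrable sphere_measure (\<lambda>y. B (x \<bullet> y)) \<and>
      (\<forall>l. \<forall>y\<in>sphere 0 1. harmonic_proj l (\<lambda>z. B (x \<bullet> z)) y =
         (1 + eigenvalue T l) powr (- s / 2) * zonal_kernel T l (x \<bullet> y)))"

definition bessel_kernel :: "'a::euclidean_space itself \<Rightarrow> real \<Rightarrow> real \<Rightarrow> real" where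
  "bessel_kernel T s = (SOME B. is_bessel_kernel T s B)"

text \<open>
  The signed measure \<open>\<mu>\<^sub>N = (1/N) \<Sum>\<^sub>j \<delta>\<^bsub>x j\<^esub> - \<sigma>\<close> is represented by the pair of its two
  terms, which are finite measures; the integral against \<open>\<mu>\<^sub>N\<close> is the difference of the two
  integrals. The image of the uniform measure on \<open>{1..N}\<close> under \<open>x\<close> is \<open>(1/N) \<Sum>\<^sub>j \<delta>\<^bsub>x j\<^esub>\<close>.
\<close>

definition empirical_measure :: "nat \<Rightarrow> (nat \<Rightarrow> 'a::euclidean_space) \<Rightarrow> 'a measure" where
  "empirical_measure N x =
    distr (uniform_count_measure {1..N}) (restrict_space borel (sphere 0 1)) x"

definition integral_mu ::
  "nat \<Rightarrow> (nat \<Rightarrow> 'a::euclidean_space) \<Rightarrow> ('a \<Rightarrow> real) \<Rightarrow> real" where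
  "integral_mu N x F = (\<integral>z. F z \<partial>empirical_measure N x) - (\<integral>z. F z \<partial>sphere_measure)"

definition bessel_error ::
  "nat \<Rightarrow> (nat \<Rightarrow> 'a::euclidean_space) \<Rightarrow> real \<Rightarrow> 'a \<Rightarrow> real" where
  "bessel_error N x s y = (\<Sum>j=1..N. bessel_kernel TYPE('a) s (x j \<bullet> y)) / real N - 1"

end

theory Submission imports Defs "HOL-Probability.Probability_Measure"
begin

text \<open>
  A function \<open>f\<close> of the Sobolev space is the convolution \<open>f x = \<integral>y. B (x \<bullet> y) * g y\<close> of the Bessel
  kernel with \<open>g = (1 - \<Delta>\<^sup>*)\<^bsup>s/2\<^esup> f\<close>, so that the quadrature error of \<open>f\<close> is the pairing of \<open>g\<close> with
  the function \<open>\<integral>x. B (x \<bullet> y) \<partial>\<mu>\<^sub>N\<close> of \<open>y\<close>. Since \<open>g\<close> runs through the unit ball of \<open>L\<^sub>p\<close>, the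
  supremum is the \<open>L\<^sub>q\<close> norm of that function.

  The analytic input is that \<open>B (x \<bullet> _)\<close> lies in \<open>L\<^sub>q\<close> for \<open>s > d/p\<close> and that convolution with it maps
  \<open>L\<^sub>p\<close> into the continuous functions. For the multiplier \<open>(l + 1)\<^bsup>-s\<^esup>\<close> in place of
  \<open>(1 + \<lambda>\<^sub>l)\<^bsup>-s/2\<^esup>\<close> the kernel is an average of Poisson kernels against a gamma density, whose norms
  are explicit. Expanding \<open>(1 + \<lambda>\<^sub>l)\<^bsup>-s/2\<^esup>\<close> in powers of \<open>1/(l + 1)\<close> reduces the general case to
  finitely many such kernels of orders \<open>s, s + 1, \<dots>\<close> and a uniformly convergent zonal series.

  The zonal kernels enter through the generating function of the Poisson kernel, which is an
  approximate identity; this yields the reproducing property. Completeness follows from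
  Stone--Weierstrass. The kernel is constructed first as any function with these properties;
  completeness then transfers them to the representative chosen by \<^const>\<open>bessel_kernel\<close>.
\<close>

subsection \<open>Rotation invariance\<close>

text \<open>The usual formula for the zonal kernel, \<open>(2 l + d - 1)/(d - 1)\<close> times a
  Gegenbauer polynomial of index \<open>(d - 1)/2\<close>, degenerates on the circle. The
  coefficients of \<open>(1 - r^2) (1 - 2 r t + r^2)^(-(d + 1)/2)\<close> are the reproducing
  kernels for every \<open>d \<ge> 1\<close>, normalization included: the Poisson integral of a
  harmonic of degree \<open>l\<close> is \<open>r^l\<close> times a constant, and
  \<open>r \<rightarrow> 1\<close> identifies the constant as the point value. The dimension and the
  normalized Gegenbauer polynomial are read off from this kernel.

  The obstacle is the singularity of the Bessel kernel at \<open>t = 1\<close> for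
  \<open>s \<le> d\<close>: its expansion does not yield the \<open>L_q\<close> bounds term by term.
  Positivity and total mass one of the Poisson kernel do, since \<open>(l + 1)^(-s)\<close> is the
  Laplace transform of a gamma density at \<open>l\<close>. The remainder of the expansion in
  \<open>1/(l + 1)\<close> is taken of order \<open>d + 2\<close>, because the zonal harmonics are
  bounded by a multiple of \<open>(l + 2)^d\<close> and a summable factor of order
  \<open>l^(-2)\<close> has to remain.

  For \<open>q = \<infinity>\<close> the norm need not be attained by a pairing, so the lower
  estimate is proved for each number below the norm.\<close>

lemma emeasure_lborel_open_pos:
  assumes "open S" "S \<noteq> {}"
  shows "emeasure lborel (S :: 'a::euclidean_space set) \<noteq> 0"
proof
  assume "emeasure lborel S = 0"
  then have "negligible S"
    using assms by (simp add: negligible_iff_emeasure0)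
  then show False using open_not_negligible[OF assms] by simp
qed

lemma ball_borel: "ball (x::'a::euclidean_space) r \<in> sets borel"
  by (rule borel_open) simp

lemma nn_integral_lborel_translate:
  fixes f :: "'a::euclidean_space \<Rightarrow> ennreal"
  assumes [measurable]: "f \<in> borel_measurable borel"
  shows "(\<integral>\<^sup>+y. f (t + y) \<partial>lborel) = (\<integral>\<^sup>+y. f y \<partial>lborel)"
proof -
  have "(\<integral>\<^sup>+y. f y \<partial>lborel) = (\<integral>\<^sup>+y. f y \<partial>distr lborel borel ((+) t))"
    by (simp only: lborel_distr_plus)
  also have "\<dots> = (\<integral>\<^sup>+y. f (t + y) \<partial>lborel)"
    by (subst nn_integral_distr) auto
  finally show ?thesis ..
qed

lemma nn_integral_lborel_reflect:
  fixes f :: "'a::euclidean_space \<Rightarrow> ennreal"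
  assumes [measurable]: "f \<in> borel_measurable borel"
  shows "(\<integral>\<^sup>+y. f (- y) \<partial>lborel) = (\<integral>\<^sup>+y. f y \<partial>lborel)"
proof -
  have "lborel = distr lborel borel (uminus :: 'a \<Rightarrow> 'a)"
    using lborel_affine[of "-1" "0::'a"] by (simp add: density_1)
  then have "(\<integral>\<^sup>+y. f y \<partial>lborel) = (\<integral>\<^sup>+y. f y \<partial>distr lborel borel uminus)"
    by simp
  also have "\<dots> = (\<integral>\<^sup>+y. f (- y) \<partial>lborel)"
    by (subst nn_integral_distr) auto
  finally show ?thesis ..
qed

lemma orthogonal_transformation_measurable:
  fixes T :: "'a::euclidean_space \<Rightarrow> 'a"
  shows "orthogonal_transformation T \<Longrightarrow> T \<in> borel_measurable borel"
  by (intro borel_measurable_continuous_onI linear_continuous_on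
      linear_conv_bounded_linear[THEN iffD1] orthogonal_transformation_linear)

text \<open>
  Uniqueness of Haar measure: the image of \<^const>\<open>lborel\<close> under \<open>T\<close> is translation invariant, and
  comparing the two measures on the unit ball, which \<open>T\<close> preserves, shows that they agree.
\<close>

lemma nn_integral_lborel_orthogonal:
  fixes g :: "'a::euclidean_space \<Rightarrow> ennreal" and T :: "'a \<Rightarrow> 'a"
  assumes T: "orthogonal_transformation T" and [measurable]: "g \<in> borel_measurable borel"
  shows "(\<integral>\<^sup>+y. g (T y) \<partial>lborel) = (\<integral>\<^sup>+y. g y \<partial>lborel)"
proof -
  note T_meas = orthogonal_transformation_measurable[OF T]
  define B where "B = ball (0::'a) 1"
  define f :: "'a \<Rightarrow> ennreal" where "f = indicator B"
  have [measurable]: "f \<in> borel_measurable borel" unfolding f_def B_def by (intro borel_measurable_indicator ball_borel)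
  have Tlin: "T (a + b) = T a + T b" for a b
    using orthogonal_transformation_linear[OF T] by (rule linear_add)
  have Tm: "T (- a) = - T a" for a
    using orthogonal_transformation_linear[OF T] by (rule linear_neg)
  have inv: "(\<integral>\<^sup>+y. h (x + T y) \<partial>lborel) = (\<integral>\<^sup>+y. h (T y) \<partial>lborel)"
    if [measurable]: "h \<in> borel_measurable borel" for h :: "'a \<Rightarrow> ennreal" and x
  proof -
    obtain z where z: "T z = x" using orthogonal_transformation_surj[OF T] by (metis surjD)
    have "(\<integral>\<^sup>+y. h (x + T y) \<partial>lborel) = (\<integral>\<^sup>+y. h (T (z + y)) \<partial>lborel)"
      by (simp add: Tlin z)
    also have "\<dots> = (\<integral>\<^sup>+y. h (T y) \<partial>lborel)"
      by (rule nn_integral_lborel_translate) (rule measurable_compose[OF T_meas that])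
    finally show ?thesis .
  qed
  have fs: "f (- y) = f y" "f (T y) = f y" for y
    by (auto simp: f_def B_def indicator_def orthogonal_transformation_norm[OF T])
  have f_int: "(\<integral>\<^sup>+x. f x \<partial>lborel) = emeasure lborel B"
    by (simp add: f_def B_def)
  have f_meas: "f \<in> borel_measurable borel" and g_meas: "g \<in> borel_measurable borel" by fact+
  have T_snd: "(\<lambda>p :: 'a \<times> 'a. T (snd p)) \<in> borel_measurable (lborel \<Otimes>\<^sub>M lborel)"
    by (rule measurable_compose[OF _ T_meas]) simp
  have T_single: "(\<lambda>y. h (x + T y)) \<in> borel_measurable borel" "(\<lambda>y. h (x - T y)) \<in> borel_measurable borel"
    if "h \<in> borel_measurable borel" for h :: "'a \<Rightarrow> ennreal" and x
    by (rule measurable_compose[OF _ that], intro borel_measurable_add borel_measurable_diff T_meas; simp)+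
  have meas1: "(\<lambda>(x, y). f x * g (x + T y)) \<in> borel_measurable (lborel \<Otimes>\<^sub>M lborel)"
    unfolding split_beta
    by (intro borel_measurable_times_ennreal measurable_compose[OF _ f_meas]
        measurable_compose[OF _ g_meas] borel_measurable_add T_snd) simp_all
  have meas2: "(\<lambda>(x, y). f (x - T y) * g x) \<in> borel_measurable (lborel \<Otimes>\<^sub>M lborel)"
    unfolding split_beta
    by (intro borel_measurable_times_ennreal measurable_compose[OF _ f_meas]
        measurable_compose[OF _ g_meas] borel_measurable_diff T_snd) simp_all
  \<comment> \<open>The double integral of \<open>f x * g (x + T y)\<close> is evaluated in both
    orders. Integrating over \<open>y\<close> inside leaves \<open>g\<close> composed with
    \<open>T\<close>; translating \<open>x\<close> by \<open>- T y\<close> moves \<open>T\<close>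
    onto \<open>f\<close>, whose invariance under \<open>T\<close> and under negation removes
    it.\<close>
  have e1: "(\<integral>\<^sup>+x. f x \<partial>lborel) * (\<integral>\<^sup>+y. g (T y) \<partial>lborel)
      = (\<integral>\<^sup>+x. f x * (\<integral>\<^sup>+y. g (x + T y) \<partial>lborel) \<partial>lborel)"
    by (simp add: inv nn_integral_multc)
  have e2: "(\<integral>\<^sup>+x. f x * (\<integral>\<^sup>+y. g (x + T y) \<partial>lborel) \<partial>lborel) = (\<integral>\<^sup>+x. (\<integral>\<^sup>+y. f x * g (x + T y) \<partial>lborel) \<partial>lborel)"
    by (intro nn_integral_cong nn_integral_cmult[symmetric]) (simp add: T_single)
  have e3: "(\<integral>\<^sup>+x. (\<integral>\<^sup>+y. f x * g (x + T y) \<partial>lborel) \<partial>lborel) = (\<integral>\<^sup>+y. (\<integral>\<^sup>+x. f x * g (x + T y) \<partial>lborel) \<partial>lborel)"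
    by (rule lborel_pair.Fubini'[OF meas1, symmetric])
  have e4: "(\<integral>\<^sup>+y. (\<integral>\<^sup>+x. f x * g (x + T y) \<partial>lborel) \<partial>lborel) = (\<integral>\<^sup>+y. (\<integral>\<^sup>+x. f (x - T y) * g x \<partial>lborel) \<partial>lborel)"
  proof (rule nn_integral_cong)
    fix y
    show "(\<integral>\<^sup>+x. f x * g (x + T y) \<partial>lborel) = (\<integral>\<^sup>+x. f (x - T y) * g x \<partial>lborel)"
    proof -
      have m: "(\<lambda>x. f (x - T y) * g x) \<in> borel_measurable borel"
        by (intro borel_measurable_times_ennreal g_meas measurable_compose[OF _ f_meas]) simp
      have "(\<lambda>x. f x * g (x + T y)) = (\<lambda>x. f (T y + x - T y) * g (T y + x))"
        by (simp add: add.commute[of _ "T y"])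
      then show ?thesis
        using nn_integral_lborel_translate[OF m, of "T y"] by (simp only:)
    qed
  qed
  have e5: "(\<integral>\<^sup>+y. (\<integral>\<^sup>+x. f (x - T y) * g x \<partial>lborel) \<partial>lborel) = (\<integral>\<^sup>+x. (\<integral>\<^sup>+y. f (x - T y) * g x \<partial>lborel) \<partial>lborel)"
    by (rule lborel_pair.Fubini'[OF meas2])
  have e6: "(\<integral>\<^sup>+x. (\<integral>\<^sup>+y. f (x - T y) * g x \<partial>lborel) \<partial>lborel) = (\<integral>\<^sup>+x. (\<integral>\<^sup>+y. f (x - T y) \<partial>lborel) * g x \<partial>lborel)"
    using T_single(2)[OF f_meas] by (intro nn_integral_cong nn_integral_multc) auto
  have e7: "(\<integral>\<^sup>+x. (\<integral>\<^sup>+y. f (x - T y) \<partial>lborel) * g x \<partial>lborel) = (\<integral>\<^sup>+x. (\<integral>\<^sup>+y. f y \<partial>lborel) * g x \<partial>lborel)"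
  proof (rule nn_integral_cong)
    fix x
    have "(\<integral>\<^sup>+y. f (x - T y) \<partial>lborel) = (\<integral>\<^sup>+y. f (x + T y) \<partial>lborel)"
      using nn_integral_lborel_reflect[OF T_single(1)[OF f_meas], of x] by (simp add: Tm)
    also have "\<dots> = (\<integral>\<^sup>+y. f y \<partial>lborel)"
      using inv[of f x] by (simp add: fs)
    finally show "(\<integral>\<^sup>+y. f (x - T y) \<partial>lborel) * g x = (\<integral>\<^sup>+y. f y \<partial>lborel) * g x"
      by (rule arg_cong)
  qed
  have e8: "(\<integral>\<^sup>+x. (\<integral>\<^sup>+y. f y \<partial>lborel) * g x \<partial>lborel) = (\<integral>\<^sup>+y. f y \<partial>lborel) * (\<integral>\<^sup>+x. g x \<partial>lborel)"
    by (rule nn_integral_cmult) simp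
  have eq: "emeasure lborel B * (\<integral>\<^sup>+y. g (T y) \<partial>lborel) = emeasure lborel B * (\<integral>\<^sup>+x. g x \<partial>lborel)"
    unfolding f_int[symmetric]
    by (rule trans[OF e1 trans[OF e2 trans[OF e3 trans[OF e4 trans[OF e5 trans[OF e6 trans[OF e7 e8]]]]]]])
  have "emeasure lborel B \<noteq> 0"
    unfolding B_def using emeasure_lborel_open_pos[of "ball (0::'a) 1"] by auto
  moreover have "emeasure lborel B \<noteq> \<infinity>"
    using emeasure_lborel_ball_finite[of "0::'a" 1] unfolding B_def by simp
  ultimately show ?thesis
    using eq unfolding ennreal_mult_cancel_left by auto
qed

section \<open>The normalized surface measure and its invariance under orthogonal maps\<close>

abbreviation unit_sphere :: "'a::euclidean_space set" where
  "unit_sphere \<equiv> sphere 0 1"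

lemma sgn_measurable_euclidean [measurable]: "(sgn :: 'a::euclidean_space \<Rightarrow> 'a) \<in> borel_measurable borel"
proof -
  have "(\<lambda>x::'a. inverse (norm x) *\<^sub>R x) \<in> borel_measurable borel" by measurable
  then show ?thesis by (simp add: sgn_div_norm[abs_def])
qed

lemma unit_sphere_borel [measurable]: "(unit_sphere :: 'a::euclidean_space set) \<in> sets borel"
  by (intro borel_closed) simp

lemma space_sphere_measure [simp]: "space sphere_measure = unit_sphere"
  by (simp add: sphere_measure_def space_restrict_space)

lemma sets_sphere_measure [measurable_cong]:
  "sets (sphere_measure :: 'a measure) = sets (restrict_space borel (unit_sphere :: 'a::euclidean_space set))"
  unfolding sphere_measure_def by (intro sets_restrict_space_cong) simp

lemma measurable_on_sphere:
  assumes "(f :: 'a::euclidean_space \<Rightarrow> 'b::topological_space) \<in> borel_measurable borel"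
  shows "f \<in> borel_measurable sphere_measure"
  unfolding measurable_cong_sets[OF sets_sphere_measure refl]
  using assms by (rule measurable_restrict_space1)

definition ball_prob :: "'a::euclidean_space measure" where
  "ball_prob = uniform_measure lborel (ball 0 1)"

lemma emeasure_unit_ball: "emeasure lborel (ball (0::'a::euclidean_space) 1) \<noteq> 0"
  "emeasure lborel (ball (0::'a::euclidean_space) 1) \<noteq> \<infinity>"
  using emeasure_lborel_open_pos[of "ball (0::'a) 1"] emeasure_lborel_ball_finite[of "0::'a" 1]
  by auto

lemma nn_integral_ball_prob:
  fixes f :: "'a::euclidean_space \<Rightarrow> ennreal"
  assumes [measurable]: "f \<in> borel_measurable borel"
  shows "(\<integral>\<^sup>+y. f y \<partial>ball_prob) =
    (\<integral>\<^sup>+y. f y * indicator (ball 0 1) y \<partial>lborel) / emeasure lborel (ball (0::'a) 1)"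
  unfolding ball_prob_def by (rule nn_integral_uniform_measure) (auto simp: mult.commute)

lemma sets_ball_prob [measurable_cong, simp]: "sets ball_prob = sets borel"
  by (simp add: ball_prob_def)

lemma space_ball_prob [simp]: "space ball_prob = UNIV"
  by (simp add: ball_prob_def)

lemma prob_space_ball_prob: "prob_space (ball_prob :: 'a::euclidean_space measure)"
  unfolding ball_prob_def using emeasure_unit_ball by (intro prob_space_uniform_measure) auto

lemma AE_ball_prob_nonzero: "AE y in (ball_prob :: 'a::euclidean_space measure). y \<noteq> 0"
  unfolding ball_prob_def using emeasure_unit_ball[where 'a='a]
  by (intro AE_uniform_measureI AE_I[where N="{0}"]) auto

text \<open>Nothing is known about \<open>f\<close> off the sphere, so its value at
  \<open>sgn 0 = 0\<close> is cut off by the indicator.\<close>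

lemma nn_integral_sphere_measure:
  fixes f :: "'a::euclidean_space \<Rightarrow> ennreal"
  assumes f: "f \<in> borel_measurable sphere_measure"
  shows "(\<integral>\<^sup>+y. f y \<partial>sphere_measure) =
    (\<integral>\<^sup>+y. f (sgn y) * indicator unit_sphere (sgn y) \<partial>ball_prob)"
proof -
  have f': "(\<lambda>y. f y * indicator unit_sphere y) \<in> borel_measurable borel"
    using f unfolding measurable_cong_sets[OF sets_sphere_measure refl]
    by (subst (asm) borel_measurable_restrict_space_iff_ennreal) auto
  have "(\<integral>\<^sup>+y. f y \<partial>sphere_measure) = (\<integral>\<^sup>+y. f y * indicator unit_sphere y \<partial>distr ball_prob borel sgn)"
    unfolding sphere_measure_def ball_prob_def
    by (rule nn_integral_restrict_space) simp
  also have "\<dots> = (\<integral>\<^sup>+y. f (sgn y) * indicator unit_sphere (sgn y) \<partial>ball_prob)"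
    by (rule nn_integral_distr) (use f' in auto)
  finally show ?thesis .
qed

lemma prob_space_sphere_measure: "prob_space (sphere_measure :: 'a::euclidean_space measure)"
proof
  interpret prob_space "ball_prob :: 'a measure" by (rule prob_space_ball_prob)
  have "emeasure (sphere_measure :: 'a measure) (space sphere_measure) = (\<integral>\<^sup>+y. 1 \<partial>(sphere_measure::'a measure))"
    by simp
  also have "\<dots> = (\<integral>\<^sup>+y. 1 * indicator unit_sphere (sgn y) \<partial>(ball_prob::'a measure))"
    by (rule nn_integral_sphere_measure) simp
  also have "\<dots> = (\<integral>\<^sup>+y. 1 \<partial>(ball_prob::'a measure))"
    by (rule nn_integral_cong_AE) (use AE_ball_prob_nonzero in \<open>auto simp: indicator_def norm_sgn\<close>)
  also have "\<dots> = 1" using emeasure_space_1 by simp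
  finally show "emeasure (sphere_measure :: 'a measure) (space sphere_measure) = 1" .
qed

interpretation sphere: prob_space "sphere_measure :: 'a::euclidean_space measure"
  by (rule prob_space_sphere_measure)

lemma orthogonal_transformation_sphere_measurable:
  assumes "orthogonal_transformation (T :: 'a::euclidean_space \<Rightarrow> 'a)"
  shows "T \<in> measurable sphere_measure sphere_measure"
  unfolding measurable_cong_sets[OF sets_sphere_measure sets_sphere_measure]
  using orthogonal_transformation_measurable[OF assms]
  by (intro measurable_restrict_space3) (auto simp: orthogonal_transformation_norm[OF assms])

text \<open>A linear isometry commutes with \<open>sgn\<close> and preserves the unit ball, so the
  invariance of Lebesgue measure descends to the cone measure.\<close>

lemma nn_integral_sphere_orthogonal:
  fixes f :: "'a::euclidean_space \<Rightarrow> ennreal" and T :: "'a \<Rightarrow> 'a"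
  assumes T: "orthogonal_transformation T" and f: "f \<in> borel_measurable sphere_measure"
  shows "(\<integral>\<^sup>+y. f (T y) \<partial>sphere_measure) = (\<integral>\<^sup>+y. f y \<partial>sphere_measure)"
proof -
  note [measurable] = orthogonal_transformation_measurable[OF T]
  define g where "g y = f (sgn y) * indicator unit_sphere (sgn y)" for y
  have "(\<lambda>y. f y * indicator unit_sphere y) \<in> borel_measurable borel"
    using f unfolding measurable_cong_sets[OF sets_sphere_measure refl]
    by (subst (asm) borel_measurable_restrict_space_iff_ennreal) auto
  then have [measurable]: "g \<in> borel_measurable borel"
    unfolding g_def by (rule measurable_compose[rotated]) simp
  have sgnT: "sgn (T y) = T (sgn y)" for y
    by (simp add: sgn_div_norm orthogonal_transformation_norm[OF T] orthogonal_transformation_scaleR[OF T])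
  have nT: "norm (T y) = norm y" for y by (rule orthogonal_transformation_norm[OF T])
  have fT: "(\<lambda>y. f (T y)) \<in> borel_measurable sphere_measure"
    by (rule measurable_compose[OF orthogonal_transformation_sphere_measurable[OF T] f])
  have "(\<integral>\<^sup>+y. f (T y) \<partial>sphere_measure) = (\<integral>\<^sup>+y. g (T y) \<partial>ball_prob)"
    unfolding nn_integral_sphere_measure[OF fT] g_def
    by (intro nn_integral_cong) (auto simp: sgnT indicator_def nT)
  also have "\<dots> = (\<integral>\<^sup>+y. g (T y) * indicator (ball 0 1) (T y) \<partial>lborel) / emeasure lborel (ball (0::'a) 1)"
    by (subst nn_integral_ball_prob) (auto simp: indicator_def nT)
  also have "\<dots> = (\<integral>\<^sup>+y. g y * indicator (ball 0 1) y \<partial>lborel) / emeasure lborel (ball (0::'a) 1)"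
    by (subst nn_integral_lborel_orthogonal[OF T, of "\<lambda>y. g y * indicator (ball 0 1) y"]) (auto intro!: borel_measurable_times_ennreal borel_measurable_indicator ball_borel)
  also have "\<dots> = (\<integral>\<^sup>+y. f y \<partial>sphere_measure)"
    unfolding nn_integral_sphere_measure[OF f] g_def[symmetric]
    by (subst nn_integral_ball_prob) auto
  finally show ?thesis .
qed

lemma distr_sphere_orthogonal:
  assumes T: "orthogonal_transformation (T :: 'a::euclidean_space \<Rightarrow> 'a)"
  shows "distr sphere_measure sphere_measure T = sphere_measure"
proof (rule measure_eqI)
  fix A assume "A \<in> sets (distr sphere_measure sphere_measure T)"
  then have A [measurable]: "A \<in> sets sphere_measure" by simp
  note [measurable] = orthogonal_transformation_sphere_measurable[OF T]
  have "emeasure (distr sphere_measure sphere_measure T) A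
      = (\<integral>\<^sup>+y. indicator A y \<partial>distr sphere_measure sphere_measure T)"
    by simp
  also have "\<dots> = (\<integral>\<^sup>+y. indicator A (T y) \<partial>sphere_measure)"
    by (rule nn_integral_distr) auto
  also have "\<dots> = emeasure sphere_measure A"
    by (subst nn_integral_sphere_orthogonal[OF T]) auto
  finally show "emeasure (distr sphere_measure sphere_measure T) A = emeasure sphere_measure A" .
qed simp

lemma integral_sphere_orthogonal:
  fixes f :: "'a::euclidean_space \<Rightarrow> real" and T :: "'a \<Rightarrow> 'a"
  assumes T: "orthogonal_transformation T" and f: "f \<in> borel_measurable sphere_measure"
  shows "(\<integral>y. f (T y) \<partial>sphere_measure) = (\<integral>y. f y \<partial>sphere_measure)"
  using integral_distr[OF orthogonal_transformation_sphere_measurable[OF T] f]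
  by (simp add: distr_sphere_orthogonal[OF T])

lemma integrable_sphere_orthogonal:
  fixes f :: "'a::euclidean_space \<Rightarrow> real" and T :: "'a \<Rightarrow> 'a"
  assumes T: "orthogonal_transformation T" and f: "f \<in> borel_measurable sphere_measure"
  shows "integrable sphere_measure (\<lambda>y. f (T y)) = integrable sphere_measure f"
  using integrable_distr_eq[OF orthogonal_transformation_sphere_measurable[OF T] f]
  by (simp add: distr_sphere_orthogonal[OF T])

text \<open>The Householder reflection in the hyperplane orthogonal to \<open>a - b\<close>. Equal
  norms give \<open>v \<bullet> v = 2 * (v \<bullet> a)\<close>, so that the subtracted multiple of
  \<open>v\<close> is exactly \<open>v\<close>.\<close>

lemma reflection_exists:
  fixes a b :: "'a::euclidean_space"
  assumes "norm a = norm b"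
  obtains T where "orthogonal_transformation T" "T a = b" "T b = a"
proof (cases "a = b")
  case True
  show ?thesis by (rule that[of "\<lambda>x. x"]) (use True in auto)
next
  case False
  define v where "v = a - b"
  have v: "v \<bullet> v \<noteq> 0" using False by (simp add: v_def)
  have ab: "a \<bullet> a = b \<bullet> b" using assms by (simp add: norm_eq)
  define T where "T y = y - (2 * (v \<bullet> y) / (v \<bullet> v)) *\<^sub>R v" for y
  have "orthogonal_transformation T"
    unfolding orthogonal_transformation_def
  proof
    show "linear T" unfolding T_def
      by (intro linearI) (auto simp: algebra_simps inner_add_right add_divide_distrib)
    show "\<forall>y w. T y \<bullet> T w = y \<bullet> w"
      using v by (auto simp: T_def inner_diff_left inner_diff_right inner_commute field_simps)
  qed
  moreover have "v \<bullet> v = 2 * (v \<bullet> a)" "v \<bullet> v = - 2 * (v \<bullet> b)"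
    using ab by (auto simp: v_def inner_diff_left inner_diff_right inner_commute)
  then have "2 * (v \<bullet> a) / (v \<bullet> v) = 1" "2 * (v \<bullet> b) / (v \<bullet> v) = - 1"
    using v by (simp_all add: divide_eq_eq)
  then have "T a = b" "T b = a" by (auto simp: T_def v_def)
  ultimately show ?thesis by (rule that)
qed

section \<open>Zonal functions and continuous functions on the sphere\<close>

lemma zonal_measurable [measurable (raw)]:
  fixes h :: "real \<Rightarrow> 'b::topological_space" and x :: "'a::euclidean_space"
  assumes "h \<in> borel_measurable borel"
  shows "(\<lambda>y. h (x \<bullet> y)) \<in> borel_measurable sphere_measure"
    "(\<lambda>y. h (y \<bullet> x)) \<in> borel_measurable sphere_measure"
  by (intro measurable_on_sphere measurable_compose[OF _ assms]; simp)+

text \<open>The reflection exchanging \<open>x\<close> and \<open>z\<close> carries one integrand to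
  the other.\<close>

lemma nn_integral_zonal_cong:
  fixes x z :: "'a::euclidean_space"
  assumes [measurable]: "h \<in> borel_measurable borel" and "norm x = norm z"
  shows "(\<integral>\<^sup>+y. h (x \<bullet> y) \<partial>sphere_measure) = (\<integral>\<^sup>+y. h (z \<bullet> y) \<partial>sphere_measure)"
proof -
  obtain T where T: "orthogonal_transformation T" "T x = z" "T z = x"
    using reflection_exists[OF assms(2)] .
  have "T y \<bullet> x = T y \<bullet> T z" for y using T by simp
  also have "\<dots> y = y \<bullet> z" for y
    using T(1) by (simp add: orthogonal_transformation_def)
  finally have *: "x \<bullet> T y = z \<bullet> y" for y by (simp add: inner_commute)
  show ?thesis
    using nn_integral_sphere_orthogonal[OF T(1) zonal_measurable(1)[OF assms(1), of x]] by (simp add: *)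
qed

text \<open>The surface measure has full support: the cone over \<open>U\<close> inside the
  punctured ball is open, and it contains the point halfway between the origin and
  \<open>x\<close>.\<close>

lemma emeasure_sphere_open_pos:
  assumes U: "open U" and x: "x \<in> U" "x \<in> (unit_sphere :: 'a::euclidean_space set)"
  shows "emeasure sphere_measure (U \<inter> unit_sphere) \<noteq> 0"
proof -
  have [measurable]: "U \<in> sets borel" using U by simp
  have UM [measurable]: "U \<inter> unit_sphere \<in> sets sphere_measure"
    unfolding sets_sphere_measure by (auto simp: sets_restrict_space)
  define V where "V = {y. y \<in> ball 0 1 - {0::'a} \<and> sgn y \<in> U}"
  have V: "V = (sgn -` U) \<inter> (ball 0 1 - {0})" by (auto simp: V_def)
  have "continuous_on (ball 0 1 - {0::'a}) sgn"
    by (intro continuous_intros) auto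
  then have "open V"
    unfolding V using U by (intro continuous_open_preimage[THEN open_Int[of UNIV, simplified]] | simp add: continuous_on_open_vimage open_delete)+
  moreover have "(1/2) *\<^sub>R x \<in> V" using x by (auto simp: V_def sgn_scaleR sgn_div_norm)
  ultimately have "emeasure lborel V \<noteq> 0"
    using emeasure_lborel_open_pos by auto
  moreover have [measurable]: "V \<in> sets borel" using \<open>open V\<close> by simp
  moreover have "emeasure sphere_measure (U \<inter> unit_sphere) = emeasure lborel V / emeasure lborel (ball (0::'a) 1)"
  proof -
    have "emeasure sphere_measure (U \<inter> unit_sphere) = (\<integral>\<^sup>+y. indicator (U \<inter> unit_sphere) y \<partial>sphere_measure)"
      by simp
    also have "\<dots> = (\<integral>\<^sup>+y. indicator (U \<inter> unit_sphere) (sgn y) * indicator unit_sphere (sgn y) \<partial>ball_prob)"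
      by (rule nn_integral_sphere_measure) simp
    also have "\<dots> = (\<integral>\<^sup>+y. indicator (sgn -` (U \<inter> unit_sphere)) y \<partial>ball_prob)"
      by (intro nn_integral_cong) (auto simp: indicator_def)
    also have "\<dots> = (\<integral>\<^sup>+y. indicator (sgn -` (U \<inter> unit_sphere)) y * indicator (ball 0 1) y \<partial>lborel) / emeasure lborel (ball (0::'a) 1)"
      by (rule nn_integral_ball_prob, rule borel_measurable_indicator) 
         (use measurable_sets[OF sgn_measurable_euclidean, of "U \<inter> unit_sphere"] in auto)
    also have "(\<lambda>y. indicator (sgn -` (U \<inter> unit_sphere)) y * indicator (ball 0 1) y :: ennreal) = indicator V"
      by (auto simp: V_def fun_eq_iff indicator_def norm_sgn sgn_zero_iff)
    finally show ?thesis by simp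
  qed
  ultimately show ?thesis
    using emeasure_unit_ball[where 'a='a] by (auto simp: ennreal_divide_eq_0_iff)
qed

text \<open>Full support upgrades almost everywhere equality. This is what allows point values at
  the nodes to be recovered from projections, which see functions only up to null sets.\<close>

lemma continuous_AE_eq_sphere:
  fixes f g :: "'a::euclidean_space \<Rightarrow> real"
  assumes "continuous_on unit_sphere f" "continuous_on unit_sphere g"
    and ae: "AE y in sphere_measure. f y = g y" and x: "x \<in> unit_sphere"
  shows "f x = g x"
proof (rule ccontr)
  assume "f x \<noteq> g x"
  have "continuous_on unit_sphere (\<lambda>y. f y - g y)" using assms by (intro continuous_intros)
  moreover have "open (- {0::real})" by (rule open_Compl) simp
  ultimately obtain U where U: "open U" "U \<inter> unit_sphere = (\<lambda>y. f y - g y) -` (- {0}) \<inter> unit_sphere"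
    by (meson continuous_on_open_invariant)
  from ae have "emeasure sphere_measure {y \<in> space sphere_measure. \<not> f y = g y} = 0"
  proof (rule AE_E)
    fix N assume N: "{y \<in> space sphere_measure. \<not> f y = g y} \<subseteq> N" "emeasure sphere_measure N = 0" "N \<in> sets sphere_measure"
    then show ?thesis using emeasure_mono[OF N(1,3)] by simp
  qed
  also have "{y \<in> space sphere_measure. \<not> f y = g y} = U \<inter> unit_sphere" using U by auto
  finally have "emeasure sphere_measure (U \<inter> unit_sphere) = 0" .
  moreover have "x \<in> U \<inter> unit_sphere" unfolding U(2) using x \<open>f x \<noteq> g x\<close> by simp
  ultimately show False using emeasure_sphere_open_pos[OF U(1), of x] by blast
qed

lemma continuous_on_sphere_measurable:
  fixes f :: "'a::euclidean_space \<Rightarrow> real"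
  assumes "continuous_on unit_sphere f" shows "f \<in> borel_measurable sphere_measure"
  unfolding measurable_cong_sets[OF sets_sphere_measure refl]
  using assms by (rule borel_measurable_continuous_on_restrict)

lemma continuous_on_sphere_bounded:
  fixes f :: "'a::euclidean_space \<Rightarrow> real"
  assumes "continuous_on unit_sphere f"
  obtains C where "C > 0" "\<And>y. y \<in> unit_sphere \<Longrightarrow> \<bar>f y\<bar> \<le> C"
proof -
  have "bounded (f ` unit_sphere)"
    by (intro compact_imp_bounded compact_continuous_image assms) simp
  then obtain C where "\<forall>z\<in>f ` unit_sphere. norm z \<le> C"
    unfolding bounded_iff by blast
  then have "\<bar>f y\<bar> \<le> max C 1" if "y \<in> unit_sphere" for y
    using that by (fastforce intro: max.coboundedI1)
  then show ?thesis by (intro that[of "max C 1"]) auto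
qed

lemma continuous_on_sphere_integrable:
  fixes f :: "'a::euclidean_space \<Rightarrow> real"
  assumes "continuous_on unit_sphere f" shows "integrable sphere_measure f"
proof -
  obtain C where "\<And>y. y \<in> unit_sphere \<Longrightarrow> \<bar>f y\<bar> \<le> C"
    using continuous_on_sphere_bounded[OF assms] by metis
  then show ?thesis
    by (intro sphere.integrable_const_bound[of _ C] continuous_on_sphere_measurable assms) auto
qed

subsection \<open>Directional derivatives of polynomial functions\<close>

text \<open>Taking the directional derivative from the Frechet derivative makes linearity in the
  direction available; it is meaningful for differentiable \<open>g\<close>, in particular for
  polynomial functions.\<close>

definition pd :: "'a::euclidean_space \<Rightarrow> ('a \<Rightarrow> real) \<Rightarrow> 'a \<Rightarrow> real" where
  "pd v g y = frechet_derivative g (at y) v"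

lemma pd_has_derivative:
  "real_polynomial_function g \<Longrightarrow> (g has_derivative (\<lambda>v. pd v g y)) (at y)"
  unfolding pd_def using differentiable_at_real_polynomial_function frechet_derivative_works by blast

lemma pd_eqI: "(g has_derivative D) (at y) \<Longrightarrow> pd v g y = D v"
  unfolding pd_def using frechet_derivative_at by metis

lemma pd_bounded_linear: "bounded_linear f \<Longrightarrow> pd v f y = f v"
  by (rule pd_eqI, rule bounded_linear_imp_has_derivative)

lemma pd_const [simp]: "pd v (\<lambda>_. c) y = 0"
  by (rule pd_eqI[OF has_derivative_const])

lemma pd_inner: "pd v (\<lambda>y. a \<bullet> y) y = a \<bullet> v"
  by (intro pd_bounded_linear bounded_linear_inner_right)

lemma pd_add:
  "real_polynomial_function f \<Longrightarrow> real_polynomial_function g \<Longrightarrow>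
    pd v (\<lambda>y. f y + g y) y = pd v f y + pd v g y"
  by (rule pd_eqI[OF has_derivative_add]) (intro pd_has_derivative; assumption)+

lemma pd_mult:
  "real_polynomial_function f \<Longrightarrow> real_polynomial_function g \<Longrightarrow>
    pd v (\<lambda>y. f y * g y) y = f y * pd v g y + pd v f y * g y"
  by (rule pd_eqI[OF has_derivative_mult]) (intro pd_has_derivative; assumption)+

lemma pd_cmult:
  "real_polynomial_function g \<Longrightarrow> pd v (\<lambda>y. c * g y) y = c * pd v g y"
  by (subst pd_mult) auto

lemma pd_sum:
  assumes "finite I" "\<And>i. i \<in> I \<Longrightarrow> real_polynomial_function (f i)"
  shows "pd v (\<lambda>y. \<Sum>i\<in>I. f i y) y = (\<Sum>i\<in>I. pd v (f i) y)"
  by (rule pd_eqI[OF has_derivative_sum]) (intro pd_has_derivative assms; assumption)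

lemma pd_power:
  assumes "real_polynomial_function f"
  shows "pd v (\<lambda>y. f y ^ k) y = real k * f y ^ (k - 1) * pd v f y"
  by (rule trans[OF pd_eqI[OF has_derivative_power[OF pd_has_derivative[OF assms]]]]) simp

lemma real_polynomial_function_pd:
  "real_polynomial_function g \<Longrightarrow> real_polynomial_function (pd v g)"
proof (induction g rule: real_polynomial_function.induct)
  case (linear f)
  then have "pd v f = (\<lambda>_. f v)" by (auto simp: pd_bounded_linear)
  then show ?case by auto
next
  case (const c)
  have "pd v (\<lambda>_::'a. c) = (\<lambda>_. 0)" by auto
  then show ?case by auto
next
  case (add f g)
  then have "pd v (\<lambda>y. f y + g y) = (\<lambda>y. pd v f y + pd v g y)" by (auto simp: pd_add)
  then show ?case using add by auto
next
  case (mult f g)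
  then have "pd v (\<lambda>y. f y * g y) = (\<lambda>y. f y * pd v g y + pd v f y * g y)" by (auto simp: pd_mult)
  then show ?case using mult by auto
qed

lemma real_polynomial_function_inner [intro]: "real_polynomial_function (\<lambda>y::'a::real_inner. a \<bullet> y)"
  by (intro real_polynomial_function.intros(1) bounded_linear_inner_right)

lemma pd_linear_direction:
  assumes "real_polynomial_function g"
  shows "pd (\<Sum>b\<in>B. c b *\<^sub>R f b) g y = (\<Sum>b\<in>B. c b * pd (f b) g y)"
    "pd (c1 *\<^sub>R v - c2 *\<^sub>R w) g y = c1 * pd v g y - c2 * pd w g y"
proof -
  interpret bounded_linear "\<lambda>v. pd v g y"
    using pd_has_derivative[OF assms] by (rule has_derivative_bounded_linear)
  show "pd (\<Sum>b\<in>B. c b *\<^sub>R f b) g y = (\<Sum>b\<in>B. c b * pd (f b) g y)"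
    by (simp add: sum scaleR)
  show "pd (c1 *\<^sub>R v - c2 *\<^sub>R w) g y = c1 * pd v g y - c2 * pd w g y"
    by (simp add: diff scaleR)
qed

lemma pd_Basis:
  assumes "real_polynomial_function g"
  shows "pd v g y = (\<Sum>b\<in>Basis. (b \<bullet> v) * pd b g y)"
  by (subst euclidean_representation[of v, symmetric], subst pd_linear_direction[OF assms])
     (simp add: inner_commute)

lemma pd_DERIV:
  assumes "real_polynomial_function g" and "(\<gamma> has_vector_derivative w) (at t)"
  shows "((\<lambda>t. g (\<gamma> t)) has_real_derivative pd w g (\<gamma> t)) (at t)"
proof -
  have "(g \<circ> \<gamma> has_derivative (\<lambda>v. pd v g (\<gamma> t)) \<circ> (\<lambda>h. h *\<^sub>R w)) (at t)"
    using assms(2) unfolding has_vector_derivative_def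
    by (intro diff_chain_at pd_has_derivative assms(1))
  moreover have "((\<lambda>v. pd v g (\<gamma> t)) \<circ> (\<lambda>h. h *\<^sub>R w)) = (\<lambda>h. pd w g (\<gamma> t) * h)"
    using pd_linear_direction(2)[OF assms(1), of _ w 0 0] by (auto simp: o_def)
  ultimately show ?thesis
    unfolding has_field_derivative_def o_def by simp
qed

section \<open>Homogeneous polynomials and solid harmonics\<close>

definition homogeneous :: "nat \<Rightarrow> ('a::real_vector \<Rightarrow> real) \<Rightarrow> bool" where
  "homogeneous m g \<longleftrightarrow> (\<forall>c x. g (c *\<^sub>R x) = c ^ m * g x)"

text \<open>Polynomials on the whole space, where derivatives make sense; spherical harmonics are
  their restrictions to the sphere, extended by zero.\<close>

definition solid_harmonics :: "nat \<Rightarrow> ('a::euclidean_space \<Rightarrow> real) set" where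
  "solid_harmonics l = {u. real_polynomial_function u \<and> homogeneous l u \<and> harmonic u}"

lemma spherical_harmonics_eq:
  "spherical_harmonics l = (\<lambda>u x. indicator unit_sphere x * u x) ` solid_harmonics l"
  unfolding spherical_harmonics_def solid_harmonics_def homogeneous_def by auto

lemma harmonic_iff_pd:
  assumes u: "real_polynomial_function u"
  shows "harmonic u \<longleftrightarrow> (\<forall>x. (\<Sum>b\<in>Basis. pd b (pd b u) x) = 0)"
proof -
  have "(deriv ^^ 2) (\<lambda>t. u (x + t *\<^sub>R b)) 0 = pd b (pd b u) x" for x b
  proof -
    have line: "((\<lambda>t. x + t *\<^sub>R b) has_vector_derivative b) (at t)" for t
      by (auto intro!: derivative_eq_intros)
    have "deriv (\<lambda>t. u (x + t *\<^sub>R b)) = (\<lambda>t. pd b u (x + t *\<^sub>R b))"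
      by (intro ext DERIV_imp_deriv pd_DERIV[OF u line])
    moreover have "deriv (\<lambda>t. pd b u (x + t *\<^sub>R b)) 0 = pd b (pd b u) (x + 0 *\<^sub>R b)"
      by (intro DERIV_imp_deriv pd_DERIV real_polynomial_function_pd u line)
    ultimately show ?thesis by (simp add: numeral_2_eq_2)
  qed
  then show ?thesis unfolding harmonic_def by simp
qed

text \<open>Euler's identity, obtained by differentiating in \<open>c\<close> at 1. Homogeneity is
  asked for positive \<open>c\<close> only, which is the form that \<open>pd_homogeneous\<close>
  supplies for derivatives.\<close>

lemma euler_homogeneous:
  fixes g :: "'a::euclidean_space \<Rightarrow> real"
  assumes g: "real_polynomial_function g" and hom: "\<And>c. c > 0 \<Longrightarrow> g (c *\<^sub>R y) = c ^ m * g y"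
  shows "pd y g y = real m * g y"
proof -
  have "((\<lambda>c. c *\<^sub>R y) has_vector_derivative y) (at 1)"
    by (auto intro!: derivative_eq_intros)
  from pd_DERIV[OF g this] have D1: "((\<lambda>c. g (c *\<^sub>R y)) has_real_derivative pd y g y) (at 1)" by simp
  have "((\<lambda>c. c ^ m * g y) has_real_derivative real m * g y) (at 1)"
    by (auto intro!: derivative_eq_intros)
  then have "((\<lambda>c. g (c *\<^sub>R y)) has_real_derivative real m * g y) (at 1)"
    by (rule has_field_derivative_transform_within_open[of _ _ _ "{0<..}"]) (auto simp: hom)
  with D1 show ?thesis by (rule DERIV_unique)
qed

lemma pd_homogeneous:
  fixes g :: "'a::euclidean_space \<Rightarrow> real"
  assumes g: "real_polynomial_function g" and hom: "homogeneous (Suc m) g" and c: "c > 0"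
  shows "pd v g (c *\<^sub>R y) = c ^ m * pd v g y"
proof -
  have l1: "((\<lambda>t. c *\<^sub>R (y + t *\<^sub>R v)) has_vector_derivative c *\<^sub>R v) (at 0)"
    and l2: "((\<lambda>t. y + t *\<^sub>R v) has_vector_derivative v) (at 0)"
    by (auto intro!: derivative_eq_intros)
  have "((\<lambda>t. g (c *\<^sub>R (y + t *\<^sub>R v))) has_real_derivative pd (c *\<^sub>R v) g (c *\<^sub>R y)) (at 0)"
    using pd_DERIV[OF g l1] by simp
  moreover have "((\<lambda>t. g (c *\<^sub>R (y + t *\<^sub>R v))) has_real_derivative c ^ Suc m * pd v g y) (at 0)"
    using DERIV_cmult[OF pd_DERIV[OF g l2], of "c ^ Suc m"] hom by (simp add: homogeneous_def)
  ultimately have "pd (c *\<^sub>R v) g (c *\<^sub>R y) = c ^ Suc m * pd v g y"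
    by (rule DERIV_unique)
  moreover have "pd (c *\<^sub>R v) g (c *\<^sub>R y) = c * pd v g (c *\<^sub>R y)"
    using pd_linear_direction(2)[OF g, of c v 0 0] by simp
  ultimately show ?thesis using c by simp
qed

lemma real_polynomial_continuous_on:
  "real_polynomial_function (g :: 'a::euclidean_space \<Rightarrow> real) \<Longrightarrow> continuous_on S g"
  by (simp add: continuous_on_polymonial_function real_polynomial_function_eq)

lemma real_polynomial_integrable_sphere:
  "real_polynomial_function (g :: 'a::euclidean_space \<Rightarrow> real) \<Longrightarrow> integrable sphere_measure g"
  by (intro continuous_on_sphere_integrable real_polynomial_continuous_on)

subsection \<open>Integration by parts on the sphere\<close>

text \<open>Rotations in the plane of \<open>e\<close> and \<open>f\<close> preserve the measure, so
  the integral of \<open>g (R t y)\<close> is constant in \<open>t\<close>; the integrand is its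
  infinitesimal generator applied to \<open>g\<close>.\<close>

lemma integral_rotation_derivative:
  fixes g :: "'a::euclidean_space \<Rightarrow> real"
  assumes g: "real_polynomial_function g" and e: "e \<in> Basis" and f: "f \<in> Basis"
  shows "(\<integral>y. (e \<bullet> y) * pd f g y - (f \<bullet> y) * pd e g y \<partial>sphere_measure) = 0"
proof (cases "e = f")
  case False
  have ef: "e \<bullet> e = 1" "f \<bullet> f = 1" "e \<bullet> f = 0" "f \<bullet> e = 0"
    using e f False by (auto simp: inner_Basis)
  define R where "R t y = y + (cos t - 1) *\<^sub>R ((e \<bullet> y) *\<^sub>R e + (f \<bullet> y) *\<^sub>R f)
    + sin t *\<^sub>R ((e \<bullet> y) *\<^sub>R f - (f \<bullet> y) *\<^sub>R e)" for t :: real and y :: 'a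
  define W where "W y = (e \<bullet> y) *\<^sub>R f - (f \<bullet> y) *\<^sub>R e" for y :: 'a
  define L where "L y = (e \<bullet> y) * pd f g y - (f \<bullet> y) * pd e g y" for y
  have L: "L y = pd (W y) g y" for y
    unfolding L_def W_def by (rule pd_linear_direction(2)[OF g, symmetric])
  have R_orth: "orthogonal_transformation (R t)" for t
    unfolding orthogonal_transformation_def
  proof (intro conjI allI)
    show "linear (R t)" unfolding R_def
      by (intro linearI) (auto simp: algebra_simps inner_add_right)
    show "R t y \<bullet> R t w = y \<bullet> w" for y w
    proof -
      define a where "a = e \<bullet> y"
      define b where "b = f \<bullet> y"
      define a' where "a' = e \<bullet> w"
      define b' where "b' = f \<bullet> w"
      define c where "c = cos t"
      define s where "s = sin t"
      have cs: "c\<^sup>2 + s\<^sup>2 = 1" by (simp add: c_def s_def)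
      have sw: "y \<bullet> e = a" "y \<bullet> f = b" "w \<bullet> e = a'" "w \<bullet> f = b'"
        by (simp_all add: a_def b_def a'_def b'_def inner_commute)
      have "R t y \<bullet> R t w = y \<bullet> w + (a * a' + b * b') * (c\<^sup>2 + s\<^sup>2 - 1)"
        unfolding R_def a_def[symmetric] b_def[symmetric] a'_def[symmetric] b'_def[symmetric]
          c_def[symmetric] s_def[symmetric]
        by (simp add: inner_add_left inner_add_right inner_diff_left inner_diff_right ef sw
            a_def[symmetric] b_def[symmetric] a'_def[symmetric] b'_def[symmetric])
           (simp add: algebra_simps power2_eq_square)
      then show ?thesis using cs by simp
    qed
  qed
  have "((\<lambda>t. R t y) has_vector_derivative
      (- sin t) *\<^sub>R ((e \<bullet> y) *\<^sub>R e + (f \<bullet> y) *\<^sub>R f) + cos t *\<^sub>R ((e \<bullet> y) *\<^sub>R f - (f \<bullet> y) *\<^sub>R e)) (at t)" for t y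
    unfolding R_def by (auto intro!: derivative_eq_intros simp: has_real_derivative_iff_has_vector_derivative[symmetric])
  moreover have "(- sin t) *\<^sub>R ((e \<bullet> y) *\<^sub>R e + (f \<bullet> y) *\<^sub>R f) + cos t *\<^sub>R ((e \<bullet> y) *\<^sub>R f - (f \<bullet> y) *\<^sub>R e) = W (R t y)" for t y
    unfolding W_def R_def by (simp add: inner_add_right inner_diff_right ef algebra_simps)
  ultimately have R_deriv: "((\<lambda>t. R t y) has_vector_derivative W (R t y)) (at t)" for t y by simp
  have gR_deriv: "((\<lambda>t. g (R t y)) has_real_derivative L (R t y)) (at t)" for t y
    unfolding L by (rule pd_DERIV[OF g R_deriv])
  have L_poly: "real_polynomial_function L"
    unfolding L_def by (intro real_polynomial_function_diff real_polynomial_function.intros(4)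
        real_polynomial_function_inner real_polynomial_function_pd g)
  obtain C where C: "\<And>y. y \<in> unit_sphere \<Longrightarrow> \<bar>L y\<bar> \<le> C"
    using continuous_on_sphere_bounded[OF real_polynomial_continuous_on[OF L_poly]] by metis
  \<comment> \<open>Difference quotients of step \<open>1 / (i + 1)\<close>: each has integral 0 by
    invariance, and by the mean value theorem each is a value of \<open>L\<close> on the same orbit,
    hence on the sphere, which gives the uniform bound \<open>C\<close>.\<close>
  define D where "D i y = (g (R (1 / real (Suc i)) y) - g y) * real (Suc i)" for i y
  have R0: "R 0 y = y" for y by (simp add: R_def)
  have g_meas: "g \<in> borel_measurable sphere_measure" and g_int: "integrable sphere_measure g"
    by (intro continuous_on_sphere_measurable real_polynomial_integrable_sphere
        real_polynomial_continuous_on g)+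
  have D_int: "(\<integral>y. D i y \<partial>sphere_measure) = 0" for i
    unfolding D_def using integrable_sphere_orthogonal[OF R_orth g_meas] g_int
      integral_sphere_orthogonal[OF R_orth g_meas] by simp
  have "(\<lambda>i. \<integral>y. D i y \<partial>sphere_measure) \<longlonglongrightarrow> (\<integral>y. L y \<partial>sphere_measure)"
  proof (rule integral_dominated_convergence[where w="\<lambda>_. C"])
    show "L \<in> borel_measurable sphere_measure"
      by (intro continuous_on_sphere_measurable real_polynomial_continuous_on L_poly)
    show "D i \<in> borel_measurable sphere_measure" for i
      unfolding D_def using integrable_sphere_orthogonal[OF R_orth g_meas] g_int
      by (intro borel_measurable_times borel_measurable_diff borel_measurable_const g_meas
          borel_measurable_integrable) simp
    show "integrable sphere_measure (\<lambda>_. C)" by simp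
    show "AE y in sphere_measure. (\<lambda>i. D i y) \<longlonglongrightarrow> L y"
    proof (rule AE_I2)
      fix y
      have "((\<lambda>h. (g (R (0 + h) y) - g (R 0 y)) / h) \<longlongrightarrow> L (R 0 y)) (at 0)"
        using gR_deriv[where t=0 and y=y] unfolding DERIV_def .
      then have "((\<lambda>h. (g (R h y) - g y) / h) \<longlongrightarrow> L y) (at 0)" by (simp add: R0)
      moreover have "filterlim (\<lambda>i. 1 / real (Suc i)) (at 0) sequentially"
        unfolding filterlim_at using LIMSEQ_inverse_real_of_nat by (auto simp: divide_inverse)
      ultimately have "((\<lambda>i. (g (R (1 / real (Suc i)) y) - g y) / (1 / real (Suc i))) \<longlongrightarrow> L y) sequentially"
        by (rule filterlim_compose)
      then show "(\<lambda>i. D i y) \<longlonglongrightarrow> L y" by (simp add: D_def)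
    qed
    show "AE y in sphere_measure. norm (D i y) \<le> C" for i
    proof (rule AE_I2)
      fix y :: 'a assume "y \<in> space sphere_measure"
      then have y: "norm y = 1" by simp
      have "0 < 1 / real (Suc i)" by simp
      from MVT2[OF this gR_deriv] obtain z where
        z: "g (R (1 / real (Suc i)) y) - g (R 0 y) = (1 / real (Suc i) - 0) * L (R z y)" by metis
      have "D i y = L (R z y)" using z by (simp add: D_def R0)
      moreover have "R z y \<in> unit_sphere" using orthogonal_transformation_norm[OF R_orth] y by simp
      ultimately show "norm (D i y) \<le> C" using C by simp
    qed
  qed
  then have "(\<integral>y. L y \<partial>sphere_measure) = 0" using D_int by (simp add: LIMSEQ_const_iff)
  then show ?thesis by (simp add: L_def)
qed simp

text \<open>Summing the rotation identity for \<open>y\<^sub>f g\<close> over all coordinates \<open>f\<close> trades a derivative for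
  multiplication by a coordinate, on the sphere itself.\<close>

lemma integral_pd_sphere:
  fixes g :: "'a::euclidean_space \<Rightarrow> real"
  assumes g: "real_polynomial_function g"
  shows "(\<integral>y. pd v g y \<partial>sphere_measure) =
    (\<integral>y. (v \<bullet> y) * (real (DIM('a) - 1) * g y + pd y g y) \<partial>sphere_measure)"
proof -
  have pE: "real_polynomial_function (\<lambda>y. pd y g y)"
    by (subst pd_Basis[OF g]) (intro real_polynomial_function_sum finite_Basis
        real_polynomial_function.intros(4) real_polynomial_function_inner real_polynomial_function_pd g)
  note polys = real_polynomial_function.intros(4) real_polynomial_function_inner
     real_polynomial_function_pd g pE real_polynomial_function.intros(3) real_polynomial_function_diff
     real_polynomial_function.intros(2)
  have basis: "(\<integral>y. pd e g y \<partial>sphere_measure) =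
    (\<integral>y. (e \<bullet> y) * (real (DIM('a) - 1) * g y + pd y g y) \<partial>sphere_measure)" if e: "e \<in> Basis" for e
  proof -
    have "0 = (\<Sum>f\<in>Basis. \<integral>y. (e \<bullet> y) * pd f (\<lambda>y. (f \<bullet> y) * g y) y - (f \<bullet> y) * pd e (\<lambda>y. (f \<bullet> y) * g y) y \<partial>sphere_measure)"
      using e by (intro sum.neutral[symmetric] ballI integral_rotation_derivative polys)
    also have "\<dots> = (\<integral>y. (\<Sum>f\<in>Basis. (e \<bullet> y) * pd f (\<lambda>y. (f \<bullet> y) * g y) y - (f \<bullet> y) * pd e (\<lambda>y. (f \<bullet> y) * g y) y) \<partial>sphere_measure)"
      by (intro Bochner_Integration.integral_sum[symmetric] real_polynomial_integrable_sphere polys)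
    also have "\<dots> = (\<integral>y. (e \<bullet> y) * (real (DIM('a) - 1) * g y + pd y g y) - pd e g y \<partial>sphere_measure)"
    proof (rule Bochner_Integration.integral_cong[OF refl])
      fix y :: 'a assume "y \<in> space sphere_measure"
      then have "y \<bullet> y = 1" by (simp add: dot_square_norm)
      then have y: "(\<Sum>f\<in>Basis. (f \<bullet> y) * (f \<bullet> y)) = 1"
        by (simp add: euclidean_inner[of y y] inner_commute)
      have d: "real (DIM('a) - 1) = real DIM('a) - 1" using DIM_positive[where 'a='a] by simp
      have "(\<Sum>f\<in>Basis. (e \<bullet> y) * pd f (\<lambda>y. (f \<bullet> y) * g y) y - (f \<bullet> y) * pd e (\<lambda>y. (f \<bullet> y) * g y) y)
        = (\<Sum>f\<in>Basis. (e \<bullet> y) * g y + (e \<bullet> y) * ((f \<bullet> y) * pd f g y)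
            - (f \<bullet> e) * ((f \<bullet> y) * g y) - ((f \<bullet> y) * (f \<bullet> y)) * pd e g y)"
        by (intro sum.cong refl) (simp add: pd_mult polys pd_inner algebra_simps)
      also have "\<dots> = real DIM('a) * ((e \<bullet> y) * g y) + (e \<bullet> y) * (\<Sum>f\<in>Basis. (f \<bullet> y) * pd f g y)
            - (\<Sum>f\<in>Basis. (f \<bullet> e) * ((f \<bullet> y) * g y)) - (\<Sum>f\<in>Basis. (f \<bullet> y) * (f \<bullet> y)) * pd e g y"
        by (simp add: sum.distrib sum_subtractf sum_distrib_left sum_distrib_right)
      \<comment> \<open>Only the index \<open>f = e\<close> survives; its contribution lowers the
        factor \<open>DIM('a)\<close> to \<open>DIM('a) - 1\<close>.\<close>
      also have "(\<Sum>f\<in>Basis. (f \<bullet> e) * ((f \<bullet> y) * g y)) = (e \<bullet> y) * g y"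
        using e by (subst sum.remove[of _ e]) (auto simp: inner_Basis intro!: sum.neutral)
      also have "(\<Sum>f\<in>Basis. (f \<bullet> y) * pd f g y) = pd y g y" using pd_Basis[OF g, of y y] by simp
      finally show "(\<Sum>f\<in>Basis. (e \<bullet> y) * pd f (\<lambda>y. (f \<bullet> y) * g y) y - (f \<bullet> y) * pd e (\<lambda>y. (f \<bullet> y) * g y) y)
        = (e \<bullet> y) * (real (DIM('a) - 1) * g y + pd y g y) - pd e g y"
        by (simp add: y d algebra_simps)
    qed
    also have "\<dots> = (\<integral>y. (e \<bullet> y) * (real (DIM('a) - 1) * g y + pd y g y) \<partial>sphere_measure)
        - (\<integral>y. pd e g y \<partial>sphere_measure)"
      by (intro Bochner_Integration.integral_diff real_polynomial_integrable_sphere polys)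
    finally show ?thesis by simp
  qed
  have "(\<integral>y. pd v g y \<partial>sphere_measure) = (\<integral>y. (\<Sum>b\<in>Basis. (b \<bullet> v) * pd b g y) \<partial>sphere_measure)"
    by (simp add: pd_Basis[OF g, of v])
  also have "\<dots> = (\<Sum>b\<in>Basis. (b \<bullet> v) * (\<integral>y. pd b g y \<partial>sphere_measure))"
    by (subst Bochner_Integration.integral_sum) (auto intro!: real_polynomial_integrable_sphere polys)
  also have "\<dots> = (\<Sum>b\<in>Basis. (b \<bullet> v) * (\<integral>y. (b \<bullet> y) * (real (DIM('a) - 1) * g y + pd y g y) \<partial>sphere_measure))"
    by (intro sum.cong refl) (simp add: basis)
  also have "\<dots> = (\<integral>y. (\<Sum>b\<in>Basis. (b \<bullet> v) * ((b \<bullet> y) * (real (DIM('a) - 1) * g y + pd y g y))) \<partial>sphere_measure)"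
    by (subst Bochner_Integration.integral_sum) (auto intro!: real_polynomial_integrable_sphere polys)
  also have "\<dots> = (\<integral>y. (v \<bullet> y) * (real (DIM('a) - 1) * g y + pd y g y) \<partial>sphere_measure)"
  proof (intro Bochner_Integration.integral_cong refl)
    fix y
    have "v \<bullet> y = (\<Sum>b\<in>Basis. (b \<bullet> v) * (b \<bullet> y))"
      by (simp add: euclidean_inner[of v] inner_commute)
    then show "(\<Sum>b\<in>Basis. (b \<bullet> v) * ((b \<bullet> y) * (real (DIM('a) - 1) * g y + pd y g y)))
      = (v \<bullet> y) * (real (DIM('a) - 1) * g y + pd y g y)"
      by (simp add: sum_distrib_right mult.assoc)
  qed
  finally show ?thesis .
qed

text \<open>Integration by parts for \<open>(x \<bullet> y) ^ (k + 1)\<close> in the direction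
  \<open>x\<close>. The Gegenbauer weight obeys the same recurrence, and this identifies the
  distribution of \<open>x \<bullet> y\<close> through its moments.\<close>

lemma moment_recurrence:
  fixes x :: "'a::euclidean_space"
  assumes x: "x \<in> unit_sphere"
  shows "real (k + DIM('a)) * (\<integral>y. (x \<bullet> y) ^ (k + 2) \<partial>sphere_measure) =
    real (k + 1) * (\<integral>y. (x \<bullet> y) ^ k \<partial>sphere_measure)"
    and "2 \<le> DIM('a) \<Longrightarrow> (\<integral>y. x \<bullet> y \<partial>sphere_measure) = 0"
proof -
  have xx: "x \<bullet> x = 1" using x by (simp add: dot_square_norm)
  have d: "real (DIM('a) - 1) = real DIM('a) - 1" using DIM_positive[where 'a='a] by simp
  let ?g = "\<lambda>y::'a. (x \<bullet> y) ^ (k + 1)"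
  have g: "real_polynomial_function ?g" by (intro real_polynomial_function_power real_polynomial_function_inner)
  have *: "pd v ?g y = real (k + 1) * (x \<bullet> y) ^ k * (x \<bullet> v)" for v y
    by (subst pd_power) (auto simp: pd_inner)
  have "(\<integral>y. real (k + 1) * (x \<bullet> y) ^ k \<partial>sphere_measure) = (\<integral>y. real (k + DIM('a)) * (x \<bullet> y) ^ (k + 2) \<partial>sphere_measure)"
    using integral_pd_sphere[OF g, of x] unfolding * d xx
    by (simp add: algebra_simps)
  then show "real (k + DIM('a)) * (\<integral>y. (x \<bullet> y) ^ (k + 2) \<partial>sphere_measure) =
    real (k + 1) * (\<integral>y. (x \<bullet> y) ^ k \<partial>sphere_measure)" by simp
  show "(\<integral>y. x \<bullet> y \<partial>sphere_measure) = 0" if "2 \<le> DIM('a)"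
    using integral_pd_sphere[of "\<lambda>_. 1" x] that by auto
qed

text \<open>Since \<open>v\<close> is harmonic, the divergence of \<open>u\<close> times the
  gradient of \<open>v\<close> is the integrand on the left. Each component
  \<open>u * pd b v\<close> is homogeneous of degree \<open>k + l - 1\<close>, so integration by
  parts produces the constant factor \<open>DIM('a) + k + l - 2\<close>, and Euler's identity for
  \<open>v\<close> produces \<open>l\<close>.\<close>

lemma integral_grad_harmonic:
  fixes u v :: "'a::euclidean_space \<Rightarrow> real"
  assumes u: "real_polynomial_function u" "homogeneous k u" and v: "v \<in> solid_harmonics l"
  shows "(\<integral>y. (\<Sum>b\<in>Basis. pd b u y * pd b v y) \<partial>sphere_measure)
    = (real DIM('a) + real k + real l - 2) * real l * (\<integral>y. u y * v y \<partial>sphere_measure)"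
proof (cases l)
  case 0
  have "v = (\<lambda>_. v 0)"
  proof
    fix x
    have "v (0 *\<^sub>R x) = 0 ^ 0 * v x"
      using v 0 unfolding solid_harmonics_def homogeneous_def by blast
    then show "v x = v 0" by simp
  qed
  then have "pd b v y = 0" for b y by (metis pd_const)
  then show ?thesis using 0 by simp
next
  case (Suc m)
  have vp: "real_polynomial_function v" and vh: "homogeneous (Suc m) v"
    and lap: "\<And>x. (\<Sum>b\<in>Basis. pd b (pd b v) x) = 0"
    using v Suc harmonic_iff_pd[of v] by (auto simp: solid_harmonics_def)
  have d: "real (DIM('a) - 1) = real DIM('a) - 1" using DIM_positive[where 'a='a] by simp
  note polys = real_polynomial_function.intros(4) real_polynomial_function_inner
     real_polynomial_function_pd u(1) vp real_polynomial_function.intros(3) real_polynomial_function_diff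
     real_polynomial_function.intros(2)
  have euler: "pd y (\<lambda>y. u y * pd b v y) y = real (k + m) * (u y * pd b v y)" for b y
    by (rule euler_homogeneous)
       (use u(2) pd_homogeneous[OF vp vh] in \<open>auto simp: homogeneous_def power_add intro!: polys\<close>)
  have ev: "pd y v y = real l * v y" for y
    by (rule euler_homogeneous[OF vp]) (use vh Suc in \<open>auto simp: homogeneous_def\<close>)
  have "(\<integral>y. (\<Sum>b\<in>Basis. pd b u y * pd b v y) \<partial>sphere_measure)
      = (\<integral>y. (\<Sum>b\<in>Basis. pd b (\<lambda>y. u y * pd b v y) y) \<partial>sphere_measure)"
    by (intro Bochner_Integration.integral_cong refl)
       (simp add: pd_mult polys sum.distrib lap flip: sum_distrib_left)
  also have "\<dots> = (\<Sum>b\<in>Basis. \<integral>y. pd b (\<lambda>y. u y * pd b v y) y \<partial>sphere_measure)"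
    by (intro Bochner_Integration.integral_sum real_polynomial_integrable_sphere polys)
  also have "\<dots> = (\<Sum>b\<in>Basis. \<integral>y. (real DIM('a) + real k + real l - 2) * (u y * ((b \<bullet> y) * pd b v y)) \<partial>sphere_measure)"
  proof (intro sum.cong refl)
    fix b :: 'a
    have "real_polynomial_function (\<lambda>y. u y * pd b v y)" by (intro polys)
    from integral_pd_sphere[OF this, of b]
    show "(\<integral>y. pd b (\<lambda>y. u y * pd b v y) y \<partial>sphere_measure) =
      (\<integral>y. (real DIM('a) + real k + real l - 2) * (u y * ((b \<bullet> y) * pd b v y)) \<partial>sphere_measure)"
      unfolding euler d by (simp add: Suc algebra_simps)
  qed
  also have "\<dots> = (\<integral>y. (\<Sum>b\<in>Basis. (real DIM('a) + real k + real l - 2) * (u y * ((b \<bullet> y) * pd b v y))) \<partial>sphere_measure)"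
    by (intro Bochner_Integration.integral_sum[symmetric] real_polynomial_integrable_sphere polys)
  also have "\<dots> = (\<integral>y. (real DIM('a) + real k + real l - 2) * real l * (u y * v y) \<partial>sphere_measure)"
  proof (intro Bochner_Integration.integral_cong refl)
    fix y
    have "(\<Sum>b\<in>Basis. (b \<bullet> y) * pd b v y) = real l * v y"
      using pd_Basis[OF vp, of y y] ev by simp
    then show "(\<Sum>b\<in>Basis. (real DIM('a) + real k + real l - 2) * (u y * ((b \<bullet> y) * pd b v y)))
      = (real DIM('a) + real k + real l - 2) * real l * (u y * v y)"
      by (simp flip: sum_distrib_left)
  qed
  finally show ?thesis by simp
qed

text \<open>The gradient pairing is symmetric, while \<open>integral_grad_harmonic\<close> evaluates
  it with the factor \<open>l\<close> in one order and \<open>k\<close> in the other. The common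
  factor is positive because \<open>k + l \<ge> 1\<close>.\<close>

lemma solid_harmonics_orthogonal:
  fixes u v :: "'a::euclidean_space \<Rightarrow> real"
  assumes dim: "2 \<le> DIM('a)" and u: "u \<in> solid_harmonics k" and v: "v \<in> solid_harmonics l" and kl: "k \<noteq> l"
  shows "(\<integral>y. u y * v y \<partial>sphere_measure) = 0"
proof -
  let ?c = "real DIM('a) + real k + real l - 2"
  have "(\<integral>y. (\<Sum>b\<in>Basis. pd b u y * pd b v y) \<partial>sphere_measure) = ?c * real l * (\<integral>y. u y * v y \<partial>sphere_measure)"
    using u by (intro integral_grad_harmonic v) (auto simp: solid_harmonics_def)
  moreover have "(\<integral>y. (\<Sum>b\<in>Basis. pd b v y * pd b u y) \<partial>sphere_measure) =
      (real DIM('a) + real l + real k - 2) * real k * (\<integral>y. v y * u y \<partial>sphere_measure)"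
    using v by (intro integral_grad_harmonic u) (auto simp: solid_harmonics_def)
  ultimately have "?c * (real l - real k) * (\<integral>y. u y * v y \<partial>sphere_measure) = 0"
    by (simp add: mult.commute algebra_simps)
  moreover have "?c > 0" using dim kl by linarith
  ultimately show ?thesis using kl by simp
qed

subsection \<open>Zonal polynomials\<close>

text \<open>
  With \<open>m = (d + 1)/2\<close>, the polynomial \<open>zonal_poly m k\<close> is the coefficient of \<open>r\<^sup>k\<close> in the Poisson
  kernel \<open>(1 - r\<^sup>2) (1 - 2 r t + r\<^sup>2)\<^bsup>-m\<^esup>\<close>; its coefficients come from expanding the power binomially
  in \<open>r\<^sup>2 - 2 r t\<close>. The function \<open>zonal_solid m k (x \<bullet> y) (y \<bullet> y)\<close> is the homogeneous extension in \<open>y\<close>.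
\<close>

definition zonal_coeff :: "real \<Rightarrow> nat \<Rightarrow> nat \<Rightarrow> real" where
  "zonal_coeff m k j = (- 2) ^ (k - 2 * j) *
     ((- m gchoose (k - j)) * real (k - j choose j)
       - (if j = 0 then 0 else (- m gchoose (k - 1 - j)) * real (k - 1 - j choose (j - 1))))"

definition zonal_solid :: "real \<Rightarrow> nat \<Rightarrow> real \<Rightarrow> real \<Rightarrow> real" where
  "zonal_solid m k a b = (\<Sum>j\<le>k div 2. zonal_coeff m k j * (a ^ (k - 2 * j) * b ^ j))"

definition zonal_poly :: "real \<Rightarrow> nat \<Rightarrow> real poly" where
  "zonal_poly m k = (\<Sum>j\<le>k div 2. monom (zonal_coeff m k j) (k - 2 * j))"

lemma poly_zonal_poly: "poly (zonal_poly m k) t = zonal_solid m k t 1"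
  by (simp add: zonal_poly_def zonal_solid_def poly_sum poly_monom)

lemma gbinomial_Suc_mult:
  "(a gchoose Suc k) * (of_nat k + 1) = (a gchoose k) * ((a::'a::field_char_0) - of_nat k)"
  by (metis gbinomial_absorb_comp gbinomial_absorption mult.commute of_nat_Suc add.commute)

lemma binomial_Suc_mult: "Suc j * (n choose Suc j) = (n - j) * (n choose j)"
  using binomial_absorption[of j n] binomial_absorb_comp[of n j] by simp

text \<open>For \<open>m = DIM('a) / 2\<close> the left side is the coefficient of
  \<open>a ^ (k - 2 * j - 2) * b ^ j\<close> in the Laplacian of \<open>zonal_solid\<close>.\<close>

lemma zonal_coeff_recurrence:
  assumes "2 * j + 2 \<le> k"
  shows "real (k - 2 * j) * real (k - 2 * j - 1) * zonal_coeff m k j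
    + 4 * real (Suc j) * (real k - real (Suc j) + m - 1) * zonal_coeff m k (Suc j) = 0"
proof -
  obtain n where k: "k = n + j + 2" and jn: "j \<le> n"
    using assms by (intro that[of "k - 2 - j"]) auto
  define g where "g i = (- m gchoose i)" for i
  have g: "g (Suc i) * (real i + 1) = g i * (- m - real i)" for i
    unfolding g_def using gbinomial_Suc_mult[of "-m" i] by simp
  define A where "A = g (n + 2) * real (n + 2 choose j) - (if j = 0 then 0 else g (n + 1) * real (n + 1 choose (j - 1)))"
  define A' where "A' = g (n + 1) * real (n + 1 choose (Suc j)) - g n * real (n choose j)"
  have pw: "(- 2 :: real) ^ (k - 2 * j) = 4 * (- 2) ^ (k - 2 * Suc j)"
  proof -
    have "k - 2 * j = Suc (Suc (k - 2 * Suc j))" using assms by simp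
    then show ?thesis by simp
  qed
  have zA: "zonal_coeff m k j = 4 * (- 2) ^ (k - 2 * Suc j) * A"
    unfolding zonal_coeff_def pw A_def g_def by (simp add: k)
  have zA': "zonal_coeff m k (Suc j) = (- 2) ^ (k - 2 * Suc j) * A'"
    unfolding zonal_coeff_def A'_def g_def by (simp add: k)
  have sub: "real (n + 2 - j) = real n + 2 - real j" "real (n + 1 - j) = real n + 1 - real j"
    using jn by (simp_all add: of_nat_diff)
  have ar: "n + 2 - 1 = n + 1" "n + 1 - 1 = n" by simp_all
  have c1: "(real n + 2 - real j) * real (n + 2 choose j) = (real n + 2) * real (n + 1 choose j)"
  proof -
    have "(n + 2 - j) * (n + 2 choose j) = (n + 2) * (n + 1 choose j)"
      using binomial_absorb_comp[of "n + 2" j] unfolding ar .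
    then have "real (n + 2 - j) * real (n + 2 choose j) = real (n + 2) * real (n + 1 choose j)"
      by (metis of_nat_mult)
    then show ?thesis unfolding sub of_nat_add of_nat_numeral of_nat_1 .
  qed
  have c2: "(real n + 1 - real j) * real (n + 1 choose j) = (real n + 1) * real (n choose j)"
  proof -
    have "(n + 1 - j) * (n + 1 choose j) = (n + 1) * (n choose j)"
      using binomial_absorb_comp[of "n + 1" j] unfolding ar .
    then have "real (n + 1 - j) * real (n + 1 choose j) = real (n + 1) * real (n choose j)"
      by (metis of_nat_mult)
    then show ?thesis unfolding sub of_nat_add of_nat_numeral of_nat_1 .
  qed
  have c3: "(real n + 2 - real j) * real (n + 1 choose (j - 1)) = real j * real (n + 1 choose j)" if "j \<noteq> 0"
  proof -
    obtain i where i: "j = Suc i" using \<open>j \<noteq> 0\<close> not0_implies_Suc by blast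
    have "real (Suc i) * real (n + 1 choose Suc i) = real (n + 1 - i) * real (n + 1 choose i)"
      using binomial_Suc_mult[of i "n + 1"] by (metis of_nat_mult)
    moreover have "real (n + 1 - i) = real n + 2 - real j" using jn i by (simp add: of_nat_diff)
    ultimately show ?thesis by (simp add: i)
  qed
  have c4: "(real j + 1) * real (n + 1 choose (Suc j)) = (real n + 1) * real (n choose j)"
  proof -
    have "real (Suc j) * real (n + 1 choose Suc j) = real (Suc n) * real (n choose j)"
      using Suc_times_binomial[of j n] by (metis of_nat_mult Suc_eq_plus1)
    then show ?thesis by (simp add: add.commute)
  qed
  \<comment> \<open>Multiplied by \<open>n + 2 - j\<close> and \<open>j + 1\<close>, the two-term
    expressions \<open>A\<close> and \<open>A'\<close> each collapse to \<open>- K\<close> times a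
    single product of binomials. The claim then reduces to the one-step recurrence of the
    generalized binomial coefficients \<open>g\<close>.\<close>
  define K where "K = m + real k - 1"
  have "(real n + 2 - real j) * A = g (n + 2) * ((real n + 2 - real j) * real (n + 2 choose j))
      - g (n + 1) * (if j = 0 then 0 else (real n + 2 - real j) * real (n + 1 choose (j - 1)))"
    by (simp add: A_def algebra_simps)
  also have "\<dots> = (g (n + 2) * (real n + 2)) * real (n + 1 choose j) - g (n + 1) * (real j * real (n + 1 choose j))"
    unfolding c1 using c3 by (simp split: if_split)
  also have "g (n + 2) * (real n + 2) = g (n + 1) * (- m - real (n + 1))"
    using g[of "n + 1"] by (simp add: add.commute)
  also have "g (n + 1) * (- m - real (n + 1)) * real (n + 1 choose j) - g (n + 1) * (real j * real (n + 1 choose j))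
     = - K * g (n + 1) * real (n + 1 choose j)"
    unfolding K_def k by (simp add: algebra_simps)
  finally have L1: "(real n + 2 - real j) * A = - K * g (n + 1) * real (n + 1 choose j)" .
  have "(real j + 1) * A' = g (n + 1) * ((real j + 1) * real (n + 1 choose (Suc j))) - g n * (real j + 1) * real (n choose j)"
    by (simp add: A'_def algebra_simps)
  also have "\<dots> = (g (n + 1) * (real n + 1)) * real (n choose j) - g n * (real j + 1) * real (n choose j)"
    unfolding c4 by simp
  also have "g (n + 1) * (real n + 1) = g n * (- m - real n)" using g[of n] by simp
  also have "g n * (- m - real n) * real (n choose j) - g n * (real j + 1) * real (n choose j)
     = - K * g n * real (n choose j)"
    unfolding K_def k by (simp add: algebra_simps)
  finally have L2: "(real j + 1) * A' = - K * g n * real (n choose j)" .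
  have "(real n + 2 - real j) * (real n + 1 - real j) * A + (real j + 1) * (real n + m) * A'
      = (real n + 1 - real j) * ((real n + 2 - real j) * A) + (real n + m) * ((real j + 1) * A')"
    by (simp add: algebra_simps)
  also have "\<dots> = - K * (g (n + 1) * ((real n + 1 - real j) * real (n + 1 choose j)) + (real n + m) * g n * real (n choose j))"
    unfolding L1 L2 by (simp add: algebra_simps)
  also have "g (n + 1) * ((real n + 1 - real j) * real (n + 1 choose j)) = (g (n + 1) * (real n + 1)) * real (n choose j)"
    unfolding c2 by simp
  also have "g (n + 1) * (real n + 1) = g n * (- m - real n)" using g[of n] by simp
  finally have Z: "(real n + 2 - real j) * (real n + 1 - real j) * A + (real j + 1) * (real n + m) * A' = 0"
    by (simp add: algebra_simps)
  have r: "real (k - 2 * j) = real n + 2 - real j" "real (k - 2 * j - 1) = real n + 1 - real j"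
    "real k - (real j + 1) + m - 1 = real n + m" "real (Suc j) = real j + 1"
    using jn by (simp_all add: k of_nat_diff)
  have "real (k - 2 * j) * real (k - 2 * j - 1) * zonal_coeff m k j
    + 4 * real (Suc j) * (real k - real (Suc j) + m - 1) * zonal_coeff m k (Suc j)
    = 4 * (- 2) ^ (k - 2 * Suc j) * ((real n + 2 - real j) * (real n + 1 - real j) * A + (real j + 1) * (real n + m) * A')"
    unfolding r zA zA' by (simp only: algebra_simps)
  then show ?thesis using Z by simp
qed

lemma real_polynomial_function_inner_self: "real_polynomial_function (\<lambda>y::'a::euclidean_space. y \<bullet> y)"
proof -
  have "(\<lambda>y::'a. y \<bullet> y) = (\<lambda>y. \<Sum>b\<in>Basis. (b \<bullet> y) * (b \<bullet> y))"
    by (rule ext, subst euclidean_inner) (simp add: inner_commute)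
  then show ?thesis
    by (simp only:) (intro real_polynomial_function_sum finite_Basis real_polynomial_function.intros(4)
      real_polynomial_function_inner)
qed

lemma pd_inner_self: "pd v (\<lambda>y. y \<bullet> y) y = 2 * (v \<bullet> y)"
  by (rule pd_eqI[THEN trans], rule has_derivative_inner[OF has_derivative_ident has_derivative_ident])
     (simp add: inner_commute)

text \<open>The sums over the basis turn products of coordinates into
  \<open>x \<bullet> x = 1\<close>, \<open>x \<bullet> y\<close>, \<open>y \<bullet> y\<close> and
  the dimension. Truncated subtraction in the exponents is harmless: every term in which it happens
  carries the factor 0.\<close>

lemma laplacian_zonal_monomial:
  fixes x :: "'a::euclidean_space"
  assumes x: "x \<in> unit_sphere"
  shows "(\<Sum>b\<in>Basis. pd b (pd b (\<lambda>y. (x \<bullet> y) ^ i * (y \<bullet> y) ^ j)) y) =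
    real i * real (i - 1) * ((x \<bullet> y) ^ (i - 2) * (y \<bullet> y) ^ j)
    + (4 * real i * real j + 2 * real j * (2 * real j + real DIM('a) - 2)) * ((x \<bullet> y) ^ i * (y \<bullet> y) ^ (j - 1))"
proof -
  let ?a = "\<lambda>y. x \<bullet> y" and ?q = "\<lambda>y::'a. y \<bullet> y"
  note polys = real_polynomial_function.intros(4) real_polynomial_function_inner
     real_polynomial_function_inner_self real_polynomial_function.intros(3)
     real_polynomial_function.intros(2) real_polynomial_function_power
  have D: "pd b (\<lambda>y. c * (?a y ^ i * ?q y ^ j)) y
      = c * (real i * (x \<bullet> b) * (?a y ^ (i - 1) * ?q y ^ j) + real j * (2 * (b \<bullet> y)) * (?a y ^ i * ?q y ^ (j - 1)))" 
      for b y c i j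
    by (simp add: pd_cmult pd_mult pd_power pd_inner pd_inner_self polys algebra_simps)
  have D1: "pd b (\<lambda>y. ?a y ^ i * ?q y ^ j) = (\<lambda>y. real i * (x \<bullet> b) * (?a y ^ (i - 1) * ?q y ^ j)
      + (2 * real j) * ((b \<bullet> y) * (?a y ^ i * ?q y ^ (j - 1))))" for b
    using D[of b 1 i j] by (auto simp: algebra_simps)
  have D2: "pd b (pd b (\<lambda>y. ?a y ^ i * ?q y ^ j)) y =
      (x \<bullet> b) * (b \<bullet> x) * (real i * real (i - 1) * (?a y ^ (i - 1 - 1) * ?q y ^ j))
      + (x \<bullet> b) * (b \<bullet> y) * (4 * real i * real j * (?a y ^ (i - 1) * ?q y ^ (j - 1)))
      + (y \<bullet> b) * (b \<bullet> y) * (4 * real j * real (j - 1) * (?a y ^ i * ?q y ^ (j - 1 - 1)))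
      + (b \<bullet> b) * (2 * real j * (?a y ^ i * ?q y ^ (j - 1)))" for b
  proof -
    have E: "pd b (\<lambda>y. (b \<bullet> y) * (?a y ^ i * ?q y ^ (j - 1))) y = (b \<bullet> y) * pd b (\<lambda>y. 1 * (?a y ^ i * ?q y ^ (j - 1))) y + (b \<bullet> b) * (?a y ^ i * ?q y ^ (j - 1))"
      by (subst pd_mult) (simp_all add: polys pd_inner)
    have "pd b (pd b (\<lambda>y. ?a y ^ i * ?q y ^ j)) y =
      pd b (\<lambda>y. real i * (x \<bullet> b) * (?a y ^ (i - 1) * ?q y ^ j)) y
      + (2 * real j) * pd b (\<lambda>y. (b \<bullet> y) * (?a y ^ i * ?q y ^ (j - 1))) y"
      unfolding D1 by (subst pd_add) (simp_all add: polys pd_cmult)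
    moreover have "b \<bullet> x = x \<bullet> b" "y \<bullet> b = b \<bullet> y" by (simp_all add: inner_commute)
    ultimately show ?thesis
      unfolding E D by (simp add: algebra_simps)
  qed
  have s: "(\<Sum>b\<in>Basis. (u \<bullet> b) * (b \<bullet> w) * c) = (u \<bullet> w) * c" for u w :: 'a and c
    unfolding sum_distrib_right[symmetric] by (subst euclidean_inner[of u w]) (simp add: inner_commute)
  have s2: "(\<Sum>b\<in>(Basis::'a set). (b \<bullet> b) * c) = real DIM('a) * c" for c :: real
    by (simp add: inner_Basis)
  have xx: "x \<bullet> x = 1" using x by (simp add: dot_square_norm)
  have "(\<Sum>b\<in>Basis. pd b (pd b (\<lambda>y. ?a y ^ i * ?q y ^ j)) y) =
      real i * real (i - 1) * (?a y ^ (i - 2) * ?q y ^ j)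
      + 4 * real i * real j * ((?a y * ?a y ^ (i - 1)) * ?q y ^ (j - 1))
      + 4 * real j * real (j - 1) * (?a y ^ i * (?q y * ?q y ^ (j - 1 - 1)))
      + real DIM('a) * (2 * real j * (?a y ^ i * ?q y ^ (j - 1)))"
    unfolding D2 sum.distrib s s2 xx by (simp add: numeral_2_eq_2 algebra_simps)
  also have "4 * real i * real j * ((?a y * ?a y ^ (i - 1)) * ?q y ^ (j - 1)) = 4 * real i * real j * (?a y ^ i * ?q y ^ (j - 1))"
    by (cases i) simp_all
  also have "4 * real j * real (j - 1) * (?a y ^ i * (?q y * ?q y ^ (j - 1 - 1))) = 4 * real j * (real j - 1) * (?a y ^ i * ?q y ^ (j - 1))"
  proof (cases "j \<le> 1")
    case True then show ?thesis by (cases j) auto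
  next
    case False
    then have "?q y * ?q y ^ (j - 1 - 1) = ?q y ^ (j - 1)" by (metis One_nat_def Suc_diff_Suc not_le power_Suc diff_Suc_1 Suc_pred zero_less_diff)
    then show ?thesis using False by (simp add: of_nat_diff)
  qed
  finally show ?thesis by (simp add: algebra_simps)
qed

text \<open>In the Laplacian, differentiating the power of \<open>x \<bullet> y\<close> twice in the
  term \<open>j\<close> and differentiating the power of \<open>y \<bullet> y\<close> in the term
  \<open>j + 1\<close> give the same monomial; \<open>zonal_coeff_recurrence\<close> makes these
  pairs cancel.\<close>

lemma zonal_solid_harmonic:
  fixes x :: "'a::euclidean_space"
  assumes x: "x \<in> unit_sphere"
  shows "(\<lambda>y. zonal_solid (real DIM('a) / 2) k (x \<bullet> y) (y \<bullet> y)) \<in> solid_harmonics k"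
proof -
  define m where "m = real DIM('a) / 2"
  let ?t = "\<lambda>j y. (x \<bullet> y) ^ (k - 2 * j) * (y \<bullet> y) ^ j"
  let ?u = "\<lambda>y. zonal_solid m k (x \<bullet> y) (y \<bullet> y)"
  have tp: "real_polynomial_function (?t j)" for j
    by (intro real_polynomial_function.intros(4) real_polynomial_function_power
        real_polynomial_function_inner real_polynomial_function_inner_self)
  have ctp: "real_polynomial_function (\<lambda>y. c * ?t j y)" for c j
    by (intro real_polynomial_function.intros(4) real_polynomial_function.intros(2) tp)
  have up: "real_polynomial_function ?u"
    unfolding zonal_solid_def by (intro real_polynomial_function_sum ctp) simp
  have "homogeneous k ?u"
    unfolding homogeneous_def zonal_solid_def
  proof (intro allI)
    fix c and y :: 'a
    have "(c * (x \<bullet> y)) ^ (k - 2 * j) * (c * (c * (y \<bullet> y))) ^ j = c ^ k * ?t j y" if "j \<le> k div 2" for j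
    proof -
      have "c ^ (k - 2 * j) * c ^ (2 * j) = c ^ k" using that by (simp flip: power_add)
      moreover have "(c * (c * (y \<bullet> y))) ^ j = c ^ (2 * j) * (y \<bullet> y) ^ j"
        by (simp add: power_mult_distrib power_mult power2_eq_square)
      ultimately have "(c * (x \<bullet> y)) ^ (k - 2 * j) * (c * (c * (y \<bullet> y))) ^ j
          = (c ^ (k - 2 * j) * c ^ (2 * j)) * ?t j y" "c ^ (k - 2 * j) * c ^ (2 * j) = c ^ k"
        by (simp_all add: power_mult_distrib[of c "x \<bullet> y"] mult_ac)
      then show ?thesis by simp
    qed
    then show "(\<Sum>j\<le>k div 2. zonal_coeff m k j * ((x \<bullet> c *\<^sub>R y) ^ (k - 2 * j) * (c *\<^sub>R y \<bullet> c *\<^sub>R y) ^ j)) =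
      c ^ k * (\<Sum>j\<le>k div 2. zonal_coeff m k j * ?t j y)"
      unfolding sum_distrib_left by (intro sum.cong refl) (simp add: algebra_simps)
  qed
  moreover have "harmonic ?u"
    unfolding harmonic_iff_pd[OF up]
  proof (intro allI)
    fix y
    have "pd b ?u = (\<lambda>y. \<Sum>j\<le>k div 2. zonal_coeff m k j * pd b (?t j) y)" for b
      unfolding zonal_solid_def by (rule ext, subst pd_sum) (auto intro!: ctp simp: pd_cmult tp)
    then have "pd b (pd b ?u) y = (\<Sum>j\<le>k div 2. zonal_coeff m k j * pd b (pd b (?t j)) y)" for b
      by (simp only:, subst pd_sum)
         (auto intro!: real_polynomial_function.intros(4) real_polynomial_function.intros(2)
           real_polynomial_function_pd tp simp: pd_cmult real_polynomial_function_pd tp)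
    then have "(\<Sum>b\<in>Basis. pd b (pd b ?u) y) = (\<Sum>j\<le>k div 2. zonal_coeff m k j * (\<Sum>b\<in>Basis. pd b (pd b (?t j)) y))"
      by (simp only: sum_distrib_left) (rule sum.swap)
    also have "\<dots> = (\<Sum>j\<le>k div 2. zonal_coeff m k j * real (k - 2 * j) * real (k - 2 * j - 1) * ((x \<bullet> y) ^ (k - 2 * j - 2) * (y \<bullet> y) ^ j))
       + (\<Sum>j\<le>k div 2. zonal_coeff m k j * (4 * real j * (real k - real j + m - 1)) * ((x \<bullet> y) ^ (k - 2 * j) * (y \<bullet> y) ^ (j - 1)))"
      (is "_ = (\<Sum>j\<le>k div 2. ?P j) + (\<Sum>j\<le>k div 2. ?Q j)")
      unfolding sum.distrib[symmetric]
    proof (intro sum.cong refl)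
      fix j assume "j \<in> {..k div 2}"
      then have r: "real (k - 2 * j) = real k - 2 * real j" by (auto simp: of_nat_diff)
      have coef: "4 * real (k - 2 * j) * real j + 2 * real j * (2 * real j + real DIM('a) - 2) = 4 * real j * (real k - real j + m - 1)"
        unfolding r m_def by (simp add: algebra_simps)
      show "zonal_coeff m k j * (\<Sum>b\<in>Basis. pd b (pd b (?t j)) y) = ?P j + ?Q j"
        unfolding laplacian_zonal_monomial[OF x] coef by (simp only: ring_distribs mult.assoc)
    qed
    \<comment> \<open>The last exponent \<open>k - 2 * (k div 2)\<close> is 0 or 1, so two
      derivatives annihilate it and the unpaired top term is 0.\<close>
    also have "(\<Sum>j\<le>k div 2. ?P j) = (\<Sum>j<k div 2. ?P j)"
    proof -
      have "real (k - 2 * (k div 2)) * real (k - 2 * (k div 2) - 1) = 0" by (cases "even k") auto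
      then have "?P (k div 2) = 0" by simp
      then show ?thesis by (simp add: lessThan_Suc_atMost[symmetric])
    qed
    also have "(\<Sum>j\<le>k div 2. ?Q j) = (\<Sum>j<k div 2. ?Q (Suc j))"
      by (subst sum.atMost_shift) simp
    also have "(\<Sum>j<k div 2. ?P j) + (\<Sum>j<k div 2. ?Q (Suc j)) = (\<Sum>j<k div 2. 0)"
      unfolding sum.distrib[symmetric]
    proof (intro sum.cong refl)
      fix j assume "j \<in> {..<k div 2}"
      then have j: "2 * j + 2 \<le> k" by auto
      have e: "k - 2 * Suc j = k - 2 * j - 2" by simp
      have "?P j + ?Q (Suc j) = (real (k - 2 * j) * real (k - 2 * j - 1) * zonal_coeff m k j
          + 4 * real (Suc j) * (real k - real (Suc j) + m - 1) * zonal_coeff m k (Suc j)) * ((x \<bullet> y) ^ (k - 2 * j - 2) * (y \<bullet> y) ^ j)"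
        unfolding e by (simp only: algebra_simps diff_Suc_1)
      then show "?P j + ?Q (Suc j) = 0" unfolding zonal_coeff_recurrence[OF j] by simp
    qed
    finally show "(\<Sum>b\<in>Basis. pd b (pd b ?u) y) = 0" by simp
  qed
  ultimately show ?thesis using up by (simp add: solid_harmonics_def m_def)
qed

subsection \<open>The Poisson kernel\<close>

context
  includes fps_syntax and no vec_syntax
begin

section \<open>Formal power series in \<open>r\<close> of an inverse power of
  \<open>1 - 2 t r + r^2\<close>\<close>

lemma fps_linear_power_nth:
  fixes c :: "'a::comm_ring_1"
  shows "((fps_X + fps_const c) ^ i) $ l = of_nat (i choose l) * c ^ (i - l)"
proof -
  have t: "(of_nat (i choose k) * fps_X ^ k * fps_const c ^ (i - k)) $ l
      = (if l = k then of_nat (i choose k) * c ^ (i - k) else 0)" for k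
  proof -
    have "of_nat (i choose k) * fps_X ^ k * fps_const c ^ (i - k)
        = fps_const (of_nat (i choose k) * c ^ (i - k)) * fps_X ^ k"
      by (simp add: fps_of_nat[symmetric] fps_const_power mult_ac flip: fps_const_mult)
    then show ?thesis by simp
  qed
  have "((fps_X + fps_const c) ^ i) $ l = (\<Sum>k\<le>i. if l = k then of_nat (i choose k) * c ^ (i - k) else 0)"
    unfolding binomial_ring fps_sum_nth t ..
  also have "\<dots> = of_nat (i choose l) * c ^ (i - l)"
    by (cases "l \<le> i") (auto simp: binomial_eq_0)
  finally show ?thesis .
qed

text \<open>The ultraspherical polynomial \<open>C_k^(m)\<close>, the coefficient of
  \<open>r^k\<close> in \<open>(1 - 2 r t + r^2)^(-m)\<close>; the index is
  \<open>j = k - i\<close>, where \<open>i\<close> is the exponent of \<open>r^2 - 2 r t\<close> in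
  the binomial series.\<close>

definition poisson_coeff :: "real \<Rightarrow> real \<Rightarrow> nat \<Rightarrow> real" where
  "poisson_coeff m t k = (\<Sum>j\<le>k div 2. (- m gchoose (k - j)) * real (k - j choose j) * (- 2 * t) ^ (k - 2 * j))"

lemma poisson_coeff_fps:
  "poisson_coeff m t k = (fps_binomial (- m) oo (fps_X\<^sup>2 + fps_const (- 2 * t) * fps_X)) $ k"
proof -
  have p: "((fps_X\<^sup>2 + fps_const (- 2 * t) * fps_X) ^ i) $ k =
      (if k < i then 0 else real (i choose (k - i)) * (- 2 * t) ^ (i - (k - i)))" for i
  proof -
    have "(fps_X\<^sup>2 + fps_const (- 2 * t) * fps_X) ^ i = fps_X ^ i * (fps_X + fps_const (- 2 * t)) ^ i"
      unfolding power_mult_distrib[symmetric] by (simp add: power2_eq_square algebra_simps)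
    then show ?thesis by (simp only: fps_X_power_mult_nth fps_linear_power_nth)
  qed
  have "(fps_binomial (- m) oo (fps_X\<^sup>2 + fps_const (- 2 * t) * fps_X)) $ k
      = (\<Sum>i=0..k. (- m gchoose i) * (real (i choose (k - i)) * (- 2 * t) ^ (i - (k - i))))"
    unfolding fps_compose_nth p by (intro sum.cong) auto
  also have "\<dots> = (\<Sum>j=0..k. (- m gchoose (k - j)) * (real (k - j choose j) * (- 2 * t) ^ (k - j - j)))"
    by (subst sum.atLeastAtMost_rev) (intro sum.cong refl, auto)
  also have "\<dots> = (\<Sum>j\<le>k div 2. (- m gchoose (k - j)) * (real (k - j choose j) * (- 2 * t) ^ (k - j - j)))"
    by (intro sum.mono_neutral_right) (auto simp: binomial_eq_0)
  also have "\<dots> = poisson_coeff m t k"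
  proof -
    have "k - j - j = k - 2 * j" for j by simp
    then show ?thesis unfolding poisson_coeff_def by (simp only: mult.assoc)
  qed
  finally show ?thesis by (rule sym)
qed

text \<open>The factor \<open>1 - r^2\<close> of the Poisson kernel subtracts the coefficient two
  places earlier. Its summand \<open>j - 1\<close> has the same power of \<open>t\<close> as the
  summand \<open>j\<close> for \<open>k\<close>, which explains the second term of
  \<open>zonal_coeff\<close>.\<close>

lemma poly_zonal_poly_coeff:
  "poly (zonal_poly m k) t = poisson_coeff m t k - (if k < 2 then 0 else poisson_coeff m t (k - 2))"
proof -
  let ?s = "\<lambda>j. if j = 0 then 0 else (- m gchoose (k - 1 - j)) * real (k - 1 - j choose (j - 1)) * (- 2 * t) ^ (k - 2 * j)"
  have "poly (zonal_poly m k) t = poisson_coeff m t k - (\<Sum>j\<le>k div 2. ?s j)"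
    unfolding poly_zonal_poly zonal_solid_def zonal_coeff_def poisson_coeff_def sum_subtractf[symmetric]
  proof (intro sum.cong refl)
    fix j
    have e: "(- 2 * t) ^ (k - 2 * j) = (- 2) ^ (k - 2 * j) * t ^ (k - 2 * j)" by (rule power_mult_distrib)
    show "(- 2) ^ (k - 2 * j) * ((- m gchoose (k - j)) * real (k - j choose j)
        - (if j = 0 then 0 else (- m gchoose (k - 1 - j)) * real (k - 1 - j choose (j - 1))))
        * (t ^ (k - 2 * j) * 1 ^ j)
      = (- m gchoose (k - j)) * real (k - j choose j) * (- 2 * t) ^ (k - 2 * j) - ?s j"
      unfolding e by (cases "j = 0") (simp_all add: algebra_simps del: One_nat_def)
  qed
  also have "(\<Sum>j\<le>k div 2. ?s j) = (if k < 2 then 0 else poisson_coeff m t (k - 2))"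
  proof (cases "k < 2")
    case True
    then have "k div 2 = 0" by simp
    then show ?thesis using True by simp
  next
    case False
    have "(\<Sum>j\<le>k div 2. ?s j) = (\<Sum>j<k div 2. ?s (Suc j))"
      by (subst sum.atMost_shift) simp
    also have "\<dots> = poisson_coeff m t (k - 2)"
    proof -
      have e: "{..(k - 2) div 2} = {..<k div 2}" using False by auto
      show ?thesis unfolding poisson_coeff_def e
        by (intro sum.cong refl) (auto simp: numeral_2_eq_2 diff_diff_left)
    qed
    finally show ?thesis using False by simp
  qed
  finally show ?thesis .
qed

text \<open>The Gegenbauer recurrence, from the differential equation of \<open>(1 - 2 t r + r\<^sup>2)\<^bsup>-m\<^esup>\<close> in \<open>r\<close>.\<close>

lemma fps_gegenbauer_recurrence:
  fixes F :: "'a::field_char_0 fps"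
  assumes ode: "(1 - fps_const (2 * t) * fps_X + fps_X\<^sup>2) * fps_deriv F = fps_const m * (fps_const (2 * t) - 2 * fps_X) * F"
  shows "F $ 1 = 2 * m * t * F $ 0"
    "of_nat (k + 2) * F $ (k + 2) = 2 * (of_nat (k + 1) + m) * t * F $ (k + 1) - (of_nat k + 2 * m) * F $ k"
proof -
  have two: "2 * fps_X = (fps_const 2 * fps_X :: 'a fps)"
    by (simp add: numeral_fps_const)
  have L: "(1 - fps_const (2 * t) * fps_X + fps_X\<^sup>2) * fps_deriv F
      = fps_deriv F - fps_const (2 * t) * (fps_X * fps_deriv F) + fps_X ^ 2 * fps_deriv F"
    by (simp add: algebra_simps)
  have R: "fps_const m * (fps_const (2 * t) - 2 * fps_X) * F
      = fps_const (m * (2 * t)) * F - fps_const (2 * m) * (fps_X * F)"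
    unfolding two by (simp add: algebra_simps flip: fps_const_mult)
  have eq: "(fps_deriv F - fps_const (2 * t) * (fps_X * fps_deriv F) + fps_X ^ 2 * fps_deriv F) $ n
      = (fps_const (m * (2 * t)) * F - fps_const (2 * m) * (fps_X * F)) $ n" for n
    using ode unfolding L R by simp
  show "F $ 1 = 2 * m * t * F $ 0"
    using eq[of 0] by (simp add: fps_X_power_mult_nth algebra_simps)
  show "of_nat (k + 2) * F $ (k + 2) = 2 * (of_nat (k + 1) + m) * t * F $ (k + 1) - (of_nat k + 2 * m) * F $ k"
    using eq[of "Suc k"]
    unfolding fps_sub_nth fps_add_nth fps_mult_left_const_nth fps_X_mult_nth fps_X_power_mult_nth fps_deriv_nth
    by (cases k) (simp_all add: algebra_simps)
qed

lemma fps_binomial_deriv_mult: "(1 + fps_X) * fps_deriv (fps_binomial a) = fps_const a * fps_binomial (a::'a::field_char_0)"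
proof (rule fps_ext)
  fix n
  show "((1 + fps_X) * fps_deriv (fps_binomial a)) $ n = (fps_const a * fps_binomial a) $ n"
    using gbinomial_Suc_mult[of a n] by (cases n) (simp_all add: algebra_simps)
qed

text \<open>The differential equation of \<open>(1 + X)^(-m)\<close> is carried through the
  substitution \<open>X = r^2 - 2 t r\<close>, which is legitimate because the substituted series
  has constant term 0.\<close>

lemma poisson_coeff_recurrence:
  "poisson_coeff m t 0 = 1" "poisson_coeff m t 1 = 2 * m * t"
  "real (k + 2) * poisson_coeff m t (k + 2) = 2 * (real (k + 1) + m) * t * poisson_coeff m t (k + 1) - (real k + 2 * m) * poisson_coeff m t k"
proof -
  define P where "P = (fps_X\<^sup>2 + fps_const (- 2 * t) * fps_X :: real fps)"
  have P0: "P $ 0 = 0" by (simp add: P_def)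
  define F where "F = fps_binomial (- m) oo P"
  have "(1 + P) * fps_deriv F = ((1 + fps_X) * fps_deriv (fps_binomial (- m)) oo P) * fps_deriv P"
    unfolding F_def fps_compose_deriv[OF P0] fps_compose_mult_distrib[OF P0] fps_compose_add_distrib
    by (simp add: fps_X_fps_compose_startby0[OF P0] mult.assoc)
  also have "\<dots> = fps_const (- m) * F * fps_deriv P"
    unfolding fps_binomial_deriv_mult fps_compose_mult_distrib[OF P0] F_def by simp
  finally have "(1 - fps_const (2 * t) * fps_X + fps_X\<^sup>2) * fps_deriv F = fps_const m * (fps_const (2 * t) - 2 * fps_X) * F"
    unfolding P_def by (simp add: algebra_simps power2_eq_square flip: fps_const_neg)
  note rec = fps_gegenbauer_recurrence[OF this]
  have F: "F $ i = poisson_coeff m t i" for i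
    unfolding F_def P_def poisson_coeff_fps ..
  show "poisson_coeff m t 0 = 1" by (simp add: poisson_coeff_def)
  then show "poisson_coeff m t 1 = 2 * m * t" using rec(1) by (simp add: F)
  show "real (k + 2) * poisson_coeff m t (k + 2) = 2 * (real (k + 1) + m) * t * poisson_coeff m t (k + 1) - (real k + 2 * m) * poisson_coeff m t k"
    using rec(2)[of k] unfolding F .
qed

section \<open>Factorization over the complex numbers, bounds and summation\<close>

text \<open>Coefficient of \<open>r^k\<close> in \<open>(1 - w r)^(-m)\<close>; for \<open>w\<close>
  on the unit circle with real part \<open>t\<close>, the quadratic \<open>1 - 2 t r + r^2\<close>
  is \<open>(1 - w r) (1 - cnj w r)\<close>.\<close>

definition linear_power_coeff :: "real \<Rightarrow> complex \<Rightarrow> nat \<Rightarrow> complex" where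
  "linear_power_coeff m w k = (complex_of_real (- m) gchoose k) * (- w) ^ k"

text \<open>The product of the two factor series solves the same differential equation, so both
  sides obey one recurrence with equal initial values. The binomial series in
  \<open>r^2 - 2 r t\<close> leaves its disc of convergence when \<open>t\<close> is close to -1 and
  \<open>r\<close> close to 1, whereas the series of the factors converge for all
  \<open>r < 1\<close>.\<close>

lemma poisson_coeff_product:
  assumes w: "norm w = 1" "Re w = t"
  shows "complex_of_real (poisson_coeff m t k) = (\<Sum>i\<le>k. linear_power_coeff m w i * linear_power_coeff m (cnj w) (k - i))"
proof -
  define E where "E v = Abs_fps (linear_power_coeff m v)" for v
  define mc where "mc = complex_of_real m"
  have E_ode: "(1 - fps_const v * fps_X) * fps_deriv (E v) = fps_const mc * fps_const v * E v" for v
    unfolding fps_const_mult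
  proof (rule fps_ext)
    fix n
    have "(1 - fps_const v * fps_X) * fps_deriv (E v) = fps_deriv (E v) - fps_const v * (fps_X * fps_deriv (E v))"
      by (simp add: algebra_simps)
    moreover have "(fps_deriv (E v) - fps_const v * (fps_X * fps_deriv (E v))) $ n = (fps_const (mc * v) * E v) $ n"
    proof (cases n)
      case 0
      then show ?thesis by (simp add: E_def linear_power_coeff_def mc_def)
    next
      case (Suc k)
      have g: "(complex_of_real (- m) gchoose Suc n) * (of_nat n + 1) = (complex_of_real (- m) gchoose n) * (- mc - of_nat n)"
        using gbinomial_Suc_mult[of "complex_of_real (- m)" n] by (simp add: mc_def)
      have "(fps_deriv (E v) - fps_const v * (fps_X * fps_deriv (E v))) $ n
         = ((complex_of_real (- m) gchoose Suc n) * (of_nat n + 1)) * (- v) ^ Suc n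
           - v * (of_nat n * ((complex_of_real (- m) gchoose n) * (- v) ^ n))"
        using Suc by (simp add: E_def linear_power_coeff_def algebra_simps)
      also have "\<dots> = (mc * v) * ((complex_of_real (- m) gchoose n) * (- v) ^ n)"
        unfolding g by (simp add: algebra_simps)
      finally show ?thesis by (simp add: E_def linear_power_coeff_def)
    qed
    ultimately show "((1 - fps_const v * fps_X) * fps_deriv (E v)) $ n = (fps_const (mc * v) * E v) $ n" by simp
  qed
  define F where "F = E w * E (cnj w)"
  define tc where "tc = complex_of_real t"
  have ww: "w + cnj w = 2 * tc" "w * cnj w = 1"
    using w by (auto simp: tc_def complex_add_cnj complex_norm_square[symmetric])
  have quad: "1 - fps_const (2 * tc) * fps_X + fps_X\<^sup>2 = (1 - fps_const w * fps_X) * (1 - fps_const (cnj w) * fps_X)"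
  proof -
    have ring1: "(1 - a * X) * (1 - b * X) = 1 - (a + b) * X + (a * b) * X\<^sup>2" for a b X :: "complex fps"
      by (simp add: algebra_simps power2_eq_square)
    show ?thesis unfolding ring1[where a="fps_const w" and b="fps_const (cnj w)" and X=fps_X] fps_const_add fps_const_mult ww
      by (simp only: fps_const_1_eq_1 mult_1_left)
  qed
  have lin: "fps_const (2 * tc) - 2 * fps_X = fps_const w * (1 - fps_const (cnj w) * fps_X) + fps_const (cnj w) * (1 - fps_const w * fps_X)"
  proof -
    have ring2: "a * (1 - b * X) + b * (1 - a * X) = (a + b) - 2 * (a * b) * X" for a b X :: "complex fps"
      by (simp add: algebra_simps)
    show ?thesis unfolding ring2[where a="fps_const w" and b="fps_const (cnj w)" and X=fps_X] fps_const_add fps_const_mult ww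
      by (simp only: fps_const_1_eq_1 mult_1_right)
  qed
  have ring3: "(p * q) * (e * df + de * f) = (p * de) * (q * f) + (q * df) * (p * e)" for p q e de f df :: "complex fps"
    by (simp add: algebra_simps)
  have ring4: "(c * a * e) * (q * f) + (c * b * f) * (p * e) = c * (a * q + b * p) * (e * f)" for a b c p q e f :: "complex fps"
    by (simp add: algebra_simps)
  have "(1 - fps_const (2 * tc) * fps_X + fps_X\<^sup>2) * fps_deriv F
     = ((1 - fps_const w * fps_X) * fps_deriv (E w)) * ((1 - fps_const (cnj w) * fps_X) * E (cnj w))
     + ((1 - fps_const (cnj w) * fps_X) * fps_deriv (E (cnj w))) * ((1 - fps_const w * fps_X) * E w)"
    unfolding quad F_def fps_deriv_mult by (rule ring3)
  also have "\<dots> = fps_const mc * (fps_const (2 * tc) - 2 * fps_X) * F"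
    unfolding E_ode lin F_def by (rule ring4)
  finally have ode: "(1 - fps_const (2 * tc) * fps_X + fps_X\<^sup>2) * fps_deriv F = fps_const mc * (fps_const (2 * tc) - 2 * fps_X) * F" .
  note rec = fps_gegenbauer_recurrence[OF this]
  have F0: "F $ 0 = 1" by (simp add: F_def E_def linear_power_coeff_def)
  have "complex_of_real (poisson_coeff m t k) = F $ k \<and> complex_of_real (poisson_coeff m t (Suc k)) = F $ (Suc k)"
  proof (induction k)
    case 0
    show ?case using rec(1) F0 poisson_coeff_recurrence(1,2)[of m t] by (simp add: mc_def tc_def)
  next
    case (Suc k)
    have "complex_of_real (real (k + 2) * poisson_coeff m t (k + 2)) = of_nat (k + 2) * F $ (k + 2)"
      unfolding poisson_coeff_recurrence(3) rec(2) conjunct1[OF Suc, symmetric] Suc_eq_plus1[symmetric] conjunct2[OF Suc, symmetric]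
        mc_def tc_def by (simp only: of_real_mult of_real_diff of_real_add of_real_of_nat_eq of_real_numeral)
    then have e: "complex_of_nat (k + 2) * complex_of_real (poisson_coeff m t (k + 2)) = of_nat (k + 2) * F $ (k + 2)"
      by (simp only: of_real_mult of_real_of_nat_eq)
    have n0: "complex_of_nat (k + 2) \<noteq> 0" unfolding of_nat_eq_0_iff by simp
    have "complex_of_real (poisson_coeff m t (k + 2)) = F $ (k + 2)"
      using mult_left_cancel[THEN iffD1, OF n0 e] .
    then show ?case using conjunct2[OF Suc] by (simp only: add_2_eq_Suc')
  qed
  then show ?thesis by (simp add: F_def E_def fps_mult_nth atMost_atLeast0)
qed

text \<open>The Cauchy square of the absolute binomial coefficients: a majorant that is uniform in
  \<open>t\<close> and still has a power series convergent for \<open>r < 1\<close>.\<close>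

definition poisson_coeff_bound :: "real \<Rightarrow> nat \<Rightarrow> real" where
  "poisson_coeff_bound m k = (\<Sum>i\<le>k. norm (complex_of_real (- m) gchoose i) * norm (complex_of_real (- m) gchoose (k - i)))"

lemma unit_complex_exists:
  assumes "\<bar>t\<bar> \<le> 1"
  obtains w where "norm w = 1" "Re w = t"
proof
  have "t\<^sup>2 \<le> 1" using assms by (simp add: abs_square_le_1)
  then show "norm (Complex t (sqrt (1 - t\<^sup>2))) = 1" by (simp add: complex_norm)
qed simp

lemma poisson_coeff_le_bound:
  assumes "\<bar>t\<bar> \<le> 1"
  shows "\<bar>poisson_coeff m t k\<bar> \<le> poisson_coeff_bound m k"
proof -
  obtain w where w: "norm w = 1" "Re w = t" using unit_complex_exists[OF assms] .
  have "\<bar>poisson_coeff m t k\<bar> = norm (complex_of_real (poisson_coeff m t k))" by simp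
  also have "\<dots> \<le> poisson_coeff_bound m k"
    unfolding poisson_coeff_product[OF w] poisson_coeff_bound_def
    by (intro sum_norm_le) (simp add: linear_power_coeff_def norm_mult norm_power w)
  finally show ?thesis .
qed

text \<open>The Cauchy product of two absolutely convergent binomial series, at \<open>- w r\<close>
  and at its conjugate. The principal powers multiply to a power of the squared modulus of
  \<open>1 - w r\<close>, which is the quadratic in \<open>r\<close>.\<close>

lemma poisson_coeff_sums:
  assumes t: "\<bar>t\<bar> \<le> 1" and r: "0 \<le> r" "r < 1"
  shows "(\<lambda>k. poisson_coeff m t k * r ^ k) sums (1 - 2 * r * t + r\<^sup>2) powr (- m)"
    and "summable (\<lambda>k. poisson_coeff_bound m k * r ^ k)"
proof -
  obtain w where w: "norm w = 1" "Re w = t" using unit_complex_exists[OF t] .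
  let ?a = "complex_of_real (- m)"
  have abs: "summable (\<lambda>k. norm (linear_power_coeff m v k * of_real r ^ k))" if "norm v = 1" for v
  proof -
    have "summable (\<lambda>k. norm ((?a gchoose k) * (- v * of_real r) ^ k))"
      using that r by (intro abs_summable_in_conv_radius)
        (auto simp: conv_radius_gchoose norm_mult one_ereal_def)
    then show ?thesis unfolding linear_power_coeff_def power_mult_distrib mult.assoc .
  qed
  have sum: "(\<lambda>k. linear_power_coeff m v k * of_real r ^ k) sums (1 - v * of_real r) powr ?a" if "norm v = 1" for v
  proof -
    have "norm (- v * of_real r) < 1" using that r by (simp add: norm_mult)
    from gen_binomial_complex[OF this, of ?a]
    have "(\<lambda>n. (?a gchoose n) * (- v * of_real r) ^ n) sums (1 - v * of_real r) powr ?a" by simp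
    then show ?thesis unfolding linear_power_coeff_def power_mult_distrib mult.assoc .
  qed
  have wc: "norm (cnj w) = 1" using w by simp
  have "(\<lambda>k. \<Sum>i\<le>k. (linear_power_coeff m w i * of_real r ^ i) * (linear_power_coeff m (cnj w) (k - i) * of_real r ^ (k - i)))
      sums ((1 - w * of_real r) powr ?a * (1 - cnj w * of_real r) powr ?a)"
    using Cauchy_product_sums[OF abs[OF w(1)] abs[OF wc]]
    unfolding sums_unique[OF sum[OF w(1)], symmetric] sums_unique[OF sum[OF wc], symmetric] .
  also have "(\<lambda>k. \<Sum>i\<le>k. (linear_power_coeff m w i * of_real r ^ i) * (linear_power_coeff m (cnj w) (k - i) * of_real r ^ (k - i)))
      = (\<lambda>k. complex_of_real (poisson_coeff m t k * r ^ k))"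
  proof
    fix k
    have "(\<Sum>i\<le>k. (linear_power_coeff m w i * of_real r ^ i) * (linear_power_coeff m (cnj w) (k - i) * of_real r ^ (k - i)))
      = (\<Sum>i\<le>k. linear_power_coeff m w i * linear_power_coeff m (cnj w) (k - i) * of_real r ^ k)"
    proof (intro sum.cong refl)
      fix i assume "i \<in> {..k}"
      then have "complex_of_real r ^ k = of_real r ^ i * of_real r ^ (k - i)" by (simp flip: power_add)
      then show "(linear_power_coeff m w i * of_real r ^ i) * (linear_power_coeff m (cnj w) (k - i) * of_real r ^ (k - i))
        = linear_power_coeff m w i * linear_power_coeff m (cnj w) (k - i) * of_real r ^ k" by simp
    qed
    then show "(\<Sum>i\<le>k. (linear_power_coeff m w i * of_real r ^ i) * (linear_power_coeff m (cnj w) (k - i) * of_real r ^ (k - i)))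
      = complex_of_real (poisson_coeff m t k * r ^ k)"
      using poisson_coeff_product[OF w, of m k] by (simp add: sum_distrib_right)
  qed
  also have "(1 - w * of_real r) powr ?a * (1 - cnj w * of_real r) powr ?a
      = complex_of_real ((1 - 2 * r * t + r\<^sup>2) powr (- m))"
  proof -
    define z where "z = 1 - w * of_real r"
    have "\<bar>Re w\<bar> \<le> 1" using abs_Re_le_cmod[of w] w by simp
    then have "r * t < 1" using r w by (smt (verit) mult_left_le)
    then have Re_z: "Re z > 0" by (simp add: z_def w mult.commute)
    then have z0: "z \<noteq> 0" by auto
    have cz: "1 - cnj w * of_real r = cnj z" by (simp add: z_def)
    \<comment> \<open>The positive real part keeps \<open>z\<close> off the branch cut, so
      conjugation commutes with the principal power.\<close>
    have "z powr ?a * cnj z powr ?a = z powr ?a * cnj (z powr ?a)"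
      using Re_z by (subst cnj_powr) auto
    also have "\<dots> = complex_of_real ((norm (z powr ?a))\<^sup>2)"
      by (rule complex_norm_square[symmetric])
    also have "norm (z powr ?a) = norm z powr (- m)"
      by (subst norm_powr_real_powr') auto
    also have "(norm z powr (- m))\<^sup>2 = ((norm z)\<^sup>2) powr (- m)"
      using z0 by (simp add: power2_eq_square powr_mult)
    also have "(norm z)\<^sup>2 = 1 - 2 * r * t + r\<^sup>2"
    proof -
      have "(Re w)\<^sup>2 + (Im w)\<^sup>2 = 1" using w(1) by (simp add: cmod_power2[symmetric])
      then have i: "(Im w)\<^sup>2 = 1 - t\<^sup>2" using w(2) by simp
      have "(norm z)\<^sup>2 = (1 - t * r)\<^sup>2 + (Im w)\<^sup>2 * r\<^sup>2"
        unfolding cmod_power2 by (simp add: z_def w power_mult_distrib)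
      then show ?thesis unfolding i by (simp add: power2_eq_square algebra_simps)
    qed
    finally show ?thesis unfolding z_def cz[unfolded z_def] .
  qed
  finally show "(\<lambda>k. poisson_coeff m t k * r ^ k) sums (1 - 2 * r * t + r\<^sup>2) powr (- m)"
    unfolding sums_of_real_iff .
  have n1: "summable (\<lambda>k. norm (norm (?a gchoose k) * r ^ k))"
    using abs[of 1] r by (simp add: linear_power_coeff_def norm_mult norm_power)
  have sb: "summable (\<lambda>k. \<Sum>i\<le>k. (norm (?a gchoose i) * r ^ i) * (norm (?a gchoose (k - i)) * r ^ (k - i)))"
    using Cauchy_product_sums[OF n1 n1] by (rule sums_summable)
  have eq: "(\<lambda>k. \<Sum>i\<le>k. (norm (?a gchoose i) * r ^ i) * (norm (?a gchoose (k - i)) * r ^ (k - i)))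
     = (\<lambda>k. poisson_coeff_bound m k * r ^ k)"
    unfolding poisson_coeff_bound_def sum_distrib_right
  proof (intro ext sum.cong refl)
    fix k i :: nat assume "i \<in> {..k}"
    then have "r ^ k = r ^ i * r ^ (k - i)" by (simp flip: power_add)
    then show "(norm (?a gchoose i) * r ^ i) * (norm (?a gchoose (k - i)) * r ^ (k - i))
      = norm (?a gchoose i) * norm (?a gchoose (k - i)) * r ^ k" by (simp only: mult_ac)
  qed
  show "summable (\<lambda>k. poisson_coeff_bound m k * r ^ k)" using sb unfolding eq .
qed

end

section \<open>The Poisson kernel as a series of zonal polynomials\<close>

definition poisson_kernel :: "real \<Rightarrow> real \<Rightarrow> real \<Rightarrow> real" where
  "poisson_kernel m r t = (1 - r\<^sup>2) * (1 - 2 * r * t + r\<^sup>2) powr (- m)"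

definition zonal_bound :: "real \<Rightarrow> nat \<Rightarrow> real" where
  "zonal_bound m k = poisson_coeff_bound m k + (if k < 2 then 0 else poisson_coeff_bound m (k - 2))"

lemma poisson_coeff_bound_nonneg: "poisson_coeff_bound m k \<ge> 0"
  unfolding poisson_coeff_bound_def by (intro sum_nonneg) simp

lemma zonal_poly_le_bound:
  assumes "\<bar>t\<bar> \<le> 1" shows "\<bar>poly (zonal_poly m k) t\<bar> \<le> zonal_bound m k"
  unfolding poly_zonal_poly_coeff zonal_bound_def
  using poisson_coeff_le_bound[OF assms, of m k] poisson_coeff_le_bound[OF assms, of m "k - 2"]
  by (auto intro: order.trans[OF abs_triangle_ineq4])

lemma sums_shift2:
  fixes f :: "nat \<Rightarrow> real"
  assumes "(\<lambda>k. f k * r ^ k) sums s"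
  shows "(\<lambda>k. (if k < 2 then 0 else f (k - 2)) * r ^ k) sums (r\<^sup>2 * s)"
proof -
  have "(\<lambda>k. r\<^sup>2 * (f k * r ^ k)) sums (r\<^sup>2 * s)" using assms by (rule sums_mult)
  also have "(\<lambda>k. r\<^sup>2 * (f k * r ^ k)) = (\<lambda>k. (if k + 2 < 2 then 0 else f (k + 2 - 2)) * r ^ (k + 2))"
    by (auto simp: power_add power2_eq_square mult_ac)
  finally show ?thesis
    by (subst (asm) sums_iff_shift[of "\<lambda>k. (if k < 2 then 0 else f (k - 2)) * r ^ k" 2]) (simp add: numeral_2_eq_2)
qed

lemma poisson_kernel_sums:
  assumes "\<bar>t\<bar> \<le> 1" "0 \<le> r" "r < 1"
  shows "(\<lambda>k. poly (zonal_poly m k) t * r ^ k) sums poisson_kernel m r t"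
    and "summable (\<lambda>k. zonal_bound m k * r ^ k)"
proof -
  note G = poisson_coeff_sums[OF assms, of m]
  show "(\<lambda>k. poly (zonal_poly m k) t * r ^ k) sums poisson_kernel m r t"
    using sums_diff[OF G(1) sums_shift2[OF G(1)]]
    unfolding poly_zonal_poly_coeff poisson_kernel_def by (simp add: algebra_simps)
  show "summable (\<lambda>k. zonal_bound m k * r ^ k)"
    using summable_add[OF G(2) sums_summable[OF sums_shift2[OF summable_sums[OF G(2)]]]]
    unfolding zonal_bound_def by (simp add: distrib_right)
qed

text \<open>The top coefficient comes from \<open>j = 0\<close> alone, and for \<open>m > 0\<close>
  the generalized binomial coefficient of \<open>- m\<close> never vanishes.\<close>

lemma degree_zonal_poly:
  assumes "m > 0"
  shows "degree (zonal_poly m k) = k"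
proof (rule antisym)
  show "degree (zonal_poly m k) \<le> k"
    unfolding zonal_poly_def
  proof (rule degree_sum_le)
    fix j
    have "degree (monom (zonal_coeff m k j) (k - 2 * j)) \<le> k - 2 * j" by (rule degree_monom_le)
    then show "degree (monom (zonal_coeff m k j) (k - 2 * j)) \<le> k" by simp
  qed simp
  have "coeff (zonal_poly m k) k = (\<Sum>j\<le>k div 2. if j = 0 then zonal_coeff m k j else 0)"
    unfolding zonal_poly_def coeff_sum coeff_monom by (intro sum.cong refl) auto
  also have "\<dots> = (- 2) ^ k * (- m gchoose k)" by (simp add: zonal_coeff_def)
  also have "\<dots> \<noteq> 0" using pochhammer_pos[OF assms, of k] by (simp add: gbinomial_pochhammer)
  finally show "k \<le> degree (zonal_poly m k)" by (rule le_degree)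
qed

lemma zonal_poly_0 [simp]: "zonal_poly m 0 = 1"
  by (simp add: zonal_poly_def zonal_coeff_def monom_0)

subsection \<open>The reproducing kernel of the spherical harmonics\<close>

lemma measure_unit_sphere [simp]: "measure (sphere_measure :: 'a::euclidean_space measure) unit_sphere = 1"
  using sphere.prob_space by simp

text \<open>The working form of the reproducing kernel, with \<open>DIM('a) / 2 = (d + 1)/2\<close>.
  Its agreement with \<open>zonal_kernel\<close>, which is defined through dimension and Gegenbauer
  polynomial, is \<open>zonal_kernel_eq\<close>.\<close>

definition zonal_harmonic :: "'a::euclidean_space itself \<Rightarrow> nat \<Rightarrow> real poly" where
  "zonal_harmonic _ l = zonal_poly (real DIM('a) / 2) l"

definition poisson :: "'a::euclidean_space itself \<Rightarrow> real \<Rightarrow> real \<Rightarrow> real" where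
  "poisson _ = poisson_kernel (real DIM('a) / 2)"

lemma inner_sphere_le: "x \<in> unit_sphere \<Longrightarrow> y \<in> unit_sphere \<Longrightarrow> \<bar>x \<bullet> (y::'a::euclidean_space)\<bar> \<le> 1"
  using Cauchy_Schwarz_ineq2[of x y] by simp

lemma zonal_solid_on_sphere:
  fixes x y :: "'a::euclidean_space"
  assumes "y \<in> unit_sphere"
  shows "zonal_solid (real DIM('a) / 2) k (x \<bullet> y) (y \<bullet> y) = poly (zonal_harmonic TYPE('a) k) (x \<bullet> y)"
  using assms by (simp add: zonal_harmonic_def poly_zonal_poly dot_square_norm)

lemma solid_harmonics_continuous_on: "u \<in> solid_harmonics l \<Longrightarrow> continuous_on S u"
  unfolding solid_harmonics_def by (auto intro: real_polynomial_continuous_on)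

lemma one_solid_harmonic: "(\<lambda>_. 1) \<in> solid_harmonics 0"
  by (auto simp: solid_harmonics_def homogeneous_def harmonic_iff_pd real_polynomial_function.intros pd_const[abs_def])

lemma continuous_on_poly_inner: "continuous_on S (\<lambda>y::'a::euclidean_space. poly p (x \<bullet> y))"
  by (intro continuous_intros)

lemma continuous_on_poisson_inner:
  assumes x: "x \<in> unit_sphere" and r: "0 \<le> r" "r < 1"
  shows "continuous_on unit_sphere (\<lambda>y::'a::euclidean_space. poisson TYPE('a) r (x \<bullet> y))"
proof -
  have "1 - 2 * r * (x \<bullet> y) + r\<^sup>2 > 0" if "y \<in> unit_sphere" for y
  proof -
    have "r * (x \<bullet> y) \<le> r * 1" using inner_sphere_le[OF x that] r by (intro mult_left_mono) auto
    moreover have "(1 - r)\<^sup>2 > 0" using r by simp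
    ultimately show ?thesis by (simp add: power2_eq_square algebra_simps)
  qed
  then show ?thesis unfolding poisson_def poisson_kernel_def
    by (intro continuous_intros) (auto simp: less_imp_neq[symmetric])
qed

lemma zonal_harmonic_orthogonal:
  fixes x :: "'a::euclidean_space"
  assumes dim: "2 \<le> DIM('a)" and x: "x \<in> unit_sphere" and u: "u \<in> solid_harmonics l" and kl: "k \<noteq> l"
  shows "(\<integral>y. poly (zonal_harmonic TYPE('a) k) (x \<bullet> y) * u y \<partial>sphere_measure) = 0"
proof -
  have "(\<integral>y. poly (zonal_harmonic TYPE('a) k) (x \<bullet> y) * u y \<partial>sphere_measure)
      = (\<integral>y. zonal_solid (real DIM('a) / 2) k (x \<bullet> y) (y \<bullet> y) * u y \<partial>sphere_measure)"
    by (intro Bochner_Integration.integral_cong refl) (simp add: zonal_solid_on_sphere)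
  also have "\<dots> = 0"
    by (rule solid_harmonics_orthogonal[OF dim zonal_solid_harmonic[OF x] u kl])
  finally show ?thesis .
qed

text \<open>Termwise integration of the Poisson series, justified by the majorant
  \<open>zonal_bound\<close>; orthogonality of different degrees leaves the term
  \<open>l\<close>.\<close>

lemma poisson_integral_series:
  fixes x :: "'a::euclidean_space"
  assumes dim: "2 \<le> DIM('a)" and x: "x \<in> unit_sphere" and u: "u \<in> solid_harmonics l" and r: "0 \<le> r" "r < 1"
  shows "(\<integral>y. poisson TYPE('a) r (x \<bullet> y) * u y \<partial>sphere_measure)
    = r ^ l * (\<integral>y. poly (zonal_harmonic TYPE('a) l) (x \<bullet> y) * u y \<partial>sphere_measure)"
proof -
  let ?Z = "\<lambda>k y. poly (zonal_harmonic TYPE('a) k) (x \<bullet> y)"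
  let ?f = "\<lambda>k y. ?Z k y * r ^ k * u y"
  define M where "M = zonal_bound (real DIM('a) / 2)"
  obtain C where C: "C > 0" "\<And>y. y \<in> unit_sphere \<Longrightarrow> \<bar>u y\<bar> \<le> C"
    using continuous_on_sphere_bounded[OF solid_harmonics_continuous_on[OF u]] by metis
  have P: "(\<lambda>k. ?Z k y * r ^ k) sums poisson TYPE('a) r (x \<bullet> y)" if "y \<in> unit_sphere" for y
    unfolding poisson_def zonal_harmonic_def by (intro poisson_kernel_sums inner_sphere_le x that r)
  have MS: "summable (\<lambda>k. M k * r ^ k)"
    using poisson_kernel_sums(2)[of 0 r] r by (simp add: M_def)
  have bd: "\<bar>?f k y\<bar> \<le> M k * r ^ k * C" if "y \<in> unit_sphere" for k y
    unfolding abs_mult M_def zonal_harmonic_def using r C that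
    by (intro mult_mono zonal_poly_le_bound inner_sphere_le x that) (auto simp: M_def zonal_bound_def poisson_coeff_bound_nonneg)
  have f_int: "integrable sphere_measure (?f k)" for k
    by (intro continuous_on_sphere_integrable continuous_intros solid_harmonics_continuous_on[OF u])
  have "(\<integral>y. poisson TYPE('a) r (x \<bullet> y) * u y \<partial>sphere_measure) = (\<integral>y. (\<Sum>k. ?f k y) \<partial>sphere_measure)"
  proof (intro Bochner_Integration.integral_cong refl)
    fix y :: 'a assume "y \<in> space sphere_measure"
    then have "y \<in> unit_sphere" by simp
    from sums_mult2[OF P[OF this], of "u y"]
    show "poisson TYPE('a) r (x \<bullet> y) * u y = (\<Sum>k. ?f k y)"
      by (rule sums_unique)
  qed
  also have "\<dots> = (\<Sum>k. \<integral>y. ?f k y \<partial>sphere_measure)"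
  proof (rule integral_suminf[OF f_int])
    show "AE y in sphere_measure. summable (\<lambda>k. norm (?f k y))"
    proof (rule AE_I2)
      fix y :: 'a assume "y \<in> space sphere_measure"
      then have y: "y \<in> unit_sphere" by simp
      show "summable (\<lambda>k. norm (?f k y))"
        using bd[OF y] by (intro summable_comparison_test'[OF summable_mult2[OF MS, of C], of 0]) auto
    qed
    show "summable (\<lambda>k. \<integral>y. norm (?f k y) \<partial>sphere_measure)"
    proof (rule summable_comparison_test'[OF summable_mult2[OF MS, of C], of 0])
      fix k
      have "(\<integral>y. norm (?f k y) \<partial>sphere_measure) \<le> (\<integral>y. M k * r ^ k * C \<partial>(sphere_measure :: 'a measure))"
        using f_int bd by (intro integral_mono integrable_norm) auto
      then show "norm (\<integral>y. norm (?f k y) \<partial>sphere_measure) \<le> M k * r ^ k * C"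
        by simp
    qed
  qed
  also have "\<dots> = (\<Sum>k. if k = l then \<integral>y. ?f l y \<partial>sphere_measure else 0)"
  proof (intro suminf_cong)
    fix k
    have "(\<integral>y. ?f k y \<partial>sphere_measure) = r ^ k * (\<integral>y. ?Z k y * u y \<partial>sphere_measure)"
      by (subst integral_mult_right_zero[symmetric]) (simp add: mult_ac)
    then show "(\<integral>y. ?f k y \<partial>sphere_measure) = (if k = l then \<integral>y. ?f l y \<partial>sphere_measure else 0)"
      using zonal_harmonic_orthogonal[OF dim x u, of k] by auto
  qed
  also have "\<dots> = (\<integral>y. ?f l y \<partial>sphere_measure)"
    using sums_single[of l "\<lambda>_. \<integral>y. ?f l y \<partial>sphere_measure"] by (simp add: sums_iff)
  also have "\<dots> = r ^ l * (\<integral>y. ?Z l y * u y \<partial>sphere_measure)"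
    by (subst integral_mult_right_zero[symmetric]) (simp add: mult_ac)
  finally show ?thesis .
qed

section \<open>The Poisson kernel as an approximate identity\<close>

lemma poisson_nonneg: "0 \<le> r \<Longrightarrow> r < 1 \<Longrightarrow> 0 \<le> poisson T r t"
  unfolding poisson_def poisson_kernel_def by (intro mult_nonneg_nonneg) (auto simp: abs_square_le_1)

lemma integral_poisson:
  fixes x :: "'a::euclidean_space"
  assumes dim: "2 \<le> DIM('a)" and x: "x \<in> unit_sphere" and r: "0 \<le> r" "r < 1"
  shows "(\<integral>y. poisson TYPE('a) r (x \<bullet> y) \<partial>sphere_measure) = 1"
  using poisson_integral_series[OF dim x one_solid_harmonic r]
  by (simp add: zonal_harmonic_def)

text \<open>Points at distance at least \<open>\<delta>\<close> satisfy
  \<open>t \<le> 1 - \<delta>^2 / 2\<close>. Writing the quadratic as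
  \<open>(1 - r)^2 + 2 r (1 - t)\<close> and using \<open>r \<ge> 1/2\<close> bounds it below by
  \<open>\<delta>^2 / 2\<close>.\<close>

lemma poisson_away:
  assumes r: "1/2 \<le> r" "r < 1" and t: "t \<le> 1 - \<delta>\<^sup>2 / 2" and \<delta>: "\<delta> > 0"
  shows "poisson TYPE('a::euclidean_space) r t \<le> (1 - r\<^sup>2) * (\<delta>\<^sup>2 / 2) powr (- (real DIM('a) / 2))"
proof -
  have "r * t \<le> r * (1 - \<delta>\<^sup>2 / 2)" using t r by (intro mult_left_mono) auto
  moreover have "r * \<delta>\<^sup>2 \<ge> 1/2 * \<delta>\<^sup>2" using r by (intro mult_right_mono) auto
  moreover have "(1 - r)\<^sup>2 \<ge> 0" by simp
  ultimately have "\<delta>\<^sup>2 / 2 \<le> 1 - 2 * r * t + r\<^sup>2"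
    by (simp add: power2_eq_square algebra_simps)
  then have "(1 - 2 * r * t + r\<^sup>2) powr (- (real DIM('a) / 2)) \<le> (\<delta>\<^sup>2 / 2) powr (- (real DIM('a) / 2))"
    using \<delta> by (intro powr_mono2') auto
  moreover have "0 \<le> 1 - r\<^sup>2" using r by (simp add: abs_square_le_1)
  ultimately show ?thesis unfolding poisson_def poisson_kernel_def by (intro mult_left_mono)
qed

text \<open>Positivity and total mass one let the error be written with \<open>f y - f x\<close>;
  near \<open>x\<close> continuity makes this small, elsewhere the kernel tends to 0
  uniformly.\<close>

lemma poisson_approximate_identity:
  fixes x :: "'a::euclidean_space"
  assumes dim: "2 \<le> DIM('a)" and x: "x \<in> unit_sphere" and f: "continuous_on unit_sphere f"
  shows "((\<lambda>r. \<integral>y. poisson TYPE('a) r (x \<bullet> y) * f y \<partial>sphere_measure) \<longlongrightarrow> f x) (at_left 1)"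
proof (rule tendstoI)
  fix e :: real assume e: "e > 0"
  obtain C where C: "C > 0" "\<And>y. y \<in> unit_sphere \<Longrightarrow> \<bar>f y\<bar> \<le> C"
    using continuous_on_sphere_bounded[OF f] by metis
  obtain \<delta> where \<delta>: "\<delta> > 0" "\<And>y. y \<in> unit_sphere \<Longrightarrow> dist y x < \<delta> \<Longrightarrow> dist (f y) (f x) < e / 2"
    using f x e unfolding continuous_on_iff by (metis half_gt_zero)
  \<comment> \<open>The bound \<open>2 * C\<close> on the oscillation of \<open>f\<close> times the
    factor of \<open>1 - r^2\<close> in \<open>poisson_away\<close>.\<close>
  define K where "K = 2 * C * (\<delta>\<^sup>2 / 2) powr (- (real DIM('a) / 2))"
  have K: "K \<ge> 0" using C by (simp add: K_def)
  have "((\<lambda>r::real. (1 - r\<^sup>2) * K) \<longlongrightarrow> (1 - 1\<^sup>2) * K) (at_left 1)"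
    by (intro tendsto_intros)
  then have "eventually (\<lambda>r. (1 - r\<^sup>2) * K < e / 2) (at_left 1)"
    using e by (intro order_tendstoD) auto
  moreover have "eventually (\<lambda>r::real. r \<in> {1/2<..<1}) (at_left 1)"
    by (rule eventually_at_leftI[of "1/2"]) auto
  ultimately show "eventually (\<lambda>r. dist (\<integral>y. poisson TYPE('a) r (x \<bullet> y) * f y \<partial>sphere_measure) (f x) < e) (at_left 1)"
  proof eventually_elim
    case (elim r)
    then have r: "0 \<le> r" "r < 1" "1/2 \<le> r" by auto
    let ?P = "\<lambda>y. poisson TYPE('a) r (x \<bullet> y)"
    note cont = continuous_on_poisson_inner[OF x r(1,2)]
    \<comment> \<open>The sum of the near and the far estimate dominates in both cases, so that a
      single integration finishes the argument.\<close>
    have bd: "\<bar>?P y * (f y - f x)\<bar> \<le> ?P y * (e / 2) + (1 - r\<^sup>2) * K" if y: "y \<in> unit_sphere" for y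
    proof (cases "dist y x < \<delta>")
      case True
      have "0 \<le> (1 - r\<^sup>2) * K" using r K by (simp add: abs_square_le_1)
      moreover have "\<bar>?P y * (f y - f x)\<bar> \<le> ?P y * (e / 2)"
        unfolding abs_mult using \<delta>(2)[OF y True] poisson_nonneg[OF r(1,2)]
        by (intro mult_mono) (auto simp: dist_real_def)
      ultimately show ?thesis by simp
    next
      case False
      have "(dist y x)\<^sup>2 = 2 - 2 * (x \<bullet> y)"
        using x y by (simp add: dist_norm power2_norm_eq_inner inner_diff_left inner_diff_right inner_commute)
          (simp add: norm_eq_1)
      moreover have "(dist y x)\<^sup>2 \<ge> \<delta>\<^sup>2" using False \<delta>(1) by (intro power_mono) auto
      ultimately have t: "x \<bullet> y \<le> 1 - \<delta>\<^sup>2 / 2" by simp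
      have "\<bar>f y - f x\<bar> \<le> 2 * C" using C(2)[OF y] C(2)[OF x] by simp
      then have "\<bar>?P y * (f y - f x)\<bar> \<le> ((1 - r\<^sup>2) * (\<delta>\<^sup>2 / 2) powr (- (real DIM('a) / 2))) * (2 * C)"
        unfolding abs_mult abs_of_nonneg[OF poisson_nonneg[OF r(1,2)]]
        using poisson_away[OF r(3,2) t \<delta>(1), where 'a='a] r C(1)
        by (intro mult_mono) (auto simp: abs_square_le_1)
      also have "\<dots> = (1 - r\<^sup>2) * K" by (simp add: K_def)
      finally show ?thesis using poisson_nonneg[OF r(1,2), of "TYPE('a)" "x \<bullet> y"] e by (simp add: add_increasing)
    qed
    have intP: "integrable sphere_measure ?P" by (intro continuous_on_sphere_integrable cont)
    have intPf: "integrable sphere_measure (\<lambda>y. ?P y * (f y - f x))"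
      by (intro continuous_on_sphere_integrable continuous_intros cont f)
    have "(\<integral>y. ?P y * f y \<partial>sphere_measure) - f x = (\<integral>y. ?P y * f y \<partial>sphere_measure) - (\<integral>y. ?P y * f x \<partial>sphere_measure)"
      using integral_poisson[OF dim x r(1,2)] by simp
    also have "\<dots> = (\<integral>y. ?P y * (f y - f x) \<partial>sphere_measure)"
      by (subst Bochner_Integration.integral_diff[symmetric])
         (auto intro!: continuous_on_sphere_integrable continuous_intros cont f simp: right_diff_distrib)
    finally have "\<bar>(\<integral>y. ?P y * f y \<partial>sphere_measure) - f x\<bar> \<le> (\<integral>y. \<bar>?P y * (f y - f x)\<bar> \<partial>sphere_measure)"
      using integral_abs_bound[of sphere_measure "\<lambda>y. ?P y * (f y - f x)"] by simp
    also have "\<dots> \<le> (\<integral>y. ?P y * (e / 2) + (1 - r\<^sup>2) * K \<partial>sphere_measure)"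
      using bd intPf intP by (intro integral_mono integrable_abs Bochner_Integration.integrable_add) auto
    also have "\<dots> = e / 2 + (1 - r\<^sup>2) * K"
      using intP integral_poisson[OF dim x r(1,2)]
      by (subst Bochner_Integration.integral_add) auto
    also have "\<dots> < e" using elim by simp
    finally show ?case by (simp add: dist_real_def)
  qed
qed

text \<open>The Poisson integral of \<open>u\<close> is \<open>r ^ l\<close> times the integral in
  question. As \<open>r\<close> tends to 1 it converges to \<open>u x\<close>, and
  \<open>r ^ l\<close> converges to 1.\<close>

theorem zonal_harmonic_reproducing:
  fixes x :: "'a::euclidean_space"
  assumes dim: "2 \<le> DIM('a)" and x: "x \<in> unit_sphere" and u: "u \<in> solid_harmonics l"
  shows "(\<integral>y. poly (zonal_harmonic TYPE('a) l) (x \<bullet> y) * u y \<partial>sphere_measure) = u x"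
proof -
  let ?c = "\<integral>y. poly (zonal_harmonic TYPE('a) l) (x \<bullet> y) * u y \<partial>sphere_measure"
  have "((\<lambda>r. \<integral>y. poisson TYPE('a) r (x \<bullet> y) * u y \<partial>sphere_measure) \<longlongrightarrow> u x) (at_left 1)"
    by (intro poisson_approximate_identity dim x solid_harmonics_continuous_on[OF u])
  moreover have "eventually (\<lambda>r. (\<integral>y. poisson TYPE('a) r (x \<bullet> y) * u y \<partial>sphere_measure) = r ^ l * ?c) (at_left 1)"
    by (rule eventually_at_leftI[of 0]) (auto intro!: poisson_integral_series dim x u simp del: mem_sphere_0)
  ultimately have "((\<lambda>r. r ^ l * ?c) \<longlongrightarrow> u x) (at_left 1)"
    by (rule Lim_transform_eventually)
  moreover have "((\<lambda>r. r ^ l * ?c) \<longlongrightarrow> 1 ^ l * ?c) (at_left 1)"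
    by (intro tendsto_intros)
  ultimately show ?thesis by (simp add: tendsto_unique[OF trivial_limit_at_left_real])
qed

lemma poisson_integral_harmonic:
  fixes x :: "'a::euclidean_space"
  assumes "2 \<le> DIM('a)" "x \<in> unit_sphere" "u \<in> solid_harmonics l" "0 \<le> r" "r < 1"
  shows "(\<integral>y. poisson TYPE('a) r (x \<bullet> y) * u y \<partial>sphere_measure) = r ^ l * u x"
  using poisson_integral_series[OF assms] zonal_harmonic_reproducing[OF assms(1-3)] by simp

lemma zonal_harmonic_convolution:
  fixes x z :: "'a::euclidean_space"
  assumes dim: "2 \<le> DIM('a)" and x: "x \<in> unit_sphere" and z: "z \<in> unit_sphere"
  shows "(\<integral>y. poly (zonal_harmonic TYPE('a) k) (x \<bullet> y) * poly (zonal_harmonic TYPE('a) l) (z \<bullet> y) \<partial>sphere_measure)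
    = (if k = l then poly (zonal_harmonic TYPE('a) l) (x \<bullet> z) else 0)"
proof -
  let ?u = "\<lambda>y. zonal_solid (real DIM('a) / 2) l (z \<bullet> y) (y \<bullet> y)"
  have u: "?u \<in> solid_harmonics l" by (rule zonal_solid_harmonic[OF z])
  have "(\<integral>y. poly (zonal_harmonic TYPE('a) k) (x \<bullet> y) * poly (zonal_harmonic TYPE('a) l) (z \<bullet> y) \<partial>sphere_measure)
    = (\<integral>y. poly (zonal_harmonic TYPE('a) k) (x \<bullet> y) * ?u y \<partial>sphere_measure)"
    by (intro Bochner_Integration.integral_cong refl) (simp add: zonal_solid_on_sphere)
  also have "\<dots> = (if k = l then ?u x else 0)"
    using zonal_harmonic_reproducing[OF dim x u] zonal_harmonic_orthogonal[OF dim x u, of k] by auto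
  also have "?u x = poly (zonal_harmonic TYPE('a) l) (x \<bullet> z)"
    using zonal_solid_on_sphere[OF x, of l z] by (simp only: inner_commute[of z x])
  finally show ?thesis .
qed

subsection \<open>The dimension of the space of spherical harmonics\<close>

interpretation function_space: vector_space "\<lambda>(c::real) (f::'a \<Rightarrow> real) x. c * f x"
  by (rule vector_space_function_scale)

lemma sum_fun_apply: "(\<Sum>i\<in>I. (f i :: 'a \<Rightarrow> real)) y = (\<Sum>i\<in>I. f i y)"
  by (induction I rule: infinite_finite_induct) auto

lemma spherical_harmonics_cases:
  assumes "f \<in> spherical_harmonics l"
  obtains u where "u \<in> solid_harmonics l" "\<And>y. y \<in> unit_sphere \<Longrightarrow> f y = u y"
    "\<And>y. y \<notin> unit_sphere \<Longrightarrow> f y = 0"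
  using assms unfolding spherical_harmonics_eq by (auto simp: indicator_def)

lemma spherical_harmonics_I:
  assumes "u \<in> solid_harmonics l"
  shows "(\<lambda>y. indicator unit_sphere y * u y) \<in> spherical_harmonics l"
  unfolding spherical_harmonics_eq using assms by auto

lemma spherical_harmonics_continuous_on:
  assumes "f \<in> spherical_harmonics l" shows "continuous_on unit_sphere f"
proof -
  obtain u where u: "u \<in> solid_harmonics l" "\<And>y. y \<in> unit_sphere \<Longrightarrow> f y = u y"
    using spherical_harmonics_cases[OF assms] by metis
  have "continuous_on unit_sphere f \<longleftrightarrow> continuous_on unit_sphere u"
    by (rule continuous_on_cong) (use u(2) in auto)
  then show ?thesis using solid_harmonics_continuous_on[OF u(1)] by blast
qed

lemma solid_harmonics_lincomb:
  assumes u: "u \<in> solid_harmonics l" and v: "v \<in> solid_harmonics l"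
  shows "(\<lambda>y. u y + c * v y) \<in> solid_harmonics l"
proof -
  have pu: "real_polynomial_function u" and pv: "real_polynomial_function v"
    using u v by (auto simp: solid_harmonics_def)
  have cv: "real_polynomial_function (\<lambda>y. c * g y)" if "real_polynomial_function g" for g :: "'a \<Rightarrow> real"
    using that by (intro real_polynomial_function.intros(2,4))
  have p: "real_polynomial_function (\<lambda>y. u y + c * v y)"
    by (intro real_polynomial_function.intros(3) pu cv pv)
  have d: "pd b (\<lambda>y. f y + c * g y) = (\<lambda>y. pd b f y + c * pd b g y)"
    if "real_polynomial_function f" "real_polynomial_function g" for b :: 'a and f g
    using that by (auto simp: pd_add pd_cmult cv)
  have "harmonic (\<lambda>y. u y + c * v y)"
    using u v unfolding harmonic_iff_pd[OF p] d[OF pu pv] d[OF real_polynomial_function_pd[OF pu] real_polynomial_function_pd[OF pv]]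
    by (auto simp: solid_harmonics_def harmonic_iff_pd sum.distrib simp flip: sum_distrib_left)
  then show ?thesis using u v p
    by (auto simp: solid_harmonics_def homogeneous_def algebra_simps)
qed

lemma spherical_harmonics_lincomb:
  assumes "f \<in> spherical_harmonics l" "g \<in> spherical_harmonics l"
  shows "(\<lambda>y. f y + c * g y) \<in> spherical_harmonics l"
proof -
  obtain u v where uv: "u \<in> solid_harmonics l" "v \<in> solid_harmonics l"
    "f = (\<lambda>y. indicator unit_sphere y * u y)" "g = (\<lambda>y. indicator unit_sphere y * v y)"
    using assms unfolding spherical_harmonics_eq by auto
  then have "(\<lambda>y. f y + c * g y) = (\<lambda>y. indicator unit_sphere y * (u y + c * v y))"
    by (auto simp: indicator_def)
  then show ?thesis using spherical_harmonics_I[OF solid_harmonics_lincomb[OF uv(1,2), of c]] by simp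
qed

lemma zero_spherical_harmonics: "(\<lambda>_. 0) \<in> spherical_harmonics l"
proof -
  have "(\<lambda>_. 0) \<in> solid_harmonics l"
    by (auto simp: solid_harmonics_def homogeneous_def harmonic_iff_pd real_polynomial_function.intros pd_const[abs_def])
  from spherical_harmonics_I[OF this] show ?thesis by simp
qed

lemma spherical_harmonics_sum:
  assumes "\<And>f. f \<in> B \<Longrightarrow> f \<in> spherical_harmonics l" "g \<in> spherical_harmonics l"
  shows "(\<lambda>y. g y + (\<Sum>f\<in>B. c f * f y)) \<in> spherical_harmonics l"
  using assms
proof (induction B arbitrary: g rule: infinite_finite_induct)
  case (insert f B)
  have "(\<lambda>y. (g y + c f * f y) + (\<Sum>f\<in>B. c f * f y)) \<in> spherical_harmonics l"
    using insert by (intro insert.IH spherical_harmonics_lincomb) auto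
  moreover have "(\<lambda>y. (g y + c f * f y) + (\<Sum>f\<in>B. c f * f y)) = (\<lambda>y. g y + (\<Sum>f\<in>insert f B. c f * f y))"
    using insert.hyps by (simp add: add.assoc)
  ultimately show ?case by simp
qed auto

definition orthonormal_harmonics :: "nat \<Rightarrow> ('a::euclidean_space \<Rightarrow> real) set \<Rightarrow> bool" where
  "orthonormal_harmonics l B \<longleftrightarrow> finite B \<and> B \<subseteq> spherical_harmonics l \<and>
     (\<forall>f\<in>B. \<forall>g\<in>B. (\<integral>y. f y * g y \<partial>sphere_measure) = (if f = g then 1 else 0))"

lemma spherical_harmonics_reproducing:
  fixes x :: "'a::euclidean_space"
  assumes dim: "2 \<le> DIM('a)" and x: "x \<in> unit_sphere" and f: "f \<in> spherical_harmonics l"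
  shows "(\<integral>y. poly (zonal_harmonic TYPE('a) l) (x \<bullet> y) * f y \<partial>sphere_measure) = f x"
proof -
  obtain u where u: "u \<in> solid_harmonics l" "\<And>y. y \<in> unit_sphere \<Longrightarrow> f y = u y"
    using spherical_harmonics_cases[OF f] by metis
  have "(\<integral>y. poly (zonal_harmonic TYPE('a) l) (x \<bullet> y) * f y \<partial>sphere_measure)
     = (\<integral>y. poly (zonal_harmonic TYPE('a) l) (x \<bullet> y) * u y \<partial>sphere_measure)"
    by (intro Bochner_Integration.integral_cong refl) (simp add: u(2))
  then show ?thesis using zonal_harmonic_reproducing[OF dim x u(1)] u(2)[OF x] by simp
qed

lemma integral_mult_sum:
  fixes g :: "'a::euclidean_space \<Rightarrow> real"
  assumes "continuous_on unit_sphere g" "\<And>f. f \<in> B \<Longrightarrow> continuous_on unit_sphere f"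
  shows "(\<integral>y. g y * (\<Sum>f\<in>B. c f * f y) \<partial>sphere_measure) = (\<Sum>f\<in>B. c f * (\<integral>y. g y * f y \<partial>sphere_measure))"
proof -
  have "(\<integral>y. g y * (\<Sum>f\<in>B. c f * f y) \<partial>sphere_measure) = (\<integral>y. (\<Sum>f\<in>B. c f * (g y * f y)) \<partial>sphere_measure)"
    by (simp add: sum_distrib_left mult_ac)
  also have "\<dots> = (\<Sum>f\<in>B. \<integral>y. c f * (g y * f y) \<partial>sphere_measure)"
    by (intro Bochner_Integration.integral_sum continuous_on_sphere_integrable continuous_intros assms)
  finally show ?thesis by simp
qed

lemma orthonormal_sum_integral:
  assumes B: "orthonormal_harmonics l B" and f: "f \<in> B"
  shows "(\<integral>y. f y * (\<Sum>g\<in>B. c g * g y) \<partial>sphere_measure) = c f"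
proof -
  have "(\<integral>y. f y * (\<Sum>g\<in>B. c g * g y) \<partial>sphere_measure) = (\<Sum>g\<in>B. c g * (\<integral>y. f y * g y \<partial>sphere_measure))"
    using B f by (intro integral_mult_sum spherical_harmonics_continuous_on) (auto simp: orthonormal_harmonics_def)
  also have "\<dots> = (\<Sum>g\<in>B. if g = f then c f else 0)"
    using B f by (intro sum.cong refl) (auto simp: orthonormal_harmonics_def)
  also have "\<dots> = c f" using B f by (simp add: orthonormal_harmonics_def)
  finally show ?thesis .
qed

text \<open>Bessel's inequality for the zonal function at \<open>x\<close>, integrated over \<open>x\<close>.\<close>

lemma card_orthonormal_le:
  fixes B :: "('a::euclidean_space \<Rightarrow> real) set"
  assumes dim: "2 \<le> DIM('a)" and B: "orthonormal_harmonics l B"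
  shows "real (card B) \<le> poly (zonal_harmonic TYPE('a) l) 1"
proof -
  let ?Z = "poly (zonal_harmonic TYPE('a) l)"
  have fin: "finite B" and sub: "\<And>f. f \<in> B \<Longrightarrow> f \<in> spherical_harmonics l"
    using B by (auto simp: orthonormal_harmonics_def)
  note cont = spherical_harmonics_continuous_on[OF sub]
  have le: "(\<Sum>f\<in>B. f x * f x) \<le> ?Z 1" if x: "x \<in> unit_sphere" for x
  proof -
    let ?s = "\<lambda>y. \<Sum>f\<in>B. f x * f y"
    have cs: "continuous_on unit_sphere ?s" by (intro continuous_intros cont)
    have xx: "x \<bullet> x = 1" using x by (simp add: dot_square_norm)
    have i1: "(\<integral>y. ?Z (x \<bullet> y) * ?s y \<partial>sphere_measure) = (\<Sum>f\<in>B. f x * f x)"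
      by (subst integral_mult_sum) (auto intro!: continuous_on_poly_inner cont simp: spherical_harmonics_reproducing[OF dim x sub])
    have i2: "(\<integral>y. ?s y * ?s y \<partial>sphere_measure) = (\<Sum>f\<in>B. f x * f x)"
    proof -
      have "(\<integral>y. ?s y * f y \<partial>sphere_measure) = f x" if "f \<in> B" for f
        using orthonormal_sum_integral[OF B that, of "\<lambda>f. f x"] by (simp add: mult.commute)
      then show ?thesis by (subst integral_mult_sum) (auto intro!: cs cont)
    qed
    have i3: "(\<integral>y. ?Z (x \<bullet> y) * ?Z (x \<bullet> y) \<partial>sphere_measure) = ?Z 1"
      using zonal_harmonic_convolution[OF dim x x, of l l] by (simp add: xx)
    have "0 \<le> (\<integral>y. (?Z (x \<bullet> y) - ?s y)\<^sup>2 \<partial>sphere_measure)" by simp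
    also have "\<dots> = (\<integral>y. ?Z (x \<bullet> y) * ?Z (x \<bullet> y) - 2 * (?Z (x \<bullet> y) * ?s y) + ?s y * ?s y \<partial>sphere_measure)"
      by (intro Bochner_Integration.integral_cong refl) (simp add: power2_eq_square algebra_simps)
    also have "\<dots> = ?Z 1 - 2 * (\<Sum>f\<in>B. f x * f x) + (\<Sum>f\<in>B. f x * f x)"
    proof -
      have I: "integrable sphere_measure (\<lambda>y. ?Z (x \<bullet> y) * ?Z (x \<bullet> y))"
        "integrable sphere_measure (\<lambda>y. 2 * (?Z (x \<bullet> y) * ?s y))"
        "integrable sphere_measure (\<lambda>y. ?s y * ?s y)"
        by (intro continuous_on_sphere_integrable continuous_intros cont; simp)+
      show ?thesis using I by (simp add: i1 i2 i3)
    qed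
    finally show ?thesis by simp
  qed
  have "real (card B) = (\<Sum>f\<in>B. \<integral>x. f x * f x \<partial>sphere_measure)"
    using B by (simp add: orthonormal_harmonics_def)
  also have "\<dots> = (\<integral>x. (\<Sum>f\<in>B. f x * f x) \<partial>sphere_measure)"
    by (intro Bochner_Integration.integral_sum[symmetric] continuous_on_sphere_integrable continuous_intros cont)
  also have "\<dots> \<le> (\<integral>x. ?Z 1 \<partial>(sphere_measure :: 'a measure))"
    using le by (intro integral_mono continuous_on_sphere_integrable continuous_intros cont) auto
  finally show ?thesis by simp
qed

lemma integral_square_pos:
  fixes f :: "'a::euclidean_space \<Rightarrow> real"
  assumes f: "continuous_on unit_sphere f" and x: "x \<in> unit_sphere" "f x \<noteq> 0"
  shows "(\<integral>y. f y * f y \<partial>sphere_measure) > 0"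
proof (rule ccontr)
  assume n: "\<not> ?thesis"
  have "integrable sphere_measure (\<lambda>y. f y * f y)"
    by (intro continuous_on_sphere_integrable continuous_intros f)
  moreover have "(\<integral>y. f y * f y \<partial>sphere_measure) \<ge> 0" by simp
  moreover have "AE y in sphere_measure. 0 \<le> f y * f y" by simp
  ultimately have "AE y in sphere_measure. f y * f y = 0"
    using n integral_nonneg_eq_0_iff_AE[of sphere_measure "\<lambda>y. f y * f y"] by linarith
  then have "f x = 0"
    by (intro continuous_AE_eq_sphere[OF f continuous_on_const _ x(1)]) auto
  then show False using x by simp
qed

text \<open>Orthonormal systems have bounded cardinality, so a largest one exists. If some
  \<open>f\<close> differed from its expansion, the normalized residual would be a further
  orthonormal element. This provides a finite basis before finite dimensionality is known.\<close>

lemma maximal_orthonormal_harmonics: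
  fixes l :: nat
  assumes dim: "2 \<le> DIM('a::euclidean_space)"
  obtains B :: "('a::euclidean_space \<Rightarrow> real) set" where "orthonormal_harmonics l B"
    "\<And>f y. f \<in> spherical_harmonics l \<Longrightarrow> f y = (\<Sum>g\<in>B. (\<integral>z. f z * g z \<partial>sphere_measure) * g y)"
proof -
  let ?P = "\<lambda>n. \<exists>B :: ('a \<Rightarrow> real) set. orthonormal_harmonics l B \<and> card B = n"
  have p0: "?P 0" by (rule exI[of _ "{}"]) (simp add: orthonormal_harmonics_def)
  have bound: "\<forall>n. ?P n \<longrightarrow> n \<le> nat \<lfloor>poly (zonal_harmonic TYPE('a) l) 1\<rfloor>"
    using card_orthonormal_le[OF dim] by (blast intro: le_nat_floor)
  obtain n where n1: "?P n" and n2: "\<forall>k. ?P k \<longrightarrow> k \<le> n"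
    by (rule exE[OF Nat.ex_has_greatest_nat[where P="?P", OF p0 bound]], erule conjE)
  then obtain B :: "('a \<Rightarrow> real) set" where B: "orthonormal_harmonics l B" and card: "card B = n" by (elim exE conjE)
  have fin: "finite B" and sub: "\<And>f. f \<in> B \<Longrightarrow> f \<in> spherical_harmonics l"
    using B by (auto simp: orthonormal_harmonics_def)
  note cont = spherical_harmonics_continuous_on[OF sub]
  have "f y = (\<Sum>g\<in>B. (\<integral>z. f z * g z \<partial>sphere_measure) * g y)" if f: "f \<in> spherical_harmonics l" for f y
  proof (rule ccontr)
    assume neq: "f y \<noteq> (\<Sum>g\<in>B. (\<integral>z. f z * g z \<partial>sphere_measure) * g y)"
    define c where "c g = (\<integral>z. f z * g z \<partial>sphere_measure)" for g
    define w where "w = (\<lambda>y. f y + (\<Sum>g\<in>B. (- c g) * g y))"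
    have w: "w \<in> spherical_harmonics l"
      unfolding w_def by (intro spherical_harmonics_sum sub f)
    note cw = spherical_harmonics_continuous_on[OF w]
    note cf = spherical_harmonics_continuous_on[OF f]
    have "w y \<noteq> 0" using neq by (simp add: w_def c_def sum_negf)
    then have y: "y \<in> unit_sphere" using spherical_harmonics_cases[OF w] by metis
    define N where "N = (\<integral>z. w z * w z \<partial>sphere_measure)"
    have N: "N > 0" unfolding N_def using integral_square_pos[OF cw y] \<open>w y \<noteq> 0\<close> by simp
    have orth: "(\<integral>z. w z * g z \<partial>sphere_measure) = 0" if g: "g \<in> B" for g
    proof -
      have I1: "integrable sphere_measure (\<lambda>z. f z * g z)"
        by (intro continuous_on_sphere_integrable continuous_intros cf cont[OF g])
      have I2: "integrable sphere_measure (\<lambda>z. g z * (\<Sum>g\<in>B. (- c g) * g z))"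
        by (intro continuous_on_sphere_integrable continuous_on_mult cont[OF g] continuous_on_sum continuous_on_const cont)
      have "(\<integral>z. w z * g z \<partial>sphere_measure) = (\<integral>z. f z * g z + g z * (\<Sum>g\<in>B. (- c g) * g z) \<partial>sphere_measure)"
        unfolding w_def by (simp add: algebra_simps)
      also have "\<dots> = c g + (- c g)"
        using orthonormal_sum_integral[OF B g, of "\<lambda>g. - c g"]
        using Bochner_Integration.integral_add[OF I1 I2] by (simp add: c_def)
      finally show ?thesis by simp
    qed
    \<comment> \<open>The summand 0 gives the expression the shape of
      \<open>spherical_harmonics_lincomb\<close>.\<close>
    define w' where "w' = (\<lambda>y. 0 + (1 / sqrt N) * w y)"
    have w': "w' \<in> spherical_harmonics l"
      unfolding w'_def by (intro spherical_harmonics_lincomb zero_spherical_harmonics w)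
    have ww: "(\<integral>z. w' z * w' z \<partial>sphere_measure) = 1"
    proof -
      have "(\<integral>z. w' z * w' z \<partial>sphere_measure) = (\<integral>z. (1 / N) * (w z * w z) \<partial>sphere_measure)"
        using N by (intro Bochner_Integration.integral_cong refl) (simp add: w'_def)
      also have "\<dots> = (1 / N) * N" unfolding N_def by (rule integral_mult_right_zero)
      finally show ?thesis using N by simp
    qed
    have wg: "(\<integral>z. w' z * g z \<partial>sphere_measure) = 0" "(\<integral>z. g z * w' z \<partial>sphere_measure) = 0" if "g \<in> B" for g
    proof -
      have "(\<integral>z. w' z * g z \<partial>sphere_measure) = (\<integral>z. (1 / sqrt N) * (w z * g z) \<partial>sphere_measure)"
        by (simp add: w'_def)
      then show "(\<integral>z. w' z * g z \<partial>sphere_measure) = 0" using orth[OF that] by simp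
      then show "(\<integral>z. g z * w' z \<partial>sphere_measure) = 0" by (simp add: mult.commute)
    qed
    have "w' \<notin> B" using ww wg(1)[of w'] by auto
    have "orthonormal_harmonics l (insert w' B)"
      using B w' ww wg unfolding orthonormal_harmonics_def by auto
    then have "?P (Suc n)" using \<open>w' \<notin> B\<close> fin card by (intro exI[of _ "insert w' B"]) auto
    from n2[rule_format, OF this] show False by simp
  qed
  then show ?thesis using that[OF B] by blast
qed

text \<open>The zonal function at \<open>x\<close> is itself a spherical harmonic whose coefficients
  are the values \<open>g x\<close>, so evaluating its expansion at \<open>x\<close> gives the sum
  of the squares \<open>g x * g x\<close>. This sum is the constant \<open>?Z 1\<close>, and
  integrating it counts the basis.\<close>

theorem harmonic_dim_eq:
  assumes dim: "2 \<le> DIM('a::euclidean_space)"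
  shows "real (harmonic_dim TYPE('a) l) = poly (zonal_harmonic TYPE('a) l) 1"
proof -
  let ?Z = "poly (zonal_harmonic TYPE('a) l)"
  obtain B :: "('a \<Rightarrow> real) set" where B: "orthonormal_harmonics l B"
    and rep: "\<And>f y. f \<in> spherical_harmonics l \<Longrightarrow> f y = (\<Sum>g\<in>B. (\<integral>z. f z * g z \<partial>sphere_measure) * g y)"
    using maximal_orthonormal_harmonics[OF dim] by blast
  have fin: "finite B" and sub: "\<And>f. f \<in> B \<Longrightarrow> f \<in> spherical_harmonics l"
    using B by (auto simp: orthonormal_harmonics_def)
  note cont = spherical_harmonics_continuous_on[OF sub]
  have "\<not> function_space.dependent B"
  proof
    assume "function_space.dependent B"
    then obtain c where c: "\<exists>f\<in>B. c f \<noteq> 0" "(\<Sum>f\<in>B. (\<lambda>y. c f * f y)) = 0"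
      unfolding function_space.dependent_finite[OF fin] by auto
    then have z: "(\<Sum>f\<in>B. c f * f y) = 0" for y
      using sum_fun_apply[of "\<lambda>f y. c f * f y" B y] by simp
    have "c f = 0" if "f \<in> B" for f
      using orthonormal_sum_integral[OF B that, of c] unfolding z by simp
    then show False using c(1) by auto
  qed
  moreover have "spherical_harmonics l \<subseteq> function_space.span B"
  proof
    fix f :: "'a \<Rightarrow> real" assume f: "f \<in> spherical_harmonics l"
    have "f = (\<Sum>g\<in>B. (\<lambda>y. (\<integral>z. f z * g z \<partial>sphere_measure) * g y))"
      unfolding sum_fun_apply fun_eq_iff by (intro allI rep f)
    also have "\<dots> \<in> function_space.span B"
      by (intro function_space.span_sum function_space.span_scale function_space.span_base)
    finally show "f \<in> function_space.span B" .
  qed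
  ultimately have "harmonic_dim TYPE('a) l = card B"
    unfolding harmonic_dim_def using sub by (intro function_space.dim_unique[of B]) auto
  moreover have "real (card B) = ?Z 1"
  proof -
    have kernel: "(\<Sum>g\<in>B. g x * g x) = ?Z 1" if x: "x \<in> unit_sphere" for x
    proof -
      define k where "k = (\<lambda>y. indicator unit_sphere y * zonal_solid (real DIM('a) / 2) l (x \<bullet> y) (y \<bullet> y))"
      have k: "k \<in> spherical_harmonics l"
        unfolding k_def by (intro spherical_harmonics_I zonal_solid_harmonic x)
      have ky: "k y = ?Z (x \<bullet> y)" if "y \<in> unit_sphere" for y
        using that zonal_solid_on_sphere[OF that, of l x] by (simp add: k_def)
      have "(\<integral>z. k z * g z \<partial>sphere_measure) = g x" if "g \<in> B" for g
      proof -
        have "(\<integral>z. k z * g z \<partial>sphere_measure) = (\<integral>z. ?Z (x \<bullet> z) * g z \<partial>sphere_measure)"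
          by (intro Bochner_Integration.integral_cong refl) (simp add: ky)
        then show ?thesis using spherical_harmonics_reproducing[OF dim x sub[OF that]] by simp
      qed
      then have "k x = (\<Sum>g\<in>B. g x * g x)" by (subst rep[OF k]) simp
      moreover have "x \<bullet> x = 1" using x by (simp add: dot_square_norm)
      ultimately show ?thesis using ky[OF x] by simp
    qed
    have "real (card B) = (\<Sum>g\<in>B. \<integral>x. g x * g x \<partial>sphere_measure)"
      using B by (simp add: orthonormal_harmonics_def)
    also have "\<dots> = (\<integral>x. (\<Sum>g\<in>B. g x * g x) \<partial>sphere_measure)"
      by (intro Bochner_Integration.integral_sum[symmetric] continuous_on_sphere_integrable continuous_intros cont)
    also have "\<dots> = (\<integral>x. ?Z 1 \<partial>(sphere_measure :: 'a measure))"
      by (intro Bochner_Integration.integral_cong refl) (simp add: kernel)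
    finally show ?thesis by simp
  qed
  ultimately show ?thesis by simp
qed

lemma inner_sphere_surj:
  assumes dim: "2 \<le> DIM('a::euclidean_space)"
  obtains x :: "'a::euclidean_space" where "x \<in> unit_sphere" "\<And>t. \<bar>t\<bar> \<le> 1 \<Longrightarrow> \<exists>y\<in>unit_sphere. x \<bullet> y = t"
proof -
  obtain b c :: 'a where bc: "b \<in> Basis" "c \<in> Basis" "b \<noteq> c"
  proof -
    obtain b :: 'a where b: "b \<in> Basis" using nonempty_Basis by blast
    have "card (Basis - {b} :: 'a set) \<ge> 1" using dim b by simp
    then have "Basis - {b} \<noteq> {}" by (metis card.empty not_one_le_zero)
    then show ?thesis using that b by blast
  qed
  show ?thesis
  proof (rule that[of b])
    show "b \<in> unit_sphere" using bc by simp
    fix t :: real assume t: "\<bar>t\<bar> \<le> 1"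
    define y where "y = t *\<^sub>R b + sqrt (1 - t\<^sup>2) *\<^sub>R c"
    have t2: "t\<^sup>2 \<le> 1" using t by (simp add: abs_square_le_1)
    have "y \<bullet> y = t * t + sqrt (1 - t\<^sup>2) * sqrt (1 - t\<^sup>2)"
      unfolding y_def using bc by (simp add: inner_add_left inner_add_right inner_Basis)
    also have "\<dots> = 1" using t2 by (simp add: power2_eq_square)
    finally have "y \<in> unit_sphere" by (simp add: norm_eq_1)
    moreover have "b \<bullet> y = t" using bc by (simp add: y_def inner_add_right inner_Basis)
    ultimately show "\<exists>y\<in>unit_sphere. b \<bullet> y = t" by blast
  qed
qed

text \<open>A nonzero polynomial has finitely many roots, hence is nonzero at some \<open>t\<close>
  between -1 and 1, and every such \<open>t\<close> is an inner product with
  \<open>x\<close>.\<close>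

lemma integral_square_zonal_pos:
  assumes dim: "2 \<le> DIM('a::euclidean_space)" and p: "p \<noteq> 0" and x: "x \<in> (unit_sphere :: 'a set)"
  shows "(\<integral>y. poly p (x \<bullet> y) * poly p (x \<bullet> y) \<partial>sphere_measure) > 0"
proof -
  obtain z :: 'a where z: "z \<in> unit_sphere" and surj: "\<And>t. \<bar>t\<bar> \<le> 1 \<Longrightarrow> \<exists>y\<in>unit_sphere. z \<bullet> y = t"
    using inner_sphere_surj[OF dim] by blast
  have "\<not> {-1..1} \<subseteq> {t. poly p t = 0}"
  proof
    assume "{-1..1} \<subseteq> {t. poly p t = 0}"
    then have "finite {-1..1::real}" by (rule finite_subset) (rule poly_roots_finite[OF p])
    then show False using infinite_Icc[of "-1::real" 1] by simp
  qed
  then obtain t where t: "\<bar>t\<bar> \<le> 1" "poly p t \<noteq> 0" by force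
  obtain T where T: "orthogonal_transformation T" "T z = x" "T x = z"
    using reflection_exists[of z x] x z by auto
  obtain y where y: "y \<in> unit_sphere" "z \<bullet> y = t" using surj[OF t(1)] by blast
  have "x \<bullet> T y = t" using T y by (metis orthogonal_transformation_def)
  moreover have "T y \<in> unit_sphere" using y orthogonal_transformation_norm[OF T(1)] by simp
  ultimately show ?thesis
    using t by (intro integral_square_pos[of _ "T y"] continuous_on_poly_inner) auto
qed

lemma degree_zonal_harmonic: "degree (zonal_harmonic TYPE('a::euclidean_space) l) = l"
  unfolding zonal_harmonic_def by (rule degree_zonal_poly) simp

lemma zonal_harmonic_nonzero: "zonal_harmonic TYPE('a::euclidean_space) l \<noteq> 0"
  using degree_zonal_harmonic[of l, where 'a='a] by (cases l) (auto simp: zonal_harmonic_def)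

text \<open>By the reproducing property the value at 1 is the integral of the square of the zonal
  function.\<close>

lemma zonal_harmonic_1_pos:
  assumes dim: "2 \<le> DIM('a::euclidean_space)"
  shows "poly (zonal_harmonic TYPE('a) l) 1 > 0"
proof -
  obtain x :: 'a where x: "x \<in> unit_sphere" using inner_sphere_surj[OF dim] by blast
  then have "x \<bullet> x = 1" by (simp add: dot_square_norm)
  then show ?thesis
    using integral_square_zonal_pos[OF dim zonal_harmonic_nonzero[where 'a='a and l=l] x]
      zonal_harmonic_convolution[OF dim x x, of l l] by simp
qed

subsection \<open>Gegenbauer polynomials\<close>

definition gegen_weight :: "nat \<Rightarrow> real \<Rightarrow> real" where
  "gegen_weight d t = (1 - t\<^sup>2) powr (real d / 2 - 1)"

text \<open>The extreme case is \<open>d = 1\<close>, with an endpoint singularity and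
  \<open>arcsin\<close> as antiderivative. On the interval the base is at most 1, so larger
  exponents give smaller weights.\<close>

lemma gegen_weight_set_integrable:
  assumes "d \<ge> 1"
  shows "set_integrable lborel {-1..1} (gegen_weight d)"
proof -
  have abs: "set_integrable lborel {-1..1} (\<lambda>t::real. (1 - t\<^sup>2) powr (- 1 / 2))"
  proof -
    have "((\<lambda>t. (1 - t\<^sup>2) powr (- 1 / 2)) has_integral (arcsin 1 - arcsin (- 1))) {-1..1}"
    proof (rule fundamental_theorem_of_calculus_interior)
      show "continuous_on {-1..1} arcsin" by (rule continuous_on_arcsin')
      fix x :: real assume x: "x \<in> {-1<..<1}"
      then have "x\<^sup>2 < 1" by (auto simp: abs_square_less_1 abs_less_iff)
      then have "inverse (sqrt (1 - x\<^sup>2)) = (1 - x\<^sup>2) powr (- 1 / 2)"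
        by (simp add: powr_minus powr_half_sqrt[symmetric])
      then show "(arcsin has_vector_derivative (1 - x\<^sup>2) powr (- 1 / 2)) (at x)"
        using DERIV_arcsin[of x] x by (simp add: has_real_derivative_iff_has_vector_derivative)
    qed simp
    then have "(\<lambda>t::real. (1 - t\<^sup>2) powr (- 1 / 2)) absolutely_integrable_on {-1..1}"
      by (subst absolutely_integrable_on_iff_nonneg) auto
    then show ?thesis
      unfolding set_integrable_def by (subst (asm) integrable_completion) auto
  qed
  show ?thesis
  proof (rule set_integrable_bound[OF abs])
    show "set_borel_measurable lborel {-1..1} (gegen_weight d)"
      unfolding set_borel_measurable_def gegen_weight_def by simp
    show "AE t in lborel. t \<in> {-1..1} \<longrightarrow> norm (gegen_weight d t) \<le> norm ((1 - t\<^sup>2) powr (- 1 / 2))"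
    proof (intro AE_I2 impI)
      fix t :: real assume "t \<in> {-1..1}"
      then have "t\<^sup>2 \<le> 1" by (auto simp: abs_square_le_1)
      then show "norm (gegen_weight d t) \<le> norm ((1 - t\<^sup>2) powr (- 1 / 2))"
        using assms by (auto simp: gegen_weight_def intro!: powr_mono')
    qed
  qed
qed

definition weight_integral :: "nat \<Rightarrow> real poly \<Rightarrow> real" where
  "weight_integral d P = (LINT t:{-1..1}|lborel. poly P t * gegen_weight d t)"

lemma poly_weight_set_integrable:
  assumes "d \<ge> 1"
  shows "set_integrable lborel {-1..1} (\<lambda>t. poly P t * gegen_weight d t)"
proof -
  have "bounded (poly P ` {-1..1})"
    by (intro compact_imp_bounded compact_continuous_image continuous_intros) simp
  then obtain C where "\<forall>t\<in>{-1..1}. \<bar>poly P t\<bar> \<le> C"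
    unfolding bounded_iff by auto
  then have C: "\<And>t. t \<in> {-1..1} \<Longrightarrow> \<bar>poly P t\<bar> \<le> C" by blast
  have C0: "C \<ge> 0" using C[of 0] by simp
  show ?thesis
  proof (rule set_integrable_bound)
    show "set_integrable lborel {-1..1} (\<lambda>t. C * gegen_weight d t)"
      by (intro set_integrable_mult_right gegen_weight_set_integrable assms)
    have [measurable]: "poly P \<in> borel_measurable borel"
      by (intro borel_measurable_continuous_onI continuous_intros)
    show "set_borel_measurable lborel {-1..1} (\<lambda>t. poly P t * gegen_weight d t)"
      unfolding set_borel_measurable_def gegen_weight_def by simp
    show "AE t in lborel. t \<in> {-1..1} \<longrightarrow> norm (poly P t * gegen_weight d t) \<le> norm (C * gegen_weight d t)"
      using C C0 by (intro AE_I2 impI) (simp add: abs_mult mult_right_mono)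
  qed
qed

lemma weight_integral_linear:
  assumes d: "d \<ge> 1"
  shows "weight_integral d (P + Q) = weight_integral d P + weight_integral d Q"
    and "weight_integral d (smult c P) = c * weight_integral d P"
proof -
  show "weight_integral d (P + Q) = weight_integral d P + weight_integral d Q"
    unfolding weight_integral_def
    by (subst set_integral_add(2)[symmetric]) (auto simp: distrib_right intro!: poly_weight_set_integrable d)
  show "weight_integral d (smult c P) = c * weight_integral d P"
    unfolding weight_integral_def by (subst set_integral_mult_right[symmetric]) (simp add: mult.assoc)
qed

text \<open>The integrand is the derivative of \<open>poly P t * (1 - t^2) powr (d / 2)\<close>,
  which vanishes at both endpoints.\<close>

lemma weight_integral_derivative:
  assumes d: "d \<ge> 1"
  shows "weight_integral d (pderiv P * [:1, 0, -1:] - smult (real d) ([:0, 1:] * P)) = 0"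
proof -
  let ?f = "\<lambda>t. poly (pderiv P * [:1, 0, -1:] - smult (real d) ([:0, 1:] * P)) t * gegen_weight d t"
  let ?F = "\<lambda>t. poly P t * (1 - t\<^sup>2) powr (real d / 2)"
  have "(?f has_integral (?F 1 - ?F (-1))) {-1..1}"
  proof (rule fundamental_theorem_of_calculus_interior)
    show "continuous_on {-1..1} ?F"
      using d by (intro continuous_intros continuous_on_powr') (auto simp: abs_square_le_1)
    fix t :: real assume "t \<in> {-1<..<1}"
    then have "t\<^sup>2 < 1" by (auto simp: abs_square_less_1 abs_less_iff)
    then have t: "1 - t\<^sup>2 > 0" by simp
    have w: "(1 - t\<^sup>2) powr (real d / 2) = (1 - t\<^sup>2) * gegen_weight d t"
      unfolding gegen_weight_def using t powr_mult_base[of "1 - t\<^sup>2" "real d / 2 - 1"] by simp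
    have "(?F has_real_derivative (poly (pderiv P) t * (1 - t\<^sup>2) powr (real d / 2)
        + poly P t * ((real d / 2) * (1 - t\<^sup>2) powr (real d / 2 - 1) * (- (2 * t))))) (at t)"
      using t by (auto intro!: derivative_eq_intros DERIV_powr simp: field_simps)
    moreover have "poly (pderiv P) t * (1 - t\<^sup>2) powr (real d / 2)
        + poly P t * ((real d / 2) * (1 - t\<^sup>2) powr (real d / 2 - 1) * (- (2 * t))) = ?f t"
      unfolding w gegen_weight_def[symmetric] by (simp add: power2_eq_square algebra_simps)
    ultimately show "(?F has_vector_derivative ?f t) (at t)"
      by (simp add: has_real_derivative_iff_has_vector_derivative)
  qed simp
  then have "(?f has_integral 0) {-1..1}" using d by simp
  moreover have "(?f has_integral weight_integral d (pderiv P * [:1, 0, -1:] - smult (real d) ([:0, 1:] * P))) {-1..1}"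
    unfolding weight_integral_def set_borel_integral_eq_integral(2)[OF poly_weight_set_integrable[OF d]]
    by (rule integrable_integral[OF set_borel_integral_eq_integral(1)[OF poly_weight_set_integrable[OF d]]])
  ultimately show ?thesis by (rule has_integral_unique[symmetric])
qed

text \<open>The preceding identity for \<open>t^(k + 1)\<close> and for 1; with
  \<open>d = DIM('a) - 1\<close> this is the recurrence of \<open>moment_recurrence\<close>.\<close>

lemma weight_integral_moments:
  assumes d: "d \<ge> 1"
  shows "real (k + 1 + d) * weight_integral d (monom 1 (k + 2)) = real (k + 1) * weight_integral d (monom 1 k)"
    and "weight_integral d (monom 1 1) = 0"
proof -
  have e: "pderiv (monom 1 (k + 1)) * [:1, 0, -1:] - smult (real d) ([:0, 1:] * monom 1 (k + 1))
     = smult (real (k + 1)) (monom 1 k) + smult (- real (k + 1 + d)) (monom 1 (k + 2))"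
    by (rule poly_ext) (simp add: pderiv_monom poly_monom algebra_simps power2_eq_square)
  show "real (k + 1 + d) * weight_integral d (monom 1 (k + 2)) = real (k + 1) * weight_integral d (monom 1 k)"
    using weight_integral_derivative[OF d, of "monom 1 (k + 1)"]
    unfolding e weight_integral_linear[OF d] by (simp add: algebra_simps)
  have "pderiv 1 * [:1, 0, -1:] - smult (real d) ([:0, 1:] * 1) = smult (- real d) (monom 1 1)"
    by (rule poly_ext) (simp add: poly_monom)
  then show "weight_integral d (monom 1 1) = 0"
    using weight_integral_derivative[OF d, of 1] d weight_integral_linear(2)[OF d, of "- real d" "monom 1 1"] by simp
qed

lemma weight_integral_pos:
  assumes d: "d \<ge> 1"
  shows "weight_integral d 1 > 0"
proof (rule ccontr)
  assume n: "\<not> ?thesis"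
  let ?f = "\<lambda>t::real. indicator {-1..1} t * gegen_weight d t"
  have int: "integrable lborel ?f" using gegen_weight_set_integrable[OF d] by (simp add: set_integrable_def)
  have wi: "weight_integral d 1 = (\<integral>t. ?f t \<partial>lborel)"
    by (simp add: weight_integral_def set_lebesgue_integral_def)
  have nn: "AE t in lborel. 0 \<le> ?f t" by (simp add: gegen_weight_def)
  have "(\<integral>t. ?f t \<partial>lborel) \<ge> 0" using nn by (rule integral_nonneg_AE)
  then have "AE t in lborel. ?f t = 0"
    using n wi integral_nonneg_eq_0_iff_AE[OF int nn] by linarith
  then have "AE t in lborel. t \<notin> {-1<..<1::real}"
  proof eventually_elim
    case (elim t)
    show ?case
    proof
      assume "t \<in> {-1<..<1}"
      then have "t\<^sup>2 < 1" "t \<in> {-1..1}" by (auto simp: abs_square_less_1 abs_less_iff)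
      then show False using elim by (simp add: gegen_weight_def)
    qed
  qed
  then have "{-1<..<1::real} \<in> null_sets lborel" by (subst AE_iff_null_sets) auto
  then have "emeasure lborel {-1<..<1::real} = 0" by (rule null_setsD1)
  then show False by simp
qed

text \<open>The moments of \<open>x \<bullet> y\<close> and of the normalized weight satisfy one
  two-step recurrence and agree in degrees 0 and 1; linearity extends this to polynomials.\<close>

lemma integral_zonal_eq_weight:
  fixes x :: "'a::euclidean_space"
  assumes dim: "2 \<le> DIM('a)" and x: "x \<in> unit_sphere"
  shows "weight_integral (DIM('a) - 1) 1 * (\<integral>y. poly P (x \<bullet> y) \<partial>sphere_measure) = weight_integral (DIM('a) - 1) P"
proof -
  define d where "d = DIM('a) - 1"
  have d: "d \<ge> 1" using dim by (simp add: d_def)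
  let ?W = "weight_integral d"
  let ?m = "\<lambda>k. \<integral>y. (x \<bullet> y) ^ k \<partial>sphere_measure"
  have mono: "?W 1 * ?m k = ?W (monom 1 k) \<and> ?W 1 * ?m (Suc k) = ?W (monom 1 (Suc k))" for k
  proof (induction k)
    case 0
    show ?case using moment_recurrence(2)[OF x dim] weight_integral_moments(2)[OF d] by (simp add: monom_0 one_pCons)
  next
    case (Suc k)
    have kd: "k + DIM('a) = k + 1 + d" using dim by (simp add: d_def)
    have "real (k + 1 + d) * (?W 1 * ?m (k + 2)) = ?W 1 * (real (k + 1) * ?m k)"
      using moment_recurrence(1)[OF x, of k] unfolding kd by (simp only: mult_ac)
    also have "\<dots> = real (k + 1) * ?W (monom 1 k)" by (simp only: conjunct1[OF Suc, symmetric] mult_ac)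
    also have "\<dots> = real (k + 1 + d) * ?W (monom 1 (k + 2))" using weight_integral_moments(1)[OF d, of k] by simp
    finally have "?W 1 * ?m (k + 2) = ?W (monom 1 (k + 2))"
      by (subst (asm) mult_left_cancel) (simp_all del: of_nat_add)
    then show ?case using Suc by (simp add: add_2_eq_Suc')
  qed
  have W0: "?W 0 = 0" using weight_integral_linear(2)[OF d, of 0 0] by simp
  have "?W 1 * (\<integral>y. poly (\<Sum>i<n. monom (coeff P i) i) (x \<bullet> y) \<partial>sphere_measure) = ?W (\<Sum>i<n. monom (coeff P i) i)" for n
  proof (induction n)
    case (Suc n)
    have "(\<integral>y. poly (\<Sum>i<Suc n. monom (coeff P i) i) (x \<bullet> y) \<partial>sphere_measure)
      = (\<integral>y. poly (\<Sum>i<n. monom (coeff P i) i) (x \<bullet> y) \<partial>sphere_measure) + coeff P n * ?m n"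
      unfolding integral_mult_right_zero[symmetric]
      by (subst Bochner_Integration.integral_add[symmetric])
         (auto simp: poly_monom intro!: continuous_on_sphere_integrable continuous_intros)
    moreover have "?W (\<Sum>i<Suc n. monom (coeff P i) i) = ?W (\<Sum>i<n. monom (coeff P i) i) + coeff P n * ?W (monom 1 n)"
      unfolding weight_integral_linear(2)[OF d, symmetric] sum.lessThan_Suc weight_integral_linear(1)[OF d]
      by (simp add: smult_monom)
    ultimately show ?case using Suc mono[of n] by (simp add: distrib_left)
  qed (simp add: W0)
  from this[of "Suc (degree P)"]
  have "?W 1 * (\<integral>y. poly P (x \<bullet> y) \<partial>sphere_measure) = ?W P"
    unfolding lessThan_Suc_atMost poly_as_sum_of_monoms .
  then show ?thesis by (simp add: d_def)
qed

text \<open>The zonal harmonic of index \<open>n\<close> has exact degree \<open>n\<close>, so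
  leading terms can be removed one at a time.\<close>

lemma zonal_harmonic_span:
  assumes "degree Q < n"
  shows "\<exists>c. Q = (\<Sum>i<n. smult (c i) (zonal_harmonic TYPE('a::euclidean_space) i))"
  using assms
proof (induction n arbitrary: Q)
  case (Suc n)
  let ?Z = "zonal_harmonic TYPE('a)"
  have lc: "coeff (?Z n) n \<noteq> 0"
    using zonal_harmonic_nonzero[of n, where 'a='a] degree_zonal_harmonic[of n, where 'a='a] by (metis leading_coeff_0_iff)
  define a where "a = coeff Q n / coeff (?Z n) n"
  define R where "R = Q - smult a (?Z n)"
  have Rn: "coeff R n = 0" using lc by (simp add: R_def a_def)
  have dR: "degree R \<le> n" unfolding R_def
    using Suc.prems degree_zonal_harmonic[of n, where 'a='a] by (intro degree_diff_le) (auto intro: order.trans[OF degree_smult_le])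
  have "\<exists>c. R = (\<Sum>i<n. smult (c i) (?Z i))"
  proof (cases "R = 0")
    case True
    then show ?thesis by (intro exI[of _ "\<lambda>_. 0"]) simp
  next
    case False
    then have "degree R \<noteq> n" using Rn by (metis leading_coeff_0_iff)
    then show ?thesis using dR Suc.IH by simp
  qed
  then obtain c where c: "R = (\<Sum>i<n. smult (c i) (?Z i))" ..
  have "Q = (\<Sum>i<Suc n. smult ((c(n := a)) i) (?Z i))"
    using c by (simp add: R_def)
  then show ?case by blast
qed simp

lemma integral_zonal_harmonic_lower_degree:
  fixes x :: "'a::euclidean_space"
  assumes dim: "2 \<le> DIM('a)" and x: "x \<in> unit_sphere" and Q: "degree Q < l"
  shows "(\<integral>y. poly (zonal_harmonic TYPE('a) l * Q) (x \<bullet> y) \<partial>sphere_measure) = 0"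
proof -
  let ?Z = "zonal_harmonic TYPE('a)"
  obtain c where c: "Q = (\<Sum>i<l. smult (c i) (?Z i))" using zonal_harmonic_span[OF Q] by blast
  have "(\<integral>y. poly (?Z l * Q) (x \<bullet> y) \<partial>sphere_measure)
     = (\<integral>y. (\<Sum>i<l. c i * (poly (?Z l) (x \<bullet> y) * poly (?Z i) (x \<bullet> y))) \<partial>sphere_measure)"
    unfolding c by (simp add: poly_sum sum_distrib_left mult_ac)
  also have "\<dots> = (\<Sum>i<l. \<integral>y. c i * (poly (?Z l) (x \<bullet> y) * poly (?Z i) (x \<bullet> y)) \<partial>sphere_measure)"
    by (intro Bochner_Integration.integral_sum continuous_on_sphere_integrable continuous_intros)
  also have "\<dots> = 0"
    by (intro sum.neutral) (simp add: zonal_harmonic_convolution[OF dim x x])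
  finally show ?thesis .
qed

text \<open>For uniqueness, a multiple of the candidate is subtracted from a competitor so that the
  leading terms cancel. The difference has lower degree, hence is orthogonal to both polynomials and
  so to itself, which forces it to be 0; the value at 1 fixes the multiple.\<close>

theorem gegenbauer_eq:
  assumes dim: "2 \<le> DIM('a::euclidean_space)"
  shows "gegenbauer (DIM('a) - 1) l =
    smult (1 / poly (zonal_harmonic TYPE('a) l) 1) (zonal_harmonic TYPE('a) l)" (is "_ = ?G")
  unfolding gegenbauer_def
proof (rule the_equality)
  let ?Z = "zonal_harmonic TYPE('a)"
  let ?d = "DIM('a) - 1"
  have d: "?d \<ge> 1" using dim by simp
  obtain x :: 'a where x: "x \<in> unit_sphere" using inner_sphere_surj[OF dim] by blast
  have W: "(LINT t:{-1..1}|lborel. poly P t * poly Q t * (1 - t\<^sup>2) powr (real ?d / 2 - 1)) = weight_integral ?d (P * Q)" for P Q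
    by (simp add: weight_integral_def gegen_weight_def)
  note Z1 = zonal_harmonic_1_pos[OF dim, of l]
  have G: "degree ?G = l" "poly ?G 1 = 1" using Z1 by (simp_all add: degree_zonal_harmonic)
  have GQ: "weight_integral ?d (?G * Q) = 0" if "degree Q < l" for Q
    using integral_zonal_harmonic_lower_degree[OF dim x that]
      integral_zonal_eq_weight[OF dim x, of "?Z l * Q"] weight_integral_linear(2)[OF d]
    by simp
  show "degree ?G = l \<and> poly ?G 1 = 1 \<and> (\<forall>Q. degree Q < l \<longrightarrow>
    (LINT t:{-1..1}|lborel. poly ?G t * poly Q t * (1 - t\<^sup>2) powr (real ?d / 2 - 1)) = 0)"
    unfolding W using G GQ by blast
  fix P
  assume P: "degree P = l \<and> poly P 1 = 1 \<and> (\<forall>Q. degree Q < l \<longrightarrow>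
    (LINT t:{-1..1}|lborel. poly P t * poly Q t * (1 - t\<^sup>2) powr (real ?d / 2 - 1)) = 0)"
  then have PQ: "weight_integral ?d (P * Q) = 0" if "degree Q < l" for Q
    using that unfolding W by blast
  define c where "c = coeff P l / coeff ?G l"
  define R where "R = P - smult c ?G"
  have lc: "coeff ?G l \<noteq> 0" using G by (metis leading_coeff_0_iff poly_0 zero_neq_one)
  have "R = 0"
  proof (rule ccontr)
    assume R0: "R \<noteq> 0"
    have "coeff R l = 0" using lc by (simp add: R_def c_def)
    moreover have "degree R \<le> l" unfolding R_def
      using P G(1) by (intro degree_diff_le) (auto intro: order.trans[OF degree_smult_le])
    ultimately have "degree R < l" using R0 by (metis leading_coeff_0_iff le_neq_implies_less)
    then have "weight_integral ?d (P * R) = 0" "weight_integral ?d (?G * R) = 0" using PQ GQ by blast+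
    moreover have "R * R = P * R + smult (- c) (?G * R)"
    proof -
      have "(p - smult a g) * r = p * r + smult (- a) (g * r)" for p g r :: "real poly" and a
        by (simp add: left_diff_distrib)
      from this[of P c ?G R] show ?thesis by (simp only: R_def[symmetric])
    qed
    ultimately have "weight_integral ?d (R * R) = 0"
      by (simp only: weight_integral_linear[OF d])
    then have "(\<integral>y. poly (R * R) (x \<bullet> y) \<partial>sphere_measure) = 0"
      using integral_zonal_eq_weight[OF dim x, of "R * R"] weight_integral_pos[OF d] by simp
    then show False using integral_square_zonal_pos[OF dim R0 x] by simp
  qed
  then have "P = smult c ?G" by (simp add: R_def)
  moreover have "c = 1"
  proof -
    have "poly P 1 = c * poly ?G 1" using \<open>P = smult c ?G\<close> by (metis poly_smult)
    then show ?thesis using P G(2) by simp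
  qed
  ultimately show "P = ?G" by simp
qed

text \<open>The dimension is the value at 1, which cancels the normalization of the Gegenbauer
  polynomial.\<close>

theorem zonal_kernel_eq:
  assumes dim: "2 \<le> DIM('a::euclidean_space)"
  shows "zonal_kernel TYPE('a) l = poly (zonal_harmonic TYPE('a) l)"
  using zonal_harmonic_1_pos[OF dim, of l]
  unfolding zonal_kernel_def sphere_dim_def gegenbauer_eq[OF dim] harmonic_dim_eq[OF dim]
  by (intro ext) simp

subsection \<open>Completeness of the spherical harmonics\<close>

text \<open>Products of exponentials of linear forms are again of this kind, so their span is an
  algebra, and each of them is a function of a single inner product, which ties it to the zonal
  polynomials.\<close>

inductive exp_comb :: "('a::euclidean_space \<Rightarrow> real) \<Rightarrow> bool" where
  base: "exp_comb (\<lambda>y. c * exp (a \<bullet> y))"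
| add: "exp_comb f \<Longrightarrow> exp_comb g \<Longrightarrow> exp_comb (\<lambda>y. f y + g y)"

lemma exp_comb_mult:
  assumes "exp_comb f" "exp_comb g"
  shows "exp_comb (\<lambda>y. f y * g y)"
  using assms
proof (induction f rule: exp_comb.induct)
  case (base c a)
  then show ?case
  proof (induction g rule: exp_comb.induct)
    case (base c' a')
    have e: "(\<lambda>y. c * exp (a \<bullet> y) * (c' * exp (a' \<bullet> y))) = (\<lambda>y. (c * c') * exp ((a + a') \<bullet> y))"
      by (simp only: inner_add_left exp_add mult_ac)
    show ?case unfolding e by (rule exp_comb.base)
  next
    case (add f g)
    show ?case unfolding distrib_left by (rule exp_comb.add) (rule add.IH)+
  qed
next
  case (add f1 f2)
  show ?case unfolding distrib_right
    by (rule exp_comb.add) (rule add.IH[OF add.prems])+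
qed

lemma exp_comb_continuous_on: "exp_comb f \<Longrightarrow> continuous_on S f"
  by (induction rule: exp_comb.induct) (auto intro!: continuous_intros)

lemma exp_comb_dense:
  fixes h :: "'a::euclidean_space \<Rightarrow> real"
  assumes h: "continuous_on unit_sphere h" and e: "e > 0"
  shows "\<exists>g. exp_comb g \<and> (\<forall>x\<in>unit_sphere. \<bar>h x - g x\<bar> < e)"
proof (rule Stone_Weierstrass_HOL[where P=exp_comb, OF _ _ _ _ _ _ h e])
  show "compact (unit_sphere :: 'a set)" by simp
  show "exp_comb (\<lambda>_. c)" for c using exp_comb.base[of c 0] by simp
  show "continuous_on unit_sphere f" if "exp_comb f" for f :: "'a \<Rightarrow> real"
    using that by (rule exp_comb_continuous_on)
  show "exp_comb (\<lambda>x. f x + g x)" if "exp_comb f \<and> exp_comb g" for f g :: "'a \<Rightarrow> real"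
    using that by (simp add: exp_comb.add)
  show "exp_comb (\<lambda>x. f x * g x)" if "exp_comb f \<and> exp_comb g" for f g :: "'a \<Rightarrow> real"
    using that by (simp add: exp_comb_mult)
  show "\<exists>f. exp_comb f \<and> f x \<noteq> f y" if "x \<in> unit_sphere \<and> y \<in> unit_sphere \<and> x \<noteq> y" for x y :: 'a
  proof -
    have "(x - y) \<bullet> (x - y) \<noteq> 0" using that by simp
    then have "(x - y) \<bullet> x \<noteq> (x - y) \<bullet> y" by (simp add: inner_diff_right)
    then have "1 * exp ((x - y) \<bullet> x) \<noteq> 1 * exp ((x - y) \<bullet> y)" by simp
    then show ?thesis using exp_comb.base[of 1 "x - y"] by blast
  qed
qed

lemma integrable_mult_continuous:
  fixes f h :: "'a::euclidean_space \<Rightarrow> real"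
  assumes f: "integrable sphere_measure f" and h: "continuous_on unit_sphere h"
  shows "integrable sphere_measure (\<lambda>y. h y * f y)"
proof -
  obtain C where C: "\<And>y. y \<in> unit_sphere \<Longrightarrow> \<bar>h y\<bar> \<le> C" and C0: "C > 0"
    using continuous_on_sphere_bounded[OF h] by metis
  show ?thesis
  proof (rule Bochner_Integration.integrable_bound)
    show "integrable sphere_measure (\<lambda>y. C * f y)" using f by simp
    show "(\<lambda>y. h y * f y) \<in> borel_measurable sphere_measure"
      using continuous_on_sphere_measurable[OF h] f by simp
    show "AE y in sphere_measure. norm (h y * f y) \<le> norm (C * f y)"
      using C C0 by (intro AE_I2) (auto simp: abs_mult intro!: mult_right_mono)
  qed
qed

lemma harmonic_proj_eq:
  fixes x :: "'a::euclidean_space"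
  assumes "2 \<le> DIM('a)"
  shows "harmonic_proj l f x = (\<integral>y. poly (zonal_harmonic TYPE('a) l) (x \<bullet> y) * f y \<partial>sphere_measure)"
  by (simp add: harmonic_proj_def zonal_kernel_eq[OF assms])

text \<open>
  A function orthogonal to all zonal harmonics is orthogonal to every polynomial in \<open>x \<bullet> y\<close>, hence to
  the functions \<open>y \<mapsto> exp (a \<bullet> y)\<close>, which span an algebra that separates points.
\<close>

theorem harmonic_proj_complete:
  fixes f :: "'a::euclidean_space \<Rightarrow> real"
  assumes dim: "2 \<le> DIM('a)" and f: "integrable sphere_measure f"
    and zero: "\<And>l x. x \<in> unit_sphere \<Longrightarrow> harmonic_proj l f x = 0"
  shows "AE y in sphere_measure. f y = 0"
proof -
  let ?Z = "zonal_harmonic TYPE('a)"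
  have poly0: "(\<integral>y. poly Q (x \<bullet> y) * f y \<partial>sphere_measure) = 0" if x: "x \<in> unit_sphere" for Q and x :: 'a
  proof -
    obtain c n where c: "Q = (\<Sum>i<n. smult (c i) (?Z i))"
      using zonal_harmonic_span[OF lessI, where 'a='a] by blast
    have "poly Q t * w = (\<Sum>i<n. c i * (poly (?Z i) t * w))" for t w
      unfolding c by (simp only: poly_sum poly_smult sum_distrib_right mult.assoc)
    then have "(\<integral>y. poly Q (x \<bullet> y) * f y \<partial>sphere_measure)
      = (\<integral>y. (\<Sum>i<n. c i * (poly (?Z i) (x \<bullet> y) * f y)) \<partial>sphere_measure)"
      by (simp only:)
    also have "\<dots> = (\<Sum>i<n. \<integral>y. c i * (poly (?Z i) (x \<bullet> y) * f y) \<partial>sphere_measure)"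
      by (intro Bochner_Integration.integral_sum Bochner_Integration.integrable_mult_right integrable_mult_continuous f continuous_on_poly_inner)
    also have "\<dots> = 0"
      using zero[OF x] unfolding harmonic_proj_eq[OF dim] by simp
    finally show ?thesis .
  qed
  \<comment> \<open>With \<open>a = r *\<^sub>R x\<close> for a unit vector \<open>x\<close>, the
    exponential is a power series in \<open>x \<bullet> y\<close>. Its terms are annihilated by
    \<open>poly0\<close> and are dominated by \<open>r ^ k / fact k\<close> times the absolute value
    of \<open>f\<close>.\<close>
  have exp0: "(\<integral>y. exp (a \<bullet> y) * f y \<partial>sphere_measure) = 0" for a :: 'a
  proof -
    obtain x :: 'a and r where x: "x \<in> unit_sphere" and a: "a = r *\<^sub>R x" and r: "r \<ge> 0"
    proof (cases "a = 0")
      case True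
      then show ?thesis using that[of _ 0] inner_sphere_surj[OF dim] by force
    next
      case False
      then show ?thesis using that[of "sgn a" "norm a"] by (simp add: norm_sgn sgn_div_norm)
    qed
    let ?g = "\<lambda>k y. poly (monom (r ^ k / fact k) k) (x \<bullet> y) * f y"
    have gy: "?g k y = (r * (x \<bullet> y)) ^ k /\<^sub>R fact k * f y" for k y
      by (simp add: poly_monom power_mult_distrib field_simps)
    have int: "integrable sphere_measure (?g k)" for k
      by (intro integrable_mult_continuous f continuous_on_poly_inner)
    have bd: "norm (?g k y) \<le> r ^ k /\<^sub>R fact k * \<bar>f y\<bar>" if "y \<in> unit_sphere" for k y
    proof -
      have "\<bar>(x \<bullet> y) ^ k\<bar> \<le> 1" using inner_sphere_le[OF x that] by (simp add: power_abs power_le_one)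
      then have "\<bar>r ^ k\<bar> * \<bar>(x \<bullet> y) ^ k\<bar> \<le> r ^ k * 1" using r by (intro mult_mono) auto
      then show ?thesis unfolding gy using r
        by (simp add: abs_mult power_mult_distrib divide_simps mult_right_mono)
    qed
    have S: "summable (\<lambda>k. r ^ k /\<^sub>R fact k)" by (rule summable_exp_generic)
    have "(\<integral>y. exp (a \<bullet> y) * f y \<partial>sphere_measure) = (\<integral>y. (\<Sum>k. ?g k y) \<partial>sphere_measure)"
    proof (intro Bochner_Integration.integral_cong refl)
      fix y
      have "(\<lambda>k. (r * (x \<bullet> y)) ^ k /\<^sub>R fact k * f y) sums (exp (r * (x \<bullet> y)) * f y)"
        by (intro sums_mult2 exp_converges)
      then show "exp (a \<bullet> y) * f y = (\<Sum>k. ?g k y)"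
        unfolding gy by (simp add: a sums_iff)
    qed
    also have "\<dots> = (\<Sum>k. \<integral>y. ?g k y \<partial>sphere_measure)"
    proof (rule integral_suminf[OF int])
      show "AE y in sphere_measure. summable (\<lambda>k. norm (?g k y))"
      proof (rule AE_I2)
        fix y :: 'a assume "y \<in> space sphere_measure"
        then have y: "y \<in> unit_sphere" by simp
        show "summable (\<lambda>k. norm (?g k y))"
          using bd[OF y] by (intro summable_comparison_test'[OF summable_mult2[OF S, of "\<bar>f y\<bar>"], of 0]) simp
      qed
      show "summable (\<lambda>k. \<integral>y. norm (?g k y) \<partial>sphere_measure)"
      proof (rule summable_comparison_test'[OF summable_mult2[OF S, of "\<integral>y. \<bar>f y\<bar> \<partial>sphere_measure"], of 0])
        fix k
        have "(\<integral>y. norm (?g k y) \<partial>sphere_measure) \<le> (\<integral>y. r ^ k /\<^sub>R fact k * \<bar>f y\<bar> \<partial>sphere_measure)"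
          using bd by (intro integral_mono integrable_norm int Bochner_Integration.integrable_mult_right integrable_abs f) simp
        then show "norm (\<integral>y. norm (?g k y) \<partial>sphere_measure) \<le> r ^ k /\<^sub>R fact k * (\<integral>y. \<bar>f y\<bar> \<partial>sphere_measure)"
          by simp
      qed
    qed
    also have "\<dots> = 0" using poly0[OF x] by simp
    finally show ?thesis .
  qed
  have comb0: "(\<integral>y. g y * f y \<partial>sphere_measure) = 0" if "exp_comb g" for g
    using that
  proof (induction rule: exp_comb.induct)
    case (base c a)
    show ?case using exp0[of a] by (simp add: mult.assoc)
  next
    case (add g h)
    then show ?case
      using integrable_mult_continuous[OF f exp_comb_continuous_on[OF add.hyps(1)]]
        integrable_mult_continuous[OF f exp_comb_continuous_on[OF add.hyps(2)]]
      by (simp add: distrib_right)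
  qed
  have cont0: "(\<integral>y. h y * f y \<partial>sphere_measure) = 0" if h: "continuous_on unit_sphere h" for h
  proof -
    let ?I = "\<integral>y. \<bar>f y\<bar> \<partial>sphere_measure"
    have I: "?I \<ge> 0" by simp
    have "\<bar>\<integral>y. h y * f y \<partial>sphere_measure\<bar> \<le> e * ?I" if e: "e > 0" for e
    proof -
      obtain g where g: "exp_comb g" "\<And>x. x \<in> unit_sphere \<Longrightarrow> \<bar>h x - g x\<bar> < e"
        using exp_comb_dense[OF h e] by blast
      note ih = integrable_mult_continuous[OF f h]
      note ig = integrable_mult_continuous[OF f exp_comb_continuous_on[OF g(1)]]
      have "(\<integral>y. h y * f y \<partial>sphere_measure) = (\<integral>y. h y * f y - g y * f y \<partial>sphere_measure)"
        using ih ig comb0[OF g(1)] by simp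
      also have "\<bar>\<dots>\<bar> \<le> (\<integral>y. \<bar>h y * f y - g y * f y\<bar> \<partial>sphere_measure)"
        by (rule integral_abs_bound)
      also have "\<dots> \<le> (\<integral>y. e * \<bar>f y\<bar> \<partial>sphere_measure)"
      proof (intro integral_mono integrable_abs Bochner_Integration.integrable_diff ih ig Bochner_Integration.integrable_mult_right f)
        fix y :: 'a assume "y \<in> space sphere_measure"
        then have "\<bar>h y - g y\<bar> \<le> e" using g(2)[of y] by simp
        then have "\<bar>h y - g y\<bar> * \<bar>f y\<bar> \<le> e * \<bar>f y\<bar>" by (rule mult_right_mono) simp
        then show "\<bar>h y * f y - g y * f y\<bar> \<le> e * \<bar>f y\<bar>" by (simp add: abs_mult[symmetric] left_diff_distrib)
      qed
      finally show ?thesis by simp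
    qed
    note * = this
    show ?thesis
    proof (rule ccontr)
      assume n: "\<not> ?thesis"
      \<comment> \<open>Chosen so that \<open>?e * (?I + 1)\<close> is half the absolute value to be
        excluded; the 1 keeps the denominator positive when \<open>?I\<close> is 0.\<close>
      let ?e = "\<bar>\<integral>y. h y * f y \<partial>sphere_measure\<bar> / (2 * (?I + 1))"
      have pos: "2 * (c + 1) > 0" if "c \<ge> 0" for c :: real using that by simp
      have e: "?e > 0" by (intro divide_pos_pos pos I) (use n in simp)
      have "?e * ?I \<le> ?e * (?I + 1)" using e by (intro mult_left_mono) auto
      also have "\<dots> = \<bar>\<integral>y. h y * f y \<partial>sphere_measure\<bar> / 2"
      proof -
        have "a / (2 * b) * b = a / 2" if "b \<noteq> 0" for a b :: real using that by simp
        moreover have "c + 1 \<noteq> 0" if "c \<ge> 0" for c :: real using that by simp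
        ultimately show ?thesis using I by blast
      qed
      finally have "\<bar>\<integral>y. h y * f y \<partial>sphere_measure\<bar> \<le> \<bar>\<integral>y. h y * f y \<partial>sphere_measure\<bar> / 2"
        by (rule order.trans[OF *[OF e]])
      then show False using n by simp
    qed
  qed
  \<comment> \<open>The indicator of a closed set is the limit of tent functions of the distance to
    it. The empty set is treated apart because \<open>infdist\<close> to it is 0 by
    convention.\<close>
  have closed0: "(\<integral>y. indicator C y * f y \<partial>sphere_measure) = 0" if C: "closed C" for C
  proof (cases "C = {}")
    case False
    let ?h = "\<lambda>k y. max 0 (1 - real k * infdist y C)"
    have "(\<lambda>k. \<integral>y. ?h k y * f y \<partial>sphere_measure) \<longlonglongrightarrow> (\<integral>y. indicator C y * f y \<partial>sphere_measure)"
    proof (rule integral_dominated_convergence[where w="\<lambda>y. \<bar>f y\<bar>"])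
      have [measurable]: "C \<in> sets borel" using C by simp
      have "(indicator C :: 'a \<Rightarrow> real) \<in> borel_measurable sphere_measure"
        by (intro measurable_on_sphere) simp
      then show "(\<lambda>y. indicator C y * f y) \<in> borel_measurable sphere_measure" using f by simp
      show "(\<lambda>y. ?h k y * f y) \<in> borel_measurable sphere_measure" for k
        by (intro borel_measurable_integrable integrable_mult_continuous f continuous_intros)
      show "integrable sphere_measure (\<lambda>y. \<bar>f y\<bar>)" using f by simp
      show "AE y in sphere_measure. (\<lambda>k. ?h k y * f y) \<longlonglongrightarrow> indicator C y * f y"
      proof (intro AE_I2 tendsto_mult tendsto_const)
        fix y
        show "(\<lambda>k. ?h k y) \<longlonglongrightarrow> indicator C y"
        proof (cases "y \<in> C")
          case True
          then show ?thesis by simp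
        next
          case ny: False
          then have pos: "infdist y C > 0" using C False by (simp add: in_closed_iff_infdist_zero infdist_pos_not_in_closed)
          obtain k0 :: nat where k0: "1 / infdist y C < real k0" using reals_Archimedean2 by blast
          have "?h k y = 0" if "k \<ge> k0" for k
          proof -
            have "1 / infdist y C < real k" using k0 that by (meson less_le_trans of_nat_mono)
            then have "1 < real k * infdist y C" using pos by (simp add: divide_less_eq)
            then show ?thesis by simp
          qed
          then have "eventually (\<lambda>k. ?h k y = 0) sequentially" by (auto simp: eventually_sequentially)
          then show ?thesis using ny by (simp add: tendsto_eventually)
        qed
      qed
      show "AE y in sphere_measure. norm (?h k y * f y) \<le> \<bar>f y\<bar>" for k
        by (intro AE_I2) (auto simp: abs_mult intro!: mult_left_le_one_le mult_nonneg_nonneg infdist_nonneg)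
    qed
    moreover have "(\<integral>y. ?h k y * f y \<partial>sphere_measure) = 0" for k
      by (intro cont0 continuous_intros)
    ultimately show ?thesis by (simp add: LIMSEQ_const_iff)
  qed simp
  have set_int: "set_integrable sphere_measure A f" if "A \<in> sets sphere_measure" for A
    unfolding set_integrable_def using that f by (rule integrable_mult_indicator)
  have bor: "A \<inter> unit_sphere \<in> sets sphere_measure" if "A \<in> sets borel" for A :: "'a set"
    using that unfolding sets_sphere_measure by (auto simp: sets_restrict_space)
  have eqA: "(LINT y:A \<inter> unit_sphere|sphere_measure. f y) = (\<integral>y. indicator A y * f y \<partial>sphere_measure)" for A
    unfolding set_lebesgue_integral_def by (intro Bochner_Integration.integral_cong refl) (auto simp: indicator_def)
  \<comment> \<open>Closed sets are stable under intersection and generate the Borel sets, so the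
    vanishing of the integrals spreads by Dynkin's argument.\<close>
  have borel0: "(LINT y:A \<inter> unit_sphere|sphere_measure. f y) = 0" if "A \<in> sigma_sets UNIV (Collect closed)" for A :: "'a set"
  proof (rule sigma_sets_induct_disjoint[OF _ _ that])
    show "Int_stable (Collect closed :: 'a set set)" by (auto simp: Int_stable_def)
    show "Collect closed \<subseteq> Pow (UNIV :: 'a set)" by simp
    show "(LINT y:C \<inter> unit_sphere|sphere_measure. f y) = 0" if "C \<in> Collect closed" for C
      using closed0[of C] that by (simp add: eqA)
    show "(LINT y:{} \<inter> unit_sphere|sphere_measure. f y) = 0" by (simp add: set_lebesgue_integral_def)
  next
    fix A :: "'a set" assume A: "A \<in> sigma_sets UNIV (Collect closed)" and 0: "(LINT y:A \<inter> unit_sphere|sphere_measure. f y) = 0"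
    have Ab: "A \<in> sets borel" using A by (simp add: borel_eq_closed)
    have "(LINT y:UNIV \<inter> unit_sphere|sphere_measure. f y) = (LINT y:A \<inter> unit_sphere|sphere_measure. f y) + (LINT y:(UNIV - A) \<inter> unit_sphere|sphere_measure. f y)"
      using Ab by (subst set_integral_Un[symmetric]) (auto intro!: set_int bor simp: Int_Un_distrib2[symmetric])
    moreover have "(LINT y:UNIV \<inter> unit_sphere|sphere_measure. f y) = 0"
      using closed0[of UNIV] by (simp only: eqA closed_UNIV)
    ultimately show "(LINT y:(UNIV - A) \<inter> unit_sphere|sphere_measure. f y) = 0" using 0 by simp
  next
    fix A :: "nat \<Rightarrow> 'a set" assume disj: "disjoint_family A" and A: "range A \<subseteq> sigma_sets UNIV (Collect closed)"
      and 0: "\<And>i. (LINT y:A i \<inter> unit_sphere|sphere_measure. f y) = 0"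
    have Ab: "A i \<in> sets borel" for i using A by (auto simp: borel_eq_closed)
    have e: "(\<Union>i. A i) \<inter> unit_sphere = (\<Union>i. A i \<inter> unit_sphere)" by auto
    show "(LINT y:(\<Union>i. A i) \<inter> unit_sphere|sphere_measure. f y) = 0"
      unfolding e using disj 0
      by (subst lebesgue_integral_countable_add)
         (auto intro!: bor Ab set_int sets.countable_UN simp: disjoint_family_on_def)
  qed
  show ?thesis
  proof (rule density_unique_real[OF f])
    show "integrable sphere_measure (\<lambda>_. 0 :: real)" by simp
    fix A :: "'a set" assume A: "A \<in> sets sphere_measure"
    then obtain A' where "A = A' \<inter> unit_sphere" "A' \<in> sets borel"
      unfolding sets_sphere_measure by (auto simp: sets_restrict_space)
    then show "(LINT y:A|sphere_measure. f y) = (LINT y:A|sphere_measure. 0)"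
      using borel0[of A'] by (simp add: borel_eq_closed)
  qed
qed

subsection \<open>\<open>L\<^sub>p\<close> norms and duality\<close>

lemma conjugate_exponents_cases:
  assumes "1 \<le> p" "1 \<le> q" "1 / p + 1 / q = (1::ereal)"
  obtains "p = 1" "q = \<infinity>" | "p = \<infinity>" "q = 1"
  | P Q where "p = ereal P" "q = ereal Q" "1 < P" "1 < Q" "1 / P + 1 / Q = 1"
proof (cases p)
  case (real P)
  then have P: "P \<ge> 1" using assms(1) by simp
  show ?thesis
  proof (cases q)
    case (real Q)
    then have Q: "Q \<ge> 1" using assms(2) by simp
    have e: "1 / P + 1 / Q = 1"
      using assms(3) P Q \<open>p = ereal P\<close> \<open>q = ereal Q\<close> by (simp add: one_ereal_def)
    have "P \<noteq> 1" "Q \<noteq> 1" using e P Q by auto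
    then show ?thesis using that(3)[OF \<open>p = ereal P\<close> \<open>q = ereal Q\<close> _ _ e] P Q by simp
  next
    case PInf
    then have "1 / P = 1" using assms(3) P \<open>p = ereal P\<close> by (simp add: one_ereal_def)
    then have "P = 1" using P by (simp add: divide_eq_eq)
    then show ?thesis using that(1) PInf \<open>p = ereal P\<close> by (simp add: one_ereal_def)
  qed (use assms in auto)
next
  case PInf
  show ?thesis
  proof (cases q)
    case (real Q)
    then have Q: "Q \<ge> 1" using assms(2) by simp
    then have "1 / Q = 1" using assms(3) PInf real by (simp add: one_ereal_def)
    then have "Q = 1" using Q by (simp add: divide_eq_eq)
    then show ?thesis using that(2) PInf real by (simp add: one_ereal_def)
  qed (use assms PInf in \<open>auto simp: one_ereal_def\<close>)
qed (use assms in auto)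

lemma lp_norm_1:
  assumes "f \<in> borel_measurable M"
  shows "lp_norm 1 M f = (\<integral>\<^sup>+x. ennreal \<bar>f x\<bar> \<partial>M)"
  by (auto simp: lp_norm_def Let_def ennreal_enn2real_if powr_one_gt_zero_iff)

lemma lp_norm_infinity: "lp_norm \<infinity> M f = esssup M (\<lambda>x. ennreal \<bar>f x\<bar>)"
  by (simp add: lp_norm_def)

lemma lp_norm_real:
  "lp_norm (ereal P) M f = (let I = \<integral>\<^sup>+x. ennreal (\<bar>f x\<bar> powr P) \<partial>M in
     if I = \<infinity> then \<infinity> else ennreal (enn2real I powr (1 / P)))"
  by (simp add: lp_norm_def Let_def)

lemma lp_norm_cong_AE:
  assumes "f \<in> borel_measurable M" "g \<in> borel_measurable M" "AE x in M. f x = g x"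
  shows "lp_norm p M f = lp_norm p M g"
proof -
  have "(\<integral>\<^sup>+x. ennreal (\<bar>f x\<bar> powr real_of_ereal p) \<partial>M) = (\<integral>\<^sup>+x. ennreal (\<bar>g x\<bar> powr real_of_ereal p) \<partial>M)"
    using assms(3) by (intro nn_integral_cong_AE) auto
  moreover have "esssup M (\<lambda>x. ennreal \<bar>f x\<bar>) = esssup M (\<lambda>x. ennreal \<bar>g x\<bar>)"
    using assms by (intro esssup_AE_cong) auto
  ultimately show ?thesis by (simp add: lp_norm_def)
qed

lemma lp_norm_le_infinity:
  assumes "f \<in> borel_measurable M" "AE x in M. \<bar>f x\<bar> \<le> C"
  shows "lp_norm \<infinity> M f \<le> ennreal C"
  unfolding lp_norm_infinity using assms by (intro esssup_I) (auto elim!: eventually_mono intro: ennreal_leI)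

lemma AE_le_lp_norm_infinity:
  "AE x in M. ennreal \<bar>f x\<bar> \<le> lp_norm \<infinity> M f"
  unfolding lp_norm_infinity by (rule esssup_AE)

lemma ennreal_powr_enn2real_le:
  assumes "I \<le> ennreal (C powr P)" "C \<ge> 0" "P > 0"
  shows "(if I = \<infinity> then \<infinity> else ennreal (enn2real I powr (1 / P))) \<le> ennreal C"
proof -
  have "I < \<infinity>" using assms(1) by (metis ennreal_less_top infinity_ennreal_def order_le_less_trans)
  moreover have "enn2real I \<le> C powr P"
    using assms(1) by (intro enn2real_leI) auto
  then have "enn2real I powr (1 / P) \<le> (C powr P) powr (1 / P)"
    using assms by (intro powr_mono2) auto
  then have "enn2real I powr (1 / P) \<le> C" using assms by (simp add: powr_powr)
  ultimately show ?thesis by (auto intro: ennreal_leI)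
qed

text \<open>Frees norm estimates from the root, the case distinction and \<open>enn2real\<close> in
  the definition of \<open>lp_norm\<close>.\<close>

lemma lp_norm_real_le_iff:
  assumes "P > 0" "C \<ge> 0"
  shows "lp_norm (ereal P) M f \<le> ennreal C \<longleftrightarrow> (\<integral>\<^sup>+x. ennreal (\<bar>f x\<bar> powr P) \<partial>M) \<le> ennreal (C powr P)"
    (is "_ \<longleftrightarrow> ?I \<le> _")
proof
  assume "?I \<le> ennreal (C powr P)"
  then show "lp_norm (ereal P) M f \<le> ennreal C"
    unfolding lp_norm_real Let_def using assms by (intro ennreal_powr_enn2real_le)
next
  assume le: "lp_norm (ereal P) M f \<le> ennreal C"
  then have fin: "?I \<noteq> \<infinity>" by (auto simp: lp_norm_real Let_def top_unique)
  then have "enn2real ?I powr (1 / P) \<le> C"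
    using le assms by (simp add: lp_norm_real Let_def)
  then have "(enn2real ?I powr (1 / P)) powr P \<le> C powr P"
    using assms by (intro powr_mono2) auto
  then have "enn2real ?I \<le> C powr P" using assms by (simp add: powr_powr)
  then have "ennreal (enn2real ?I) \<le> ennreal (C powr P)" by (rule ennreal_leI)
  moreover have "ennreal (enn2real ?I) = ?I" using fin by (intro ennreal_enn2real) (simp add: less_top)
  ultimately show "?I \<le> ennreal (C powr P)" by simp
qed

section \<open>Hoelder's inequality and the vector space structure\<close>

lemma holder_real_normalized:
  fixes u v :: "'a \<Rightarrow> real"
  assumes [measurable]: "u \<in> borel_measurable M" "v \<in> borel_measurable M"
    and PQ: "1 < P" "1 < Q" "1 / P + 1 / Q = 1"
    and u: "(\<integral>\<^sup>+x. ennreal (\<bar>u x\<bar> powr P) \<partial>M) \<le> 1" and v: "(\<integral>\<^sup>+x. ennreal (\<bar>v x\<bar> powr Q) \<partial>M) \<le> 1"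
  shows "(\<integral>\<^sup>+x. ennreal \<bar>u x * v x\<bar> \<partial>M) \<le> 1"
proof -
  have "(\<integral>\<^sup>+x. ennreal \<bar>u x * v x\<bar> \<partial>M) \<le> (\<integral>\<^sup>+x. ennreal (1 / P) * ennreal (\<bar>u x\<bar> powr P) + ennreal (1 / Q) * ennreal (\<bar>v x\<bar> powr Q) \<partial>M)"
  proof (rule nn_integral_mono)
    fix x
    have "\<bar>u x * v x\<bar> \<le> \<bar>u x\<bar> powr P / P + \<bar>v x\<bar> powr Q / Q"
      unfolding abs_mult using PQ by (intro Youngs_inequality) auto
    then have "ennreal \<bar>u x * v x\<bar> \<le> ennreal (1 / P * \<bar>u x\<bar> powr P + 1 / Q * \<bar>v x\<bar> powr Q)"
      by (intro ennreal_leI) simp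
    also have "\<dots> = ennreal (1 / P) * ennreal (\<bar>u x\<bar> powr P) + ennreal (1 / Q) * ennreal (\<bar>v x\<bar> powr Q)"
    proof -
      have "ennreal (1 / P * \<bar>u x\<bar> powr P) = ennreal (1 / P) * ennreal (\<bar>u x\<bar> powr P)"
        "ennreal (1 / Q * \<bar>v x\<bar> powr Q) = ennreal (1 / Q) * ennreal (\<bar>v x\<bar> powr Q)"
        using PQ by (intro ennreal_mult; simp)+
      moreover have "0 \<le> 1 / P * \<bar>u x\<bar> powr P" "0 \<le> 1 / Q * \<bar>v x\<bar> powr Q" using PQ by simp_all
      ultimately show ?thesis by (simp only: ennreal_plus)
    qed
    finally show "ennreal \<bar>u x * v x\<bar> \<le> ennreal (1 / P) * ennreal (\<bar>u x\<bar> powr P) + ennreal (1 / Q) * ennreal (\<bar>v x\<bar> powr Q)" .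
  qed
  also have "\<dots> = ennreal (1 / P) * (\<integral>\<^sup>+x. ennreal (\<bar>u x\<bar> powr P) \<partial>M) + ennreal (1 / Q) * (\<integral>\<^sup>+x. ennreal (\<bar>v x\<bar> powr Q) \<partial>M)"
    by (simp add: nn_integral_add nn_integral_cmult)
  also have "\<dots> \<le> ennreal (1 / P) * 1 + ennreal (1 / Q) * 1"
    using u v by (intro add_mono mult_left_mono) auto
  also have "\<dots> = ennreal (1 / P + 1 / Q)" using PQ by (subst ennreal_plus) auto
  finally show ?thesis using PQ(3) by simp
qed

lemma lp_norm_scale_le:
  assumes f: "f \<in> borel_measurable M" and c: "c > 0" and P: "P > 0" and le: "lp_norm (ereal P) M f \<le> ennreal c"
  shows "(\<integral>\<^sup>+x. ennreal (\<bar>f x / c\<bar> powr P) \<partial>M) \<le> 1"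
proof -
  note [measurable] = f
  have "(\<integral>\<^sup>+x. ennreal (\<bar>f x / c\<bar> powr P) \<partial>M) = (\<integral>\<^sup>+x. ennreal (\<bar>f x\<bar> powr P) * ennreal (1 / (c powr P)) \<partial>M)"
    using c by (intro nn_integral_cong) (simp add: ennreal_mult[symmetric] powr_divide)
  also have "\<dots> = (\<integral>\<^sup>+x. ennreal (\<bar>f x\<bar> powr P) \<partial>M) * ennreal (1 / (c powr P))"
    by (rule nn_integral_multc) simp
  also have "\<dots> \<le> ennreal (c powr P) * ennreal (1 / (c powr P))"
    using le c P by (intro mult_right_mono) (auto simp: lp_norm_real_le_iff)
  also have "\<dots> = 1" using c by (simp add: ennreal_mult[symmetric])
  finally show ?thesis .
qed

theorem holder_lp:
  assumes conj: "1 \<le> p" "1 \<le> q" "1 / p + 1 / q = (1::ereal)"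
    and [measurable]: "f \<in> borel_measurable M" "g \<in> borel_measurable M"
    and a: "lp_norm p M f \<le> ennreal a" "a \<ge> 0" and b: "lp_norm q M g \<le> ennreal b" "b \<ge> 0"
  shows "(\<integral>\<^sup>+x. ennreal \<bar>f x * g x\<bar> \<partial>M) \<le> ennreal (a * b)"
  using conj
proof (cases rule: conjugate_exponents_cases)
  case 1
  have "AE x in M. ennreal \<bar>g x\<bar> \<le> ennreal b"
    using AE_le_lp_norm_infinity[where M=M and f=g] b(1) unfolding \<open>q = \<infinity>\<close> by (auto elim!: eventually_mono)
  then have "(\<integral>\<^sup>+x. ennreal \<bar>f x * g x\<bar> \<partial>M) \<le> (\<integral>\<^sup>+x. ennreal \<bar>f x\<bar> * ennreal b \<partial>M)"
    by (intro nn_integral_mono_AE) (auto simp: abs_mult ennreal_mult intro: mult_left_mono elim!: eventually_mono)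
  also have "\<dots> = lp_norm 1 M f * ennreal b" by (simp add: lp_norm_1 nn_integral_multc)
  also have "\<dots> \<le> ennreal a * ennreal b" using a 1 by (intro mult_right_mono) auto
  finally show ?thesis using a b by (simp add: ennreal_mult)
next
  case 2
  have "AE x in M. ennreal \<bar>f x\<bar> \<le> ennreal a"
    using AE_le_lp_norm_infinity[where M=M and f=f] a(1) unfolding \<open>p = \<infinity>\<close> by (auto elim!: eventually_mono)
  then have "(\<integral>\<^sup>+x. ennreal \<bar>f x * g x\<bar> \<partial>M) \<le> (\<integral>\<^sup>+x. ennreal a * ennreal \<bar>g x\<bar> \<partial>M)"
    by (intro nn_integral_mono_AE) (auto simp: abs_mult ennreal_mult intro: mult_right_mono elim!: eventually_mono)
  also have "\<dots> = ennreal a * lp_norm 1 M g" by (simp add: lp_norm_1 nn_integral_cmult)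
  also have "\<dots> \<le> ennreal a * ennreal b" using b 2 by (intro mult_left_mono) auto
  finally show ?thesis using a b by (simp add: ennreal_mult)
next
  case (3 P Q)
  \<comment> \<open>Bounds strictly above \<open>a\<close> and \<open>b\<close> are positive even if
    \<open>a\<close> or \<open>b\<close> is 0, so the functions can be normalized; letting the
    excess \<open>1 / (n + 1)\<close> tend to 0 restores \<open>a * b\<close>.\<close>
  have *: "(\<integral>\<^sup>+x. ennreal \<bar>f x * g x\<bar> \<partial>M) \<le> ennreal (a' * b')" if ab: "a' > a" "b' > b" for a' b'
  proof -
    have ab0: "a' > 0" "b' > 0" using ab a b by auto
    have "(\<integral>\<^sup>+x. ennreal \<bar>(f x / a') * (g x / b')\<bar> \<partial>M) \<le> 1"
    proof (rule holder_real_normalized[where P=P and Q=Q])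
      show "(\<integral>\<^sup>+x. ennreal (\<bar>f x / a'\<bar> powr P) \<partial>M) \<le> 1"
        using 3 a(1) ab ab0 by (intro lp_norm_scale_le) (auto intro: order.trans[OF _ ennreal_leI])
      show "(\<integral>\<^sup>+x. ennreal (\<bar>g x / b'\<bar> powr Q) \<partial>M) \<le> 1"
        using 3 b(1) ab ab0 by (intro lp_norm_scale_le) (auto intro: order.trans[OF _ ennreal_leI])
    qed (use 3 in auto)
    then have "ennreal (a' * b') * (\<integral>\<^sup>+x. ennreal \<bar>(f x / a') * (g x / b')\<bar> \<partial>M) \<le> ennreal (a' * b') * 1"
      by (intro mult_left_mono) auto
    also have "ennreal (a' * b') * (\<integral>\<^sup>+x. ennreal \<bar>(f x / a') * (g x / b')\<bar> \<partial>M)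
      = (\<integral>\<^sup>+x. ennreal (a' * b') * ennreal \<bar>(f x / a') * (g x / b')\<bar> \<partial>M)"
      by (rule nn_integral_cmult[symmetric]) simp
    also have "\<dots> = (\<integral>\<^sup>+x. ennreal \<bar>f x * g x\<bar> \<partial>M)"
      using ab0 by (intro nn_integral_cong) (simp add: ennreal_mult[symmetric] abs_mult)
    finally show ?thesis by simp
  qed
  have lim: "(\<lambda>n. ennreal ((a + 1 / real (Suc n)) * (b + 1 / real (Suc n)))) \<longlonglongrightarrow> ennreal ((a + 0) * (b + 0))"
    by (intro tendsto_ennrealI tendsto_intros LIMSEQ_inverse_real_of_nat[unfolded inverse_eq_divide])
  show ?thesis
    using LIMSEQ_le_const[OF lim, of "\<integral>\<^sup>+x. ennreal \<bar>f x * g x\<bar> \<partial>M"] *[of "a + 1 / real (Suc n)" "b + 1 / real (Suc n)" for n]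
    by (auto simp del: of_nat_Suc)
qed

lemma lp_spaceE:
  assumes "f \<in> lp_space p M"
  obtains a where "f \<in> borel_measurable M" "a \<ge> 0" "lp_norm p M f = ennreal a"
  using assms unfolding lp_space_def by (cases "lp_norm p M f") auto

lemma lp_spaceI:
  "f \<in> borel_measurable M \<Longrightarrow> lp_norm p M f \<le> ennreal a \<Longrightarrow> f \<in> lp_space p M"
  unfolding lp_space_def using le_less_trans[OF _ ennreal_less_top] by auto

lemma (in prob_space) lp_space_bounded:
  assumes f: "f \<in> borel_measurable M" and p: "1 \<le> p" and C: "C \<ge> 0" "AE x in M. \<bar>f x\<bar> \<le> C"
  shows "lp_norm p M f \<le> ennreal C"
proof (cases p)
  case (real P)
  then have P: "P \<ge> 1" using p by simp
  have "(\<integral>\<^sup>+x. ennreal (\<bar>f x\<bar> powr P) \<partial>M) \<le> (\<integral>\<^sup>+x. ennreal (C powr P) \<partial>M)"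
    using C P by (intro nn_integral_mono_AE) (auto elim!: eventually_mono intro!: ennreal_leI powr_mono2)
  also have "\<dots> = ennreal (C powr P)" by (simp add: emeasure_space_1)
  finally show ?thesis using P C real by (simp add: lp_norm_real_le_iff)
next
  case PInf
  then show ?thesis using lp_norm_le_infinity[OF f C(2)] by simp
qed (use p in auto)

lemma (in prob_space) lp_space_integrable_mult:
  assumes conj: "1 \<le> p" "1 \<le> q" "1 / p + 1 / q = (1::ereal)"
    and f: "f \<in> lp_space p M" and g: "g \<in> lp_space q M"
  shows "integrable M (\<lambda>x. f x * g x)"
proof -
  obtain a where a: "f \<in> borel_measurable M" "a \<ge> 0" "lp_norm p M f = ennreal a" using f by (rule lp_spaceE)
  obtain b where b: "g \<in> borel_measurable M" "b \<ge> 0" "lp_norm q M g = ennreal b" using g by (rule lp_spaceE)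
  have "(\<integral>\<^sup>+x. ennreal \<bar>f x * g x\<bar> \<partial>M) \<le> ennreal (a * b)"
    using a b by (intro holder_lp[OF conj]) auto
  then show ?thesis using a(1) b(1)
    by (intro integrableI_bounded) (auto intro: le_less_trans)
qed

lemma conjugate_exponent_exists:
  assumes "1 \<le> (p::ereal)"
  obtains q where "1 \<le> q" "1 / p + 1 / q = 1"
proof (cases p)
  case (real P)
  then have P: "P \<ge> 1" using assms by simp
  show ?thesis
  proof (cases "P = 1")
    case True
    then show ?thesis using that[of \<infinity>] real by (simp add: one_ereal_def)
  next
    case False
    then have "P > 1" using P by simp
    then show ?thesis using that[of "ereal (P / (P - 1))"] real
      by (simp add: one_ereal_def field_simps)
  qed
next
  case PInf
  then show ?thesis using that[of 1] by (simp add: one_ereal_def)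
qed (use assms in auto)

lemma (in prob_space) lp_space_integrable:
  assumes "1 \<le> p" "f \<in> lp_space p M"
  shows "integrable M f"
proof -
  obtain q where q: "1 \<le> q" "1 / p + 1 / q = 1" using conjugate_exponent_exists[OF assms(1)] .
  have "lp_norm q M (\<lambda>_. 1) \<le> ennreal 1" by (rule lp_space_bounded) (use q in auto)
  then have "(\<lambda>_. 1) \<in> lp_space q M" by (rule lp_spaceI[rotated]) simp
  from lp_space_integrable_mult[OF assms(1) q assms(2) this] show ?thesis by simp
qed

lemma lp_space_add:
  assumes p: "1 \<le> p" and f: "f \<in> lp_space p M" and g: "g \<in> lp_space p M"
  shows "(\<lambda>x. f x + g x) \<in> lp_space p M"
proof -
  obtain a where a: "f \<in> borel_measurable M" "a \<ge> 0" "lp_norm p M f = ennreal a" using f by (rule lp_spaceE)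
  obtain b where b: "g \<in> borel_measurable M" "b \<ge> 0" "lp_norm p M g = ennreal b" using g by (rule lp_spaceE)
  note [measurable] = a(1) b(1)
  show ?thesis
  proof (cases p)
    case (real P)
    then have P: "P \<ge> 1" using p by simp
    have A: "(\<integral>\<^sup>+x. ennreal (\<bar>f x\<bar> powr P) \<partial>M) \<le> ennreal (a powr P)"
      using a P real by (subst lp_norm_real_le_iff[symmetric]) auto
    have B: "(\<integral>\<^sup>+x. ennreal (\<bar>g x\<bar> powr P) \<partial>M) \<le> ennreal (b powr P)"
      using b P real by (subst lp_norm_real_le_iff[symmetric]) auto
    have pw: "\<bar>f x + g x\<bar> powr P \<le> 2 powr P * (\<bar>f x\<bar> powr P + \<bar>g x\<bar> powr P)" for x
    proof -
      have "\<bar>f x + g x\<bar> \<le> 2 * max \<bar>f x\<bar> \<bar>g x\<bar>" by linarith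
      then have "\<bar>f x + g x\<bar> powr P \<le> (2 * max \<bar>f x\<bar> \<bar>g x\<bar>) powr P" using P by (intro powr_mono2) auto
      also have "\<dots> = 2 powr P * (max \<bar>f x\<bar> \<bar>g x\<bar>) powr P" by (subst powr_mult) auto
      also have "\<dots> \<le> 2 powr P * (\<bar>f x\<bar> powr P + \<bar>g x\<bar> powr P)"
        by (intro mult_left_mono) (auto simp: max_def)
      finally show ?thesis .
    qed
    have "(\<integral>\<^sup>+x. ennreal (\<bar>f x + g x\<bar> powr P) \<partial>M)
      \<le> (\<integral>\<^sup>+x. ennreal (2 powr P) * (ennreal (\<bar>f x\<bar> powr P) + ennreal (\<bar>g x\<bar> powr P)) \<partial>M)"
      using pw by (intro nn_integral_mono) (simp add: ennreal_mult[symmetric] ennreal_plus[symmetric] ennreal_leI del: ennreal_plus)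
    also have "\<dots> = ennreal (2 powr P) * ((\<integral>\<^sup>+x. ennreal (\<bar>f x\<bar> powr P) \<partial>M) + (\<integral>\<^sup>+x. ennreal (\<bar>g x\<bar> powr P) \<partial>M))"
      by (simp add: nn_integral_cmult nn_integral_add)
    also have "\<dots> \<le> ennreal (2 powr P) * (ennreal (a powr P) + ennreal (b powr P))"
      using A B by (intro mult_left_mono add_mono) auto
    also have "\<dots> < \<infinity>" by (simp add: ennreal_mult_less_top)
    finally show ?thesis
      unfolding lp_space_def real lp_norm_real Let_def by simp
  next
    case PInf
    have "AE x in M. \<bar>f x\<bar> \<le> a" "AE x in M. \<bar>g x\<bar> \<le> b"
      using AE_le_lp_norm_infinity[where M=M and f=f] AE_le_lp_norm_infinity[where M=M and f=g] a b PInf by simp_all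
    then have "AE x in M. \<bar>f x + g x\<bar> \<le> a + b" by eventually_elim linarith
    then show ?thesis unfolding PInf by (intro lp_spaceI[of _ _ _ "a + b"] lp_norm_le_infinity) auto
  qed (use p in auto)
qed

lemma lp_space_cmult:
  assumes p: "1 \<le> p" and f: "f \<in> lp_space p M"
  shows "(\<lambda>x. c * f x) \<in> lp_space p M"
proof -
  obtain a where a: "f \<in> borel_measurable M" "a \<ge> 0" "lp_norm p M f = ennreal a" using f by (rule lp_spaceE)
  note [measurable] = a(1)
  show ?thesis
  proof (cases p)
    case (real P)
    then have P: "P \<ge> 1" using p by simp
    have A: "(\<integral>\<^sup>+x. ennreal (\<bar>f x\<bar> powr P) \<partial>M) \<le> ennreal (a powr P)"
      using a P real by (subst lp_norm_real_le_iff[symmetric]) auto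
    have "(\<integral>\<^sup>+x. ennreal (\<bar>c * f x\<bar> powr P) \<partial>M) = ennreal (\<bar>c\<bar> powr P) * (\<integral>\<^sup>+x. ennreal (\<bar>f x\<bar> powr P) \<partial>M)"
      by (subst nn_integral_cmult[symmetric]) (auto simp: ennreal_mult[symmetric] abs_mult powr_mult)
    also have "\<dots> \<le> ennreal (\<bar>c\<bar> powr P) * ennreal (a powr P)" using A by (intro mult_left_mono) auto
    also have "\<dots> < \<infinity>" by (simp add: ennreal_mult_less_top)
    finally show ?thesis
      unfolding lp_space_def real lp_norm_real Let_def by simp
  next
    case PInf
    have "AE x in M. \<bar>f x\<bar> \<le> a" using AE_le_lp_norm_infinity[where M=M and f=f] a PInf by simp
    then have "AE x in M. \<bar>c * f x\<bar> \<le> \<bar>c\<bar> * a"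
      by eventually_elim (simp add: abs_mult mult_left_mono)
    then show ?thesis unfolding PInf by (intro lp_spaceI[of _ _ _ "\<bar>c\<bar> * a"] lp_norm_le_infinity) auto
  qed (use p in auto)
qed

lemma (in prob_space) lp_space_sum:
  assumes p: "1 \<le> p" and f: "\<And>i. i \<in> I \<Longrightarrow> f i \<in> lp_space p M"
  shows "(\<lambda>x. \<Sum>i\<in>I. f i x) \<in> lp_space p M"
  using f
proof (induction I rule: infinite_finite_induct)
  case (insert i I)
  then show ?case using lp_space_add[OF p, of "f i" M "\<lambda>x. \<Sum>i\<in>I. f i x"] by simp
qed (auto intro!: lp_spaceI[of _ _ _ 0] lp_space_bounded[OF _ p])

section \<open>Norming functions and membership by duality\<close>

lemma lp_norm_real_eq:
  assumes P: "P > 0" and N: "lp_norm (ereal P) M f = ennreal N" "N \<ge> 0"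
  shows "(\<integral>\<^sup>+x. ennreal (\<bar>f x\<bar> powr P) \<partial>M) = ennreal (N powr P)"
proof -
  let ?I = "\<integral>\<^sup>+x. ennreal (\<bar>f x\<bar> powr P) \<partial>M"
  have fin: "?I \<noteq> \<infinity>" using N by (auto simp: lp_norm_real Let_def)
  then have "enn2real ?I powr (1 / P) = N" using N by (simp add: lp_norm_real Let_def)
  then have "(enn2real ?I powr (1 / P)) powr P = N powr P" by simp
  then have "enn2real ?I = N powr P" using P by (simp add: powr_powr)
  moreover have "ennreal (enn2real ?I) = ?I" using fin by (intro ennreal_enn2real) (simp add: less_top)
  ultimately show ?thesis by simp
qed

text \<open>Explicit near-extremal functions. For finite \<open>q\<close> the pairing reaches the
  norm; for \<open>q = \<infinity>\<close> it may only approach it, which is why the statement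
  concerns a number \<open>c\<close> below the norm.\<close>

theorem (in prob_space) lp_dual_attained:
  assumes conj: "1 \<le> p" "1 \<le> q" "1 / p + 1 / q = (1::ereal)"
    and b: "b \<in> lp_space q M" and c: "c < lp_norm q M b"
  obtains g where "g \<in> lp_space p M" "lp_norm p M g \<le> 1" "c \<le> ennreal (\<integral>x. b x * g x \<partial>M)"
proof -
  obtain N where N: "b \<in> borel_measurable M" "N \<ge> 0" "lp_norm q M b = ennreal N" using b by (rule lp_spaceE)
  note [measurable] = N(1)
  have N0: "N > 0" using c N by (cases "N = 0") auto
  have main: thesis if g: "g \<in> borel_measurable M" "lp_norm p M g \<le> 1"
    and le: "integrable M (\<lambda>x. b x * g x) \<Longrightarrow> c \<le> ennreal (\<integral>x. b x * g x \<partial>M)" for g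
  proof -
    have gl: "g \<in> lp_space p M" using g by (intro lp_spaceI[of _ _ _ 1]) auto
    have "integrable M (\<lambda>x. g x * b x)" by (rule lp_space_integrable_mult[OF conj gl b])
    then show thesis using gl g le by (intro \<open>\<And>g. _ \<Longrightarrow> _ \<Longrightarrow> _ \<Longrightarrow> thesis\<close>) (simp_all add: mult.commute)
  qed
  show thesis
    using conj
  proof (cases rule: conjugate_exponents_cases)
    case 1
    obtain c' where c': "c = ennreal c'" "c' \<ge> 0" using c N by (cases c) auto
    define A where "A = {x \<in> space M. c' < \<bar>b x\<bar>}"
    have [measurable]: "A \<in> sets M" unfolding A_def by measurable
    have A0: "prob A > 0"
    proof (rule ccontr)
      assume "\<not> prob A > 0"
      then have "prob A = 0" by (simp add: zero_less_measure_iff)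
      then have "AE x in M. x \<notin> A" by (subst AE_iff_null_sets[symmetric]) (auto simp: null_sets_def emeasure_eq_measure)
      then have "AE x in M. \<bar>b x\<bar> \<le> c'" using AE_space by eventually_elim (auto simp: A_def)
      then have "lp_norm \<infinity> M b \<le> ennreal c'" by (intro lp_norm_le_infinity N(1))
      then show False using c 1 c' by simp
    qed
    \<comment> \<open>Unit mass spread over \<open>A\<close>, which has positive probability since
      \<open>c'\<close> lies below the essential supremum. The pairing is the average over
      \<open>A\<close> of the absolute value of \<open>b\<close>, so it is at least
      \<open>c'\<close>.\<close>
    define g where "g x = sgn (b x) * indicator A x / prob A" for x
    have g1: "\<bar>g x\<bar> = indicator A x / prob A" for x
      using c'(2) by (auto simp: g_def A_def abs_mult abs_sgn_eq indicator_def)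
    show thesis
    proof (rule main)
      show "g \<in> borel_measurable M" unfolding g_def by measurable
      then have "lp_norm 1 M g = (\<integral>\<^sup>+x. ennreal (1 / prob A) * indicator A x \<partial>M)"
        by (subst lp_norm_1) (auto simp: g1 indicator_def intro!: nn_integral_cong)
      also have "\<dots> = ennreal (1 / prob A) * emeasure M A" by (rule nn_integral_cmult_indicator) simp
      also have "\<dots> = 1" using A0 by (simp add: emeasure_eq_measure ennreal_mult[symmetric])
      finally show "lp_norm p M g \<le> 1" using 1 by simp
      assume int: "integrable M (\<lambda>x. b x * g x)"
      have "c' = (\<integral>x. c' / prob A * indicator A x \<partial>M)" using A0 by simp
      also have "\<dots> \<le> (\<integral>x. b x * g x \<partial>M)"
      proof (intro integral_mono int)
        show "integrable M (\<lambda>x. c' / prob A * indicator A x)"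
          by (intro integrable_mult_right integrable_real_indicator) (auto simp: emeasure_eq_measure)
        fix x
        have "b x * g x = \<bar>b x\<bar> * (indicator A x / prob A)"
          by (simp add: g_def mult.assoc[symmetric] abs_sgn)
        then show "c' / prob A * indicator A x \<le> b x * g x"
          using A0 by (auto simp: indicator_def A_def divide_right_mono)
      qed
      finally show "c \<le> ennreal (\<integral>x. b x * g x \<partial>M)" by (simp add: c' ennreal_leI)
    qed
  next
    case 2
    show thesis
    proof (rule main[of "\<lambda>x. sgn (b x)"])
      have "lp_norm p M (\<lambda>x. sgn (b x)) \<le> ennreal 1"
        unfolding \<open>p = \<infinity>\<close> by (rule lp_norm_le_infinity) (auto simp: abs_sgn_eq)
      then show "lp_norm p M (\<lambda>x. sgn (b x)) \<le> 1" by simp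
      assume "integrable M (\<lambda>x. b x * sgn (b x))"
      then have "integrable M (\<lambda>x. \<bar>b x\<bar>)" by (simp add: abs_sgn)
      then have "lp_norm q M b = ennreal (\<integral>x. \<bar>b x\<bar> \<partial>M)"
        using 2 by (simp add: lp_norm_1 nn_integral_eq_integral)
      then show "c \<le> ennreal (\<integral>x. b x * sgn (b x) \<partial>M)" using c by (simp add: abs_sgn less_imp_le)
    qed simp
  next
    case (3 P Q)
    have Q1: "(Q - 1) * P = Q" using 3 by (simp add: field_simps)
    have I: "(\<integral>\<^sup>+x. ennreal (\<bar>b x\<bar> powr Q) \<partial>M) = ennreal (N powr Q)"
      using N 3 by (intro lp_norm_real_eq) auto
    \<comment> \<open>The equality case of Hoelder's inequality: because
      \<open>(Q - 1) * P = Q\<close>, the power \<open>P\<close> of \<open>g\<close> is the power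
      \<open>Q\<close> of \<open>b\<close> divided by \<open>N powr Q\<close>, of integral
      1.\<close>
    define g where "g x = sgn (b x) * (\<bar>b x\<bar> powr (Q - 1) / N powr (Q - 1))" for x
    have ga: "\<bar>g x\<bar> powr P = \<bar>b x\<bar> powr Q * (1 / N powr Q)" for x
      using 3 by (cases "b x = 0") (simp_all add: g_def abs_mult abs_sgn_eq powr_divide powr_powr Q1)
    have bg: "b x * g x = \<bar>b x\<bar> powr Q * (1 / N powr (Q - 1))" for x
    proof -
      have "b x * sgn (b x) = \<bar>b x\<bar>" by (simp add: abs_sgn)
      then have "b x * g x = \<bar>b x\<bar> * \<bar>b x\<bar> powr (Q - 1) / N powr (Q - 1)"
        by (simp add: g_def mult.assoc[symmetric])
      also have "\<bar>b x\<bar> * \<bar>b x\<bar> powr (Q - 1) = \<bar>b x\<bar> powr Q"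
        using powr_mult_base[of "\<bar>b x\<bar>" "Q - 1"] by simp
      finally show ?thesis by simp
    qed
    show thesis
    proof (rule main)
      show "g \<in> borel_measurable M" unfolding g_def by measurable
      have "(\<integral>\<^sup>+x. ennreal (\<bar>g x\<bar> powr P) \<partial>M) = (\<integral>\<^sup>+x. ennreal (\<bar>b x\<bar> powr Q) * ennreal (1 / N powr Q) \<partial>M)"
        unfolding ga by (intro nn_integral_cong ennreal_mult) auto
      also have "\<dots> = ennreal (N powr Q) * ennreal (1 / N powr Q)"
        by (subst nn_integral_multc) (simp_all add: I)
      also have "\<dots> = ennreal (1 powr P)" using N0 by (simp add: ennreal_mult[symmetric])
      finally have "lp_norm (ereal P) M g \<le> ennreal 1" using 3 by (subst lp_norm_real_le_iff) auto
      then show "lp_norm p M g \<le> 1" using 3 by simp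
      assume int: "integrable M (\<lambda>x. b x * g x)"
      have "ennreal (\<integral>x. b x * g x \<partial>M) = (\<integral>\<^sup>+x. ennreal (b x * g x) \<partial>M)"
        using int by (intro nn_integral_eq_integral[symmetric]) (auto simp: bg)
      also have "\<dots> = (\<integral>\<^sup>+x. ennreal (\<bar>b x\<bar> powr Q) * ennreal (1 / N powr (Q - 1)) \<partial>M)"
        unfolding bg by (intro nn_integral_cong ennreal_mult) auto
      also have "\<dots> = ennreal (N powr Q) * ennreal (1 / N powr (Q - 1))"
        by (subst nn_integral_multc) (simp_all add: I)
      also have "\<dots> = ennreal (N powr Q / N powr (Q - 1))"
        by (simp add: ennreal_mult[symmetric])
      also have "N powr Q / N powr (Q - 1) = N" using N0 by (simp add: powr_diff[symmetric])
      finally show "c \<le> ennreal (\<integral>x. b x * g x \<partial>M)" using c N by (simp add: less_imp_le)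
    qed
  qed
qed

text \<open>
  Duality applies to the truncations of \<open>h\<close>, which are bounded and hence in \<open>L\<^sub>q\<close>; monotone
  convergence then passes to \<open>h\<close>.
\<close>

theorem (in prob_space) lp_space_by_duality:
  assumes conj: "1 \<le> p" "1 \<le> q" "1 / p + 1 / q = (1::ereal)"
    and h [measurable]: "h \<in> borel_measurable M" and h0: "\<And>x. x \<in> space M \<Longrightarrow> 0 \<le> h x" and C: "C \<ge> 0"
    and bound: "\<And>g. g \<in> lp_space p M \<Longrightarrow> lp_norm p M g \<le> 1 \<Longrightarrow> (\<integral>\<^sup>+x. ennreal (h x * \<bar>g x\<bar>) \<partial>M) \<le> ennreal C"
  shows "h \<in> lp_space q M"
proof -
  define hn where "hn n x = min (h x) (real n)" for n x
  have [measurable]: "hn n \<in> borel_measurable M" for n unfolding hn_def by measurable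
  have hn: "0 \<le> hn n x" "hn n x \<le> h x" "hn n x \<le> real n" if "x \<in> space M" for n x
    using h0[OF that] by (auto simp: hn_def)
  have hnl: "hn n \<in> lp_space q M" for n
    using hn by (intro lp_spaceI[of _ _ _ "real n"] lp_space_bounded conj) auto
  have le: "lp_norm q M (hn n) \<le> ennreal C" for n
  proof (rule ccontr)
    assume "\<not> ?thesis"
    then have "ennreal C < lp_norm q M (hn n)" by simp
    then obtain c where c: "ennreal C < c" "c < lp_norm q M (hn n)" using dense by blast
    obtain g where g: "g \<in> lp_space p M" "lp_norm p M g \<le> 1" "c \<le> ennreal (\<integral>x. hn n x * g x \<partial>M)"
      using lp_dual_attained[OF conj hnl c(2)] by blast
    note g(3)
    also have "ennreal (\<integral>x. hn n x * g x \<partial>M) \<le> (\<integral>\<^sup>+x. ennreal (hn n x * \<bar>g x\<bar>) \<partial>M)"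
    proof -
      have int: "integrable M (\<lambda>x. hn n x * g x)"
        using lp_space_integrable_mult[OF conj g(1) hnl[of n]] by (simp add: mult.commute)
      then have "integrable M (\<lambda>x. \<bar>hn n x * g x\<bar>)" by simp
      then have "ennreal (\<integral>x. \<bar>hn n x * g x\<bar> \<partial>M) = (\<integral>\<^sup>+x. ennreal \<bar>hn n x * g x\<bar> \<partial>M)"
        by (intro nn_integral_eq_integral[symmetric]) auto
      also have "\<dots> = (\<integral>\<^sup>+x. ennreal (hn n x * \<bar>g x\<bar>) \<partial>M)"
        using hn(1) by (intro nn_integral_cong) (simp add: abs_mult)
      finally have "(\<integral>\<^sup>+x. ennreal (hn n x * \<bar>g x\<bar>) \<partial>M) = ennreal (\<integral>x. \<bar>hn n x * g x\<bar> \<partial>M)" ..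
      moreover have "(\<integral>x. hn n x * g x \<partial>M) \<le> (\<integral>x. \<bar>hn n x * g x\<bar> \<partial>M)"
        by (rule order.trans[OF abs_ge_self integral_abs_bound])
      ultimately show ?thesis by (simp only: ennreal_leI)
    qed
    also have "\<dots> \<le> (\<integral>\<^sup>+x. ennreal (h x * \<bar>g x\<bar>) \<partial>M)"
      using hn(2) by (intro nn_integral_mono ennreal_leI mult_right_mono) auto
    also have "\<dots> \<le> ennreal C" by (rule bound[OF g(1,2)])
    finally show False using c(1) by simp
  qed
  show ?thesis
  proof (cases q)
    case (real Q)
    then have Q: "Q \<ge> 1" using conj by simp
    have "(\<integral>\<^sup>+x. ennreal (\<bar>h x\<bar> powr Q) \<partial>M) \<le> (\<integral>\<^sup>+x. (SUP n. ennreal (\<bar>hn n x\<bar> powr Q)) \<partial>M)"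
    proof (rule nn_integral_mono)
      fix x
      obtain n :: nat where "h x \<le> real n" using real_arch_simple by blast
      then have "hn n x = h x" by (simp add: hn_def)
      then show "ennreal (\<bar>h x\<bar> powr Q) \<le> (SUP n. ennreal (\<bar>hn n x\<bar> powr Q))"
        by (intro SUP_upper2[of n]) auto
    qed
    \<comment> \<open>The indicator confines the monotonicity of the truncations to the space, where
      \<open>h\<close> is known to be nonnegative.\<close>
    also have "\<dots> = (\<integral>\<^sup>+x. (SUP n. ennreal (\<bar>hn n x\<bar> powr Q) * indicator (space M) x) \<partial>M)"
      by (intro nn_integral_cong) simp
    also have "\<dots> = (SUP n. \<integral>\<^sup>+x. ennreal (\<bar>hn n x\<bar> powr Q) * indicator (space M) x \<partial>M)"
    proof (rule nn_integral_monotone_convergence_SUP)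
      show "incseq (\<lambda>n x. ennreal (\<bar>hn n x\<bar> powr Q) * indicator (space M) x)"
        using h0 Q by (auto simp: incseq_def le_fun_def hn_def indicator_def intro!: ennreal_leI powr_mono2)
    qed simp
    also have "\<dots> \<le> ennreal (C powr Q)"
    proof (rule SUP_least)
      fix n
      have "(\<integral>\<^sup>+x. ennreal (\<bar>hn n x\<bar> powr Q) \<partial>M) \<le> ennreal (C powr Q)"
        using le[of n] Q C real by (subst (asm) real, subst (asm) lp_norm_real_le_iff) auto
      then show "(\<integral>\<^sup>+x. ennreal (\<bar>hn n x\<bar> powr Q) * indicator (space M) x \<partial>M) \<le> ennreal (C powr Q)"
        by (simp cong: nn_integral_cong)
    qed
    finally show ?thesis
      using Q C real by (intro lp_spaceI[of _ _ _ C]) (auto simp: lp_norm_real_le_iff)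
  next
    case PInf
    have "AE x in M. \<bar>hn n x\<bar> \<le> C" for n
    proof -
      have "AE x in M. ennreal \<bar>hn n x\<bar> \<le> ennreal C"
        using AE_le_lp_norm_infinity[where M=M and f="hn n"] le[of n] PInf by (auto elim!: eventually_mono intro: order.trans)
      then show ?thesis using C by simp
    qed
    then have "AE x in M. \<forall>n. \<bar>hn n x\<bar> \<le> C" by (simp add: AE_all_countable)
    then have "AE x in M. \<bar>h x\<bar> \<le> C"
    proof eventually_elim
      case (elim x)
      obtain n :: nat where "h x \<le> real n" using real_arch_simple by blast
      then have "hn n x = h x" by (simp add: hn_def)
      then show ?case using elim by metis
    qed
    then show ?thesis unfolding PInf by (intro lp_spaceI[of _ _ _ C] lp_norm_le_infinity) auto
  qed (use conj in auto)
qed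

subsection \<open>Zonal kernels acting on \<open>L\<^sub>p\<close>\<close>

lemma continuous_on_integral_dominated:
  fixes F :: "'b::metric_space \<Rightarrow> 'c \<Rightarrow> real"
  assumes cont: "\<And>y. y \<in> space M \<Longrightarrow> continuous_on S (\<lambda>x. F x y)"
    and meas: "\<And>x. x \<in> S \<Longrightarrow> F x \<in> borel_measurable M"
    and w: "integrable M w" and bound: "\<And>x y. x \<in> S \<Longrightarrow> y \<in> space M \<Longrightarrow> \<bar>F x y\<bar> \<le> w y"
  shows "continuous_on S (\<lambda>x. \<integral>y. F x y \<partial>M)"
  unfolding continuous_on_sequentially
proof (intro allI ballI impI, elim conjE)
  fix X a assume a: "a \<in> S" and X: "\<forall>n. X n \<in> S" "X \<longlonglongrightarrow> a"
  have "(\<lambda>n. \<integral>y. F (X n) y \<partial>M) \<longlonglongrightarrow> (\<integral>y. F a y \<partial>M)"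
  proof (rule integral_dominated_convergence[where w=w])
    show "AE y in M. (\<lambda>n. F (X n) y) \<longlonglongrightarrow> F a y"
    proof (rule AE_I2)
      fix y assume "y \<in> space M"
      from cont[OF this] a X have "((\<lambda>x. F x y) \<circ> X) \<longlonglongrightarrow> F a y"
        unfolding continuous_on_sequentially by blast
      then show "(\<lambda>n. F (X n) y) \<longlonglongrightarrow> F a y" by (simp add: o_def)
    qed
  qed (use a X meas w bound in auto)
  then show "((\<lambda>x. \<integral>y. F x y \<partial>M) \<circ> X) \<longlonglongrightarrow> (\<integral>y. F a y \<partial>M)" by (simp add: o_def)
qed

text \<open>The maximum is at \<open>t = 1\<close>, where the kernel is
  \<open>(1 + r) / (1 - r) ^ (DIM('a) - 1)\<close>.\<close>

lemma poisson_le: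
  assumes r: "0 \<le> r" "r < 1" and t: "\<bar>t\<bar> \<le> 1"
  shows "poisson TYPE('a::euclidean_space) r t \<le> 2 / (1 - r) ^ (DIM('a) - 1)"
proof -
  have "r * t \<le> r * 1" using t r by (intro mult_left_mono) auto
  then have le: "(1 - r)\<^sup>2 \<le> 1 - 2 * r * t + r\<^sup>2" by (simp add: power2_eq_square algebra_simps)
  have "(1 - 2 * r * t + r\<^sup>2) powr (- (real DIM('a) / 2)) \<le> ((1 - r)\<^sup>2) powr (- (real DIM('a) / 2))"
    using r le by (intro powr_mono2') auto
  also have "((1 - r)\<^sup>2) powr (- (real DIM('a) / 2)) = 1 / (1 - r) ^ DIM('a)"
  proof -
    have "(1 - r)\<^sup>2 = (1 - r) powr 2" using r by simp
    then have "((1 - r)\<^sup>2) powr (- (real DIM('a) / 2)) = (1 - r) powr (- real DIM('a))"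
      by (simp add: powr_powr)
    moreover have "(1 - r) powr real DIM('a) = (1 - r) ^ DIM('a)" using r by (intro powr_realpow) simp
    ultimately show ?thesis by (simp only: powr_minus_divide)
  qed
  finally have "poisson TYPE('a) r t \<le> (1 - r\<^sup>2) * (1 / (1 - r) ^ DIM('a))"
    unfolding poisson_def poisson_kernel_def using r by (intro mult_left_mono) (auto simp: abs_square_le_1)
  also have "\<dots> \<le> (2 * (1 - r)) * (1 / (1 - r) ^ DIM('a))"
  proof (intro mult_right_mono)
    have "(1 + r) * (1 - r) \<le> 2 * (1 - r)" using r by (intro mult_right_mono) auto
    then show "1 - r\<^sup>2 \<le> 2 * (1 - r)" by (simp add: power2_eq_square algebra_simps)
  qed (use r in auto)
  also have "\<dots> = 2 / (1 - r) ^ (DIM('a) - 1)"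
  proof -
    have pw: "(1 - r) ^ DIM('a) = (1 - r) * (1 - r) ^ (DIM('a) - 1)"
      using DIM_positive[where 'a='a] by (simp flip: power_Suc)
    have "2 * a * (1 / (a * b)) = 2 / b" if "a \<noteq> 0" for a b :: real using that by simp
    moreover have "1 - r \<noteq> 0" using r by simp
    ultimately show ?thesis unfolding pw by blast
  qed
  finally show ?thesis .
qed

lemma poisson_measurable [measurable]: "poisson T r \<in> borel_measurable borel"
  unfolding poisson_def poisson_kernel_def by measurable

text \<open>Interpolation between total mass 1 and the supremum bound \<open>S\<close>: the integral
  of the power \<open>Q\<close> is at most \<open>S powr (Q - 1)\<close>, whose root of order
  \<open>Q\<close> is \<open>S powr (1 / P)\<close>.\<close>

lemma poisson_lp_norm:
  fixes x :: "'a::euclidean_space"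
  assumes dim: "2 \<le> DIM('a)" and conj: "1 \<le> p" "1 \<le> q" "1 / p + 1 / q = (1::ereal)"
    and x: "x \<in> unit_sphere" and r: "0 \<le> r" "r < 1"
  shows "lp_norm q sphere_measure (\<lambda>y. poisson TYPE('a) r (x \<bullet> y))
    \<le> ennreal ((2 / (1 - r) ^ (DIM('a) - 1)) powr real_of_ereal (1 / p))"
proof -
  let ?P = "\<lambda>y. poisson TYPE('a) r (x \<bullet> y)"
  define S where "S = 2 / (1 - r) ^ (DIM('a) - 1)"
  have S: "S > 0" using r by (simp add: S_def)
  have P0: "0 \<le> ?P y" for y by (rule poisson_nonneg[OF r])
  have PS: "?P y \<le> S" if "y \<in> unit_sphere" for y
    unfolding S_def by (intro poisson_le r inner_sphere_le x that)
  have m: "?P \<in> borel_measurable sphere_measure" by measurable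
  have int: "integrable sphere_measure ?P"
    by (intro continuous_on_sphere_integrable continuous_on_poisson_inner x r)
  have I: "(\<integral>\<^sup>+y. ennreal (?P y) \<partial>sphere_measure) = 1"
    using nn_integral_eq_integral[OF int] P0 integral_poisson[OF dim x r] by simp
  have "lp_norm q sphere_measure ?P \<le> ennreal (S powr real_of_ereal (1 / p))"
    using conj
  proof (cases rule: conjugate_exponents_cases)
    case 1
    have "lp_norm \<infinity> sphere_measure ?P \<le> ennreal S"
      using PS P0 by (intro lp_norm_le_infinity m AE_I2) auto
    then show ?thesis using 1 S by (simp add: one_ereal_def)
  next
    case 2
    then show ?thesis using I P0 S by (simp add: lp_norm_1[OF m])
  next
    case (3 P Q)
    have th: "real_of_ereal (1 / p) = 1 / P" using 3 by (simp add: one_ereal_def)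
    have e: "Q / P = Q - 1" using 3 by (simp add: field_simps)
    have "(\<integral>\<^sup>+y. ennreal (\<bar>?P y\<bar> powr Q) \<partial>sphere_measure) \<le> (\<integral>\<^sup>+y. ennreal (S powr (Q - 1)) * ennreal (?P y) \<partial>sphere_measure)"
    proof (rule nn_integral_mono)
      fix y :: 'a assume "y \<in> space sphere_measure"
      then have y: "y \<in> unit_sphere" by simp
      have "\<bar>?P y\<bar> powr Q = ?P y * ?P y powr (Q - 1)"
        using powr_mult_base[OF P0[of y], of "Q - 1"] P0[of y] by simp
      also have "\<dots> \<le> ?P y * S powr (Q - 1)"
        using PS[OF y] P0[of y] 3 by (intro mult_left_mono powr_mono2) auto
      finally have "ennreal (\<bar>?P y\<bar> powr Q) \<le> ennreal (S powr (Q - 1) * ?P y)"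
        by (intro ennreal_leI) (simp only: mult.commute)
      then show "ennreal (\<bar>?P y\<bar> powr Q) \<le> ennreal (S powr (Q - 1)) * ennreal (?P y)"
        using P0[of y] by (simp only: ennreal_mult powr_ge_zero)
    qed
    also have "\<dots> = ennreal ((S powr (1 / P)) powr Q)"
      using m by (subst nn_integral_cmult) (auto simp: I powr_powr e)
    finally show ?thesis unfolding th \<open>q = ereal Q\<close> using 3 by (subst lp_norm_real_le_iff) auto
  qed
  then show ?thesis by (simp only: S_def)
qed

text \<open>The facts about a kernel on which the error formula rests: sections in
  \<open>L_q\<close>, diagonal action on harmonics with factors \<open>m l\<close>, and convolution
  taking \<open>L_p\<close> to continuous functions. They survive linear combinations, so the Bessel
  kernel can be assembled from simpler kernels.\<close>

definition zonal_multiplier ::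
  "'a::euclidean_space itself \<Rightarrow> ereal \<Rightarrow> ereal \<Rightarrow> (nat \<Rightarrow> real) \<Rightarrow> (real \<Rightarrow> real) \<Rightarrow> bool" where
  "zonal_multiplier T p q m h \<longleftrightarrow> h \<in> borel_measurable borel \<and>
    (\<forall>x\<in>(unit_sphere :: 'a set). (\<lambda>y. h (x \<bullet> y)) \<in> lp_space q sphere_measure \<and>
      (\<forall>z\<in>unit_sphere. \<forall>l. (\<integral>y. poly (zonal_harmonic T l) (z \<bullet> y) * h (x \<bullet> y) \<partial>sphere_measure)
         = m l * poly (zonal_harmonic T l) (x \<bullet> z))) \<and>
    (\<forall>g\<in>lp_space p (sphere_measure :: 'a measure).
       continuous_on unit_sphere (\<lambda>x. \<integral>y. h (x \<bullet> y) * g y \<partial>sphere_measure))"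

lemma poly_zonal_lp_space:
  fixes z :: "'a::euclidean_space"
  assumes "1 \<le> p"
  shows "(\<lambda>y. poly Q (z \<bullet> y)) \<in> lp_space p sphere_measure"
proof -
  have c: "continuous_on unit_sphere (\<lambda>y. poly Q (z \<bullet> y))" by (rule continuous_on_poly_inner)
  obtain C where "C > 0" "\<And>y. y \<in> unit_sphere \<Longrightarrow> \<bar>poly Q (z \<bullet> y)\<bar> \<le> C"
    using continuous_on_sphere_bounded[OF c] by metis
  then show ?thesis
    by (intro lp_spaceI[of _ _ _ C] sphere.lp_space_bounded assms continuous_on_sphere_measurable c) auto
qed

lemma zonal_multiplier_add:
  assumes conj: "1 \<le> p" "1 \<le> q" "1 / p + 1 / q = (1::ereal)"
    and h: "zonal_multiplier TYPE('a::euclidean_space) p q m h" and k: "zonal_multiplier TYPE('a) p q m' k"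
  shows "zonal_multiplier TYPE('a) p q (\<lambda>l. m l + c * m' l) (\<lambda>t. h t + c * k t)"
  unfolding zonal_multiplier_def
proof (intro conjI ballI allI)
  have [measurable]: "h \<in> borel_measurable borel" "k \<in> borel_measurable borel"
    using h k by (auto simp: zonal_multiplier_def)
  show "(\<lambda>t. h t + c * k t) \<in> borel_measurable borel" by measurable
  fix x :: 'a assume x: "x \<in> unit_sphere"
  have lp: "(\<lambda>y. h (x \<bullet> y)) \<in> lp_space q sphere_measure" "(\<lambda>y. k (x \<bullet> y)) \<in> lp_space q sphere_measure"
    using h k x by (auto simp: zonal_multiplier_def)
  show "(\<lambda>y. h (x \<bullet> y) + c * k (x \<bullet> y)) \<in> lp_space q sphere_measure"
    by (intro lp_space_add lp_space_cmult conj lp)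
  fix z :: 'a and l assume z: "z \<in> unit_sphere"
  let ?Z = "\<lambda>y. poly (zonal_harmonic TYPE('a) l) (z \<bullet> y)"
  have i: "integrable sphere_measure (\<lambda>y. ?Z y * h (x \<bullet> y))" "integrable sphere_measure (\<lambda>y. ?Z y * k (x \<bullet> y))"
    by (intro sphere.lp_space_integrable_mult[OF conj] poly_zonal_lp_space conj lp)+
  have "(\<integral>y. ?Z y * (h (x \<bullet> y) + c * k (x \<bullet> y)) \<partial>sphere_measure)
    = (\<integral>y. ?Z y * h (x \<bullet> y) + c * (?Z y * k (x \<bullet> y)) \<partial>sphere_measure)"
    by (simp add: algebra_simps)
  also have "\<dots> = (\<integral>y. ?Z y * h (x \<bullet> y) \<partial>sphere_measure) + c * (\<integral>y. ?Z y * k (x \<bullet> y) \<partial>sphere_measure)"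
    using i by simp
  finally show "(\<integral>y. ?Z y * (h (x \<bullet> y) + c * k (x \<bullet> y)) \<partial>sphere_measure)
    = (m l + c * m' l) * poly (zonal_harmonic TYPE('a) l) (x \<bullet> z)"
    using h k x z by (simp add: zonal_multiplier_def algebra_simps)
next
  fix g :: "'a \<Rightarrow> real" assume g: "g \<in> lp_space p sphere_measure"
  have "continuous_on unit_sphere (\<lambda>x. (\<integral>y. h (x \<bullet> y) * g y \<partial>sphere_measure) + c * (\<integral>y. k (x \<bullet> y) * g y \<partial>sphere_measure))"
    using h k g by (intro continuous_intros) (auto simp: zonal_multiplier_def)
  moreover have "(\<integral>y. (h (x \<bullet> y) + c * k (x \<bullet> y)) * g y \<partial>sphere_measure)
      = (\<integral>y. h (x \<bullet> y) * g y \<partial>sphere_measure) + c * (\<integral>y. k (x \<bullet> y) * g y \<partial>sphere_measure)"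
    if x: "x \<in> unit_sphere" for x
  proof -
    have "integrable sphere_measure (\<lambda>y. g y * h (x \<bullet> y))" "integrable sphere_measure (\<lambda>y. g y * k (x \<bullet> y))"
      using h k x by (auto simp: zonal_multiplier_def intro!: sphere.lp_space_integrable_mult[OF conj g])
    then have "(\<integral>y. h (x \<bullet> y) * g y + c * (k (x \<bullet> y) * g y) \<partial>sphere_measure)
      = (\<integral>y. h (x \<bullet> y) * g y \<partial>sphere_measure) + c * (\<integral>y. k (x \<bullet> y) * g y \<partial>sphere_measure)"
      by (simp add: mult.commute)
    then show ?thesis by (simp add: algebra_simps)
  qed
  ultimately show "continuous_on unit_sphere (\<lambda>x. \<integral>y. (h (x \<bullet> y) + c * k (x \<bullet> y)) * g y \<partial>sphere_measure)"
    by (subst continuous_on_cong[OF refl]) auto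
qed

subsection \<open>Subordination to the Poisson kernel\<close>

definition gamma_density :: "real \<Rightarrow> real \<Rightarrow> real" where
  "gamma_density s t = (if t > 0 then t powr (s - 1) * exp (- t) / Gamma s else 0)"

lemma gamma_density_measurable [measurable]: "gamma_density s \<in> borel_measurable borel"
  unfolding gamma_density_def by measurable

lemma gamma_density_nonneg: "s > 0 \<Longrightarrow> 0 \<le> gamma_density s t"
  unfolding gamma_density_def by simp

lemma nn_integral_gamma_powr:
  assumes "s > 0"
  shows "(\<integral>\<^sup>+t. ennreal (if t > 0 then t powr (s - 1) * exp (- t) else 0) \<partial>lborel) = ennreal (Gamma s)"
proof -
  have "(\<integral>\<^sup>+t. ennreal (if t > 0 then t powr (s - 1) * exp (- t) else 0) \<partial>lborel)
    = (\<integral>\<^sup>+t. ennreal (indicator {0..} t * t powr (s - 1) / exp t) \<partial>lborel)"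
    by (intro nn_integral_cong) (auto simp: indicator_def exp_minus divide_inverse)
  then show ?thesis using Gamma_conv_nn_integral_real[OF assms] by simp
qed

text \<open>The Laplace transform of the gamma density, by the scaling \<open>(c + 1) * t\<close>.
  At \<open>c = l\<close> it averages the factor \<open>r^l\<close> of the Poisson kernel of radius
  \<open>r = exp (- t)\<close> to \<open>(l + 1)^(-s)\<close>.\<close>

lemma integral_gamma_density_exp:
  assumes s: "s > 0" and c: "c \<ge> (0::real)"
  shows "(\<integral>t. gamma_density s t * exp (- t) powr c \<partial>lborel) = (c + 1) powr (- s)"
proof -
  let ?f = "\<lambda>t::real. if t > 0 then t powr (s - 1) * exp (- t) else 0"
  have f: "(\<integral>t. ?f t \<partial>lborel) = Gamma s"
    using nn_integral_gamma_powr[OF s] Gamma_real_pos[OF s]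
    by (intro integral_eq_nn_integral[THEN trans]) auto
  have "(\<integral>t. ?f t \<partial>lborel) = (c + 1) * (\<integral>t. ?f ((c + 1) * t) \<partial>lborel)"
    using lborel_integral_real_affine[of "c + 1" ?f 0] c unfolding add_0_left by simp
  also have "(\<lambda>t. ?f ((c + 1) * t)) = (\<lambda>t. ((c + 1) powr (s - 1) * Gamma s) * (gamma_density s t * exp (- t) powr c))"
  proof
    fix t
    have "exp (- ((c + 1) * t)) = exp (- t) * exp (- t) powr c"
      by (simp add: powr_def exp_add[symmetric] algebra_simps)
    then show "?f ((c + 1) * t) = ((c + 1) powr (s - 1) * Gamma s) * (gamma_density s t * exp (- t) powr c)"
      using c Gamma_real_pos[OF s] by (auto simp: gamma_density_def powr_mult zero_less_mult_iff)
  qed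
  also have "(c + 1) * (\<integral>t. ((c + 1) powr (s - 1) * Gamma s) * (gamma_density s t * exp (- t) powr c) \<partial>lborel)
    = Gamma s * ((c + 1) * (c + 1) powr (s - 1)) * (\<integral>t. gamma_density s t * exp (- t) powr c \<partial>lborel)"
    by simp
  also have "(c + 1) * (c + 1) powr (s - 1) = (c + 1) powr s"
    using powr_mult_base[of "c + 1" "s - 1"] c by simp
  finally have "Gamma s * ((c + 1) powr s * (\<integral>t. gamma_density s t * exp (- t) powr c \<partial>lborel)) = Gamma s * 1"
    using f by (simp add: mult_ac)
  then have "(c + 1) powr s * (\<integral>t. gamma_density s t * exp (- t) powr c \<partial>lborel) = 1"
    using Gamma_real_pos[OF s] by simp
  then show ?thesis using c by (simp add: powr_minus field_simps)
qed

text \<open>\<open>L\<^sub>q\<close> norms of the Poisson kernels of radius \<open>exp (- t)\<close> blow up like \<open>t\<^bsup>-d/p\<^esup>\<close>, which the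
  gamma density of order \<open>s > d/p\<close> compensates.\<close>

definition poisson_norm_bound :: "nat \<Rightarrow> real \<Rightarrow> real \<Rightarrow> real" where
  "poisson_norm_bound d th t = (2 / (1 - exp (- t)) ^ d) powr th"

lemma gamma_density_poisson_norm:
  assumes th: "th \<ge> 0" and s: "s > real d * th"
  shows "integrable lborel (\<lambda>t. gamma_density s t * poisson_norm_bound d th t)"
proof -
  define a where "a = real d * th"
  have a: "a \<ge> 0" "s > a" "s > 0" using th s by (auto simp: a_def intro: le_less_trans[of 0 "real d * th"])
  define c where "c = 2 powr th * 2 powr a / Gamma s"
  have c: "c \<ge> 0" unfolding c_def using Gamma_real_pos[of s] a by simp
  \<comment> \<open>Since \<open>1 - exp (- t) \<ge> t / (1 + t)\<close>, the norm bound is of order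
    \<open>t powr (- a)\<close> near 0 and bounded away from 0. The two terms are gamma integrands
    of the positive orders \<open>s\<close> and \<open>s - a\<close>.\<close>
  have pw: "gamma_density s t * poisson_norm_bound d th t
    \<le> c * ((if t > 0 then t powr (s - 1) * exp (- t) else 0) + (if t > 0 then t powr (s - a - 1) * exp (- t) else 0))" for t
  proof (cases "t > 0")
    case True
    have e: "1 - exp (- t) \<ge> t / (1 + t)"
    proof -
      have "exp (- t) = inverse (exp t)" by (rule exp_minus)
      also have "\<dots> \<le> inverse (1 + t)" using True exp_ge_add_one_self[of t] by (intro le_imp_inverse_le) auto
      finally show ?thesis using True by (simp add: field_simps)
    qed
    have e0: "t / (1 + t) > 0" using True by simp
    have "poisson_norm_bound d th t = 2 powr th * (1 - exp (- t)) powr (- a)"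
    proof -
      have pos: "1 - exp (- t) > 0" using True by simp
      have "2 / (1 - exp (- t)) ^ d = 2 * (1 - exp (- t)) powr (- real d)"
        using powr_realpow[OF pos, of d] by (simp add: powr_minus_divide)
      then show ?thesis unfolding poisson_norm_bound_def a_def using pos by (simp add: powr_mult powr_powr)
    qed
    also have "\<dots> \<le> 2 powr th * (t / (1 + t)) powr (- a)"
      using e e0 a by (intro mult_left_mono powr_mono2') auto
    also have "(t / (1 + t)) powr (- a) = ((1 + t) / t) powr a"
      using True by (simp add: powr_minus powr_divide inverse_eq_divide)
    also have "((1 + t) / t) powr a \<le> 2 powr a * (1 + t powr (- a))"
    proof (cases "t \<ge> 1")
      case True
      then have "((1 + t) / t) powr a \<le> 2 powr a" using a by (intro powr_mono2) (auto simp: field_simps)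
      also have "\<dots> \<le> 2 powr a * (1 + t powr (- a))" by (simp add: distrib_left)
      finally show ?thesis .
    next
      case False
      then have "((1 + t) / t) powr a \<le> (2 * (1 / t)) powr a"
        using a \<open>t > 0\<close> by (intro powr_mono2) (auto simp: field_simps)
      also have "\<dots> = 2 powr a * t powr (- a)"
      proof -
        have "(1 / t) powr a = t powr (- a)" using \<open>t > 0\<close> by (simp add: powr_divide powr_minus_divide)
        then show ?thesis using \<open>t > 0\<close> powr_mult[of 2 "1 / t" a] by simp
      qed
      also have "\<dots> \<le> 2 powr a * (1 + t powr (- a))" by (simp add: distrib_left)
      finally show ?thesis .
    qed
    finally have "poisson_norm_bound d th t \<le> 2 powr th * (2 powr a * (1 + t powr (- a)))"
      by (simp add: mult_left_mono)
    then have "gamma_density s t * poisson_norm_bound d th t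
      \<le> gamma_density s t * (2 powr th * (2 powr a * (1 + t powr (- a))))"
      using gamma_density_nonneg[OF a(3)] by (intro mult_left_mono)
    also have "\<dots> = c * (t powr (s - 1) * exp (- t) + (t powr (s - 1) * t powr (- a)) * exp (- t))"
      using True by (simp add: gamma_density_def c_def field_simps)
    also have "t powr (s - 1) * t powr (- a) = t powr (s - a - 1)"
      by (simp add: powr_add[symmetric] algebra_simps)
    finally show ?thesis using True by simp
  next
    case False
    then show ?thesis by (simp add: gamma_density_def)
  qed
  have nn: "0 \<le> gamma_density s t * poisson_norm_bound d th t" for t
    using gamma_density_nonneg[OF a(3), of t] by (simp add: poisson_norm_bound_def)
  have "(\<integral>\<^sup>+t. ennreal (gamma_density s t * poisson_norm_bound d th t) \<partial>lborel)
    \<le> (\<integral>\<^sup>+t. ennreal c * (ennreal (if t > 0 then t powr (s - 1) * exp (- t) else 0) + ennreal (if t > 0 then t powr (s - a - 1) * exp (- t) else 0)) \<partial>lborel)"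
    using pw c by (intro nn_integral_mono) (simp add: ennreal_mult[symmetric] ennreal_plus[symmetric] ennreal_leI del: ennreal_plus)
  also have "\<dots> = ennreal c * (ennreal (Gamma s) + ennreal (Gamma (s - a)))"
    using a nn_integral_gamma_powr[of s] nn_integral_gamma_powr[of "s - a"]
    by (subst nn_integral_cmult, measurable, subst nn_integral_add) auto
  also have "\<dots> < \<infinity>" by (simp add: ennreal_mult_less_top)
  finally show ?thesis
    unfolding poisson_norm_bound_def using nn
    by (intro integrableI_bounded) (auto simp: poisson_norm_bound_def)
qed

text \<open>For \<open>s \<le> DIM('a) - 1\<close> and \<open>DIM('a) \<ge> 2\<close> the integral
  diverges at \<open>t = 1\<close>, where the Bochner integral then takes the value 0; for fixed
  \<open>x\<close> this concerns the single point \<open>y = x\<close> of the sphere.\<close>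

definition riesz_kernel :: "'a::euclidean_space itself \<Rightarrow> real \<Rightarrow> real \<Rightarrow> real" where
  "riesz_kernel T s t = (\<integral>\<tau>. gamma_density s \<tau> * poisson T (exp (- \<tau>)) t \<partial>lborel)"

lemma gamma_poisson_measurable [measurable]:
  "(\<lambda>z. gamma_density s (fst z) * poisson TYPE('a::euclidean_space) (exp (- fst z)) (snd z)) \<in> borel_measurable (borel \<Otimes>\<^sub>M borel)"
  unfolding gamma_density_def poisson_def poisson_kernel_def by measurable

lemma riesz_kernel_measurable [measurable]: "riesz_kernel TYPE('a::euclidean_space) s \<in> borel_measurable borel"
proof -
  have "(\<lambda>z. gamma_density s (snd z) * poisson TYPE('a) (exp (- snd z)) (fst z)) \<in> borel_measurable (borel \<Otimes>\<^sub>M lborel)"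
    unfolding gamma_density_def poisson_def poisson_kernel_def by measurable
  then have "(\<lambda>(t, \<tau>). gamma_density s \<tau> * poisson TYPE('a) (exp (- \<tau>)) t) \<in> borel_measurable (borel \<Otimes>\<^sub>M lborel)"
    by (simp add: split_beta')
  then show ?thesis unfolding riesz_kernel_def[abs_def]
    by (rule sigma_finite_measure.borel_measurable_lebesgue_integral[rotated]) (rule sigma_finite_lborel)
qed

lemma gamma_poisson_nonneg: "s > 0 \<Longrightarrow> 0 \<le> gamma_density s \<tau> * poisson T (exp (- \<tau>)) t"
  by (cases "\<tau> > 0") (auto simp: gamma_density_def intro!: mult_nonneg_nonneg divide_nonneg_nonneg poisson_nonneg)

context
  fixes p q :: ereal and s th :: real
  assumes conj: "1 \<le> p" "1 \<le> q" "1 / p + 1 / q = (1::ereal)"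
    and th: "th = real_of_ereal (1 / p)"
begin

lemma inverse_exponent_nonneg: "th \<ge> 0"
  using conj by (cases rule: conjugate_exponents_cases) (auto simp: th one_ereal_def)

lemma poisson_convolution_bound:
  fixes x :: "'a::euclidean_space"
  assumes dim: "2 \<le> DIM('a)" and x: "x \<in> unit_sphere" and t: "\<tau> > 0"
    and g: "g \<in> borel_measurable sphere_measure" "lp_norm p sphere_measure g \<le> ennreal G" "G \<ge> 0"
  shows "(\<integral>\<^sup>+y. ennreal (poisson TYPE('a) (exp (- \<tau>)) (x \<bullet> y) * \<bar>g y\<bar>) \<partial>sphere_measure)
    \<le> ennreal (G * poisson_norm_bound (DIM('a) - 1) th \<tau>)"
proof -
  have r: "0 \<le> exp (- \<tau>)" "exp (- \<tau>) < 1" using t by auto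
  have "(\<integral>\<^sup>+y. ennreal (poisson TYPE('a) (exp (- \<tau>)) (x \<bullet> y) * \<bar>g y\<bar>) \<partial>sphere_measure)
    = (\<integral>\<^sup>+y. ennreal \<bar>g y * poisson TYPE('a) (exp (- \<tau>)) (x \<bullet> y)\<bar> \<partial>sphere_measure)"
    using poisson_nonneg[OF r, where T="TYPE('a)"] by (intro nn_integral_cong) (simp add: abs_mult)
  also have "\<dots> \<le> ennreal (G * poisson_norm_bound (DIM('a) - 1) th \<tau>)"
    using poisson_lp_norm[OF dim conj x r] g
    by (intro holder_lp[OF conj]) (auto simp: poisson_norm_bound_def th)
  finally show ?thesis .
qed

context
  fixes Ty :: "'a::euclidean_space itself"
  assumes dim: "2 \<le> DIM('a)" and s: "s > real (DIM('a) - 1) * th"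
begin

lemma riesz_order_pos: "s > 0"
  using s inverse_exponent_nonneg by (auto intro: le_less_trans[rotated])

text \<open>The bound that Minkowski's integral inequality predicts for the \<open>L_q\<close> norm
  of the kernel: the average of the norm bounds of the Poisson kernels.\<close>

definition riesz_norm_bound :: real where
  "riesz_norm_bound = (\<integral>\<tau>. gamma_density s \<tau> * poisson_norm_bound (DIM('a) - 1) th \<tau> \<partial>lborel)"

lemma riesz_norm_bound_nonneg: "riesz_norm_bound \<ge> 0"
  unfolding riesz_norm_bound_def using gamma_density_nonneg[OF riesz_order_pos]
  by (intro integral_nonneg_AE AE_I2 mult_nonneg_nonneg) (auto simp: poisson_norm_bound_def)

text \<open>Hoelder's inequality for each radius, then integration over \<open>\<tau>\<close>. The
  estimate serves both the exchange of integrals and the membership of the kernel in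
  \<open>L_q\<close>.\<close>

lemma riesz_joint_bound:
  fixes x :: 'a
  assumes x: "x \<in> unit_sphere"
    and g: "g \<in> borel_measurable sphere_measure" "lp_norm p sphere_measure g \<le> ennreal G" "G \<ge> 0"
  shows "(\<integral>\<^sup>+\<tau>. \<integral>\<^sup>+y. ennreal (gamma_density s \<tau> * poisson TYPE('a) (exp (- \<tau>)) (x \<bullet> y) * \<bar>g y\<bar>) \<partial>sphere_measure \<partial>lborel)
    \<le> ennreal (riesz_norm_bound * G)"
proof -
  have "(\<integral>\<^sup>+\<tau>. \<integral>\<^sup>+y. ennreal (gamma_density s \<tau> * poisson TYPE('a) (exp (- \<tau>)) (x \<bullet> y) * \<bar>g y\<bar>) \<partial>sphere_measure \<partial>lborel)
    \<le> (\<integral>\<^sup>+\<tau>. ennreal (gamma_density s \<tau> * poisson_norm_bound (DIM('a) - 1) th \<tau>) * ennreal G \<partial>lborel)"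
  proof (rule nn_integral_mono)
    fix \<tau> :: real
    show "(\<integral>\<^sup>+y. ennreal (gamma_density s \<tau> * poisson TYPE('a) (exp (- \<tau>)) (x \<bullet> y) * \<bar>g y\<bar>) \<partial>sphere_measure)
      \<le> ennreal (gamma_density s \<tau> * poisson_norm_bound (DIM('a) - 1) th \<tau>) * ennreal G"
    proof (cases "\<tau> > 0")
      case True
      have m: "(\<lambda>y. ennreal (poisson TYPE('a) (exp (- \<tau>)) (x \<bullet> y) * \<bar>g y\<bar>)) \<in> borel_measurable sphere_measure"
        using g(1) by measurable
      have "(\<integral>\<^sup>+y. ennreal (gamma_density s \<tau> * poisson TYPE('a) (exp (- \<tau>)) (x \<bullet> y) * \<bar>g y\<bar>) \<partial>sphere_measure)
        = ennreal (gamma_density s \<tau>) * (\<integral>\<^sup>+y. ennreal (poisson TYPE('a) (exp (- \<tau>)) (x \<bullet> y) * \<bar>g y\<bar>) \<partial>sphere_measure)"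
        using m gamma_density_nonneg[OF riesz_order_pos]
        by (subst nn_integral_cmult[symmetric]) (auto simp: ennreal_mult'[symmetric] mult.assoc)
      also have "\<dots> \<le> ennreal (gamma_density s \<tau>) * ennreal (G * poisson_norm_bound (DIM('a) - 1) th \<tau>)"
        by (intro mult_left_mono poisson_convolution_bound dim x True g) auto
      also have "\<dots> = ennreal (gamma_density s \<tau> * poisson_norm_bound (DIM('a) - 1) th \<tau>) * ennreal G"
        using gamma_density_nonneg[OF riesz_order_pos, of \<tau>] g(3)
        by (simp add: ennreal_mult''[symmetric] ennreal_mult'[symmetric] mult_ac poisson_norm_bound_def)
      finally show ?thesis .
    next
      case False
      then show ?thesis by (simp add: gamma_density_def)
    qed
  qed
  also have "\<dots> = ennreal riesz_norm_bound * ennreal G"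
  proof -
    have int: "integrable lborel (\<lambda>\<tau>. gamma_density s \<tau> * poisson_norm_bound (DIM('a) - 1) th \<tau>)"
      by (rule gamma_density_poisson_norm[OF inverse_exponent_nonneg s])
    then have "(\<integral>\<^sup>+\<tau>. ennreal (gamma_density s \<tau> * poisson_norm_bound (DIM('a) - 1) th \<tau>) \<partial>lborel) = ennreal riesz_norm_bound"
      unfolding riesz_norm_bound_def using gamma_density_nonneg[OF riesz_order_pos]
      by (intro nn_integral_eq_integral) (auto simp: poisson_norm_bound_def)
    then show ?thesis using int by (subst nn_integral_multc) auto
  qed
  finally show ?thesis using riesz_norm_bound_nonneg g(3) by (simp add: ennreal_mult)
qed

lemma riesz_joint_measurable:
  fixes x :: 'a
  assumes g: "g \<in> borel_measurable sphere_measure"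
  shows "(\<lambda>(y, \<tau>). gamma_density s \<tau> * poisson TYPE('a) (exp (- \<tau>)) (x \<bullet> y) * g y) \<in> borel_measurable (sphere_measure \<Otimes>\<^sub>M lborel)"
proof -
  have i: "(\<lambda>y. x \<bullet> y) \<in> borel_measurable sphere_measure" by (rule zonal_measurable(1)[of "\<lambda>t. t"]) simp
  have "(\<lambda>z. (snd z, x \<bullet> fst z)) \<in> measurable (sphere_measure \<Otimes>\<^sub>M lborel) (borel \<Otimes>\<^sub>M borel)"
    using i by (intro measurable_Pair measurable_compose[OF measurable_fst i]) simp_all
  from measurable_compose[OF this gamma_poisson_measurable[of s, where 'a='a]]
  have m1: "(\<lambda>z. gamma_density s (snd z) * poisson TYPE('a) (exp (- snd z)) (x \<bullet> fst z)) \<in> borel_measurable (sphere_measure \<Otimes>\<^sub>M lborel)"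
    by simp
  show ?thesis
    using borel_measurable_times[OF m1 measurable_compose[OF measurable_fst g]] unfolding split_beta' .
qed

lemma riesz_joint_integrable:
  fixes x :: 'a
  assumes x: "x \<in> unit_sphere" and g: "g \<in> lp_space p sphere_measure"
  shows "integrable (sphere_measure \<Otimes>\<^sub>M lborel)
    (\<lambda>(y, \<tau>). gamma_density s \<tau> * poisson TYPE('a) (exp (- \<tau>)) (x \<bullet> y) * g y)"
proof -
  interpret pair_sigma_finite "sphere_measure :: 'a measure" "lborel :: real measure"
    unfolding pair_sigma_finite_def using sphere.sigma_finite_measure_axioms sigma_finite_lborel by blast
  obtain G where G: "g \<in> borel_measurable sphere_measure" "G \<ge> 0" "lp_norm p sphere_measure g = ennreal G"
    using g by (rule lp_spaceE)
  have ag: "(\<lambda>y. \<bar>g y\<bar>) \<in> borel_measurable sphere_measure" using G(1) by simp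
  show ?thesis
  proof (rule integrableI_bounded)
    show "(\<lambda>(y, \<tau>). gamma_density s \<tau> * poisson TYPE('a) (exp (- \<tau>)) (x \<bullet> y) * g y) \<in> borel_measurable (sphere_measure \<Otimes>\<^sub>M lborel)"
      by (rule riesz_joint_measurable[OF G(1)])
    have "(\<integral>\<^sup>+z. ennreal (norm (case z of (y, \<tau>) \<Rightarrow> gamma_density s \<tau> * poisson TYPE('a) (exp (- \<tau>)) (x \<bullet> y) * g y)) \<partial>(sphere_measure \<Otimes>\<^sub>M lborel))
      = (\<integral>\<^sup>+z. (\<lambda>(y, \<tau>). ennreal (gamma_density s \<tau> * poisson TYPE('a) (exp (- \<tau>)) (x \<bullet> y) * \<bar>g y\<bar>)) z \<partial>(sphere_measure \<Otimes>\<^sub>M lborel))"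
      using gamma_poisson_nonneg[OF riesz_order_pos, where T="TYPE('a)"]
      by (intro nn_integral_cong) (auto simp: abs_mult[of "_ * _" "g _"])
    also have "\<dots> = (\<integral>\<^sup>+\<tau>. \<integral>\<^sup>+y. ennreal (gamma_density s \<tau> * poisson TYPE('a) (exp (- \<tau>)) (x \<bullet> y) * \<bar>g y\<bar>) \<partial>sphere_measure \<partial>lborel)"
      using measurable_compose[OF riesz_joint_measurable[OF ag, of x] measurable_ennreal]
      by (subst nn_integral_snd[symmetric]) (auto simp: split_beta')
    also have "\<dots> \<le> ennreal (riesz_norm_bound * G)" using G by (intro riesz_joint_bound x) auto
    also have "\<dots> < \<infinity>" by simp
    finally show "(\<integral>\<^sup>+z. ennreal (norm (case z of (y, \<tau>) \<Rightarrow> gamma_density s \<tau> * poisson TYPE('a) (exp (- \<tau>)) (x \<bullet> y) * g y)) \<partial>(sphere_measure \<Otimes>\<^sub>M lborel)) < \<infinity>" .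
  qed
qed

lemma riesz_convolution:
  fixes x :: 'a
  assumes x: "x \<in> unit_sphere" and g: "g \<in> lp_space p sphere_measure"
  shows "(\<integral>y. riesz_kernel TYPE('a) s (x \<bullet> y) * g y \<partial>sphere_measure)
    = (\<integral>\<tau>. gamma_density s \<tau> * (\<integral>y. poisson TYPE('a) (exp (- \<tau>)) (x \<bullet> y) * g y \<partial>sphere_measure) \<partial>lborel)"
proof -
  interpret pair_sigma_finite "sphere_measure :: 'a measure" "lborel :: real measure"
    unfolding pair_sigma_finite_def using sphere.sigma_finite_measure_axioms sigma_finite_lborel by blast
  have e0: "(\<integral>y. (\<integral>\<tau>. gamma_density s \<tau> * poisson TYPE('a) (exp (- \<tau>)) (x \<bullet> y) * g y \<partial>lborel) \<partial>sphere_measure)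
    = (\<integral>\<tau>. (\<integral>y. gamma_density s \<tau> * poisson TYPE('a) (exp (- \<tau>)) (x \<bullet> y) * g y \<partial>sphere_measure) \<partial>lborel)"
    by (rule Fubini_integral[OF riesz_joint_integrable[OF x g], symmetric])
  have e1: "(\<integral>\<tau>. gamma_density s \<tau> * poisson TYPE('a) (exp (- \<tau>)) (x \<bullet> y) * g y \<partial>lborel)
    = riesz_kernel TYPE('a) s (x \<bullet> y) * g y" for y
    by (simp add: riesz_kernel_def)
  have e2: "(\<integral>y. gamma_density s \<tau> * poisson TYPE('a) (exp (- \<tau>)) (x \<bullet> y) * g y \<partial>sphere_measure)
    = gamma_density s \<tau> * (\<integral>y. poisson TYPE('a) (exp (- \<tau>)) (x \<bullet> y) * g y \<partial>sphere_measure)" for \<tau>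
    by (simp add: mult.assoc)
  show ?thesis using e0 unfolding e1 e2 .
qed

text \<open>By Tonelli, the pairing with any \<open>g\<close> in the unit ball of \<open>L_p\<close>
  is covered by \<open>riesz_joint_bound\<close>, with a constant that does not depend on
  \<open>g\<close>; duality concludes. Where the defining integral diverges, the value 0 keeps the
  pointwise inequality true.\<close>

lemma riesz_kernel_lp:
  fixes x :: 'a
  assumes x: "x \<in> unit_sphere"
  shows "(\<lambda>y. riesz_kernel TYPE('a) s (x \<bullet> y)) \<in> lp_space q sphere_measure"
proof (rule sphere.lp_space_by_duality[OF conj _ _ riesz_norm_bound_nonneg])
  interpret pair_sigma_finite "sphere_measure :: 'a measure" "lborel :: real measure"
    unfolding pair_sigma_finite_def using sphere.sigma_finite_measure_axioms sigma_finite_lborel by blast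
  show "(\<lambda>y. riesz_kernel TYPE('a) s (x \<bullet> y)) \<in> borel_measurable sphere_measure" by measurable
  show "0 \<le> riesz_kernel TYPE('a) s (x \<bullet> y)" for y
    unfolding riesz_kernel_def using gamma_poisson_nonneg[OF riesz_order_pos, where T="TYPE('a)"] by simp
  fix g assume g: "g \<in> lp_space p (sphere_measure :: 'a measure)" "lp_norm p sphere_measure g \<le> 1"
  then have gm: "g \<in> borel_measurable sphere_measure" by (simp add: lp_space_def)
  have ag: "(\<lambda>y. \<bar>g y\<bar>) \<in> borel_measurable sphere_measure" using gm by simp
  have "(\<integral>\<^sup>+y. ennreal (riesz_kernel TYPE('a) s (x \<bullet> y) * \<bar>g y\<bar>) \<partial>sphere_measure)
    \<le> (\<integral>\<^sup>+y. \<integral>\<^sup>+\<tau>. ennreal (gamma_density s \<tau> * poisson TYPE('a) (exp (- \<tau>)) (x \<bullet> y) * \<bar>g y\<bar>) \<partial>lborel \<partial>sphere_measure)"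
  proof (rule nn_integral_mono)
    fix y
    have "riesz_kernel TYPE('a) s (x \<bullet> y) * \<bar>g y\<bar> = (\<integral>\<tau>. gamma_density s \<tau> * poisson TYPE('a) (exp (- \<tau>)) (x \<bullet> y) * \<bar>g y\<bar> \<partial>lborel)"
      by (simp add: riesz_kernel_def)
    also have "ennreal \<dots> \<le> (\<integral>\<^sup>+\<tau>. ennreal (gamma_density s \<tau> * poisson TYPE('a) (exp (- \<tau>)) (x \<bullet> y) * \<bar>g y\<bar>) \<partial>lborel)"
    proof (cases "integrable lborel (\<lambda>\<tau>. gamma_density s \<tau> * poisson TYPE('a) (exp (- \<tau>)) (x \<bullet> y) * \<bar>g y\<bar>)")
      case True
      then show ?thesis using gamma_poisson_nonneg[OF riesz_order_pos, where T="TYPE('a)"]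
        by (subst nn_integral_eq_integral) auto
    next
      case False
      then show ?thesis by (simp add: not_integrable_integral_eq)
    qed
    finally show "ennreal (riesz_kernel TYPE('a) s (x \<bullet> y) * \<bar>g y\<bar>)
      \<le> (\<integral>\<^sup>+\<tau>. ennreal (gamma_density s \<tau> * poisson TYPE('a) (exp (- \<tau>)) (x \<bullet> y) * \<bar>g y\<bar>) \<partial>lborel)" .
  qed
  also have "\<dots> = (\<integral>\<^sup>+\<tau>. \<integral>\<^sup>+y. ennreal (gamma_density s \<tau> * poisson TYPE('a) (exp (- \<tau>)) (x \<bullet> y) * \<bar>g y\<bar>) \<partial>sphere_measure \<partial>lborel)"
    using measurable_compose[OF riesz_joint_measurable[OF ag, of x] measurable_ennreal]
    by (intro Fubini'[symmetric]) (simp add: split_beta')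
  also have "\<dots> \<le> ennreal (riesz_norm_bound * 1)" using g gm by (intro riesz_joint_bound x) auto
  finally show "(\<integral>\<^sup>+y. ennreal (riesz_kernel TYPE('a) s (x \<bullet> y) * \<bar>g y\<bar>) \<partial>sphere_measure) \<le> ennreal riesz_norm_bound" by simp
qed

text \<open>On harmonics of degree \<open>l\<close> the Poisson kernel of radius
  \<open>exp (- \<tau>)\<close> acts as \<open>exp (- \<tau> l)\<close>, and the gamma average of
  this is \<open>(l + 1) powr (- s)\<close>.\<close>

lemma riesz_multiplier:
  fixes x z :: 'a
  assumes x: "x \<in> unit_sphere" and z: "z \<in> unit_sphere"
  shows "(\<integral>y. poly (zonal_harmonic TYPE('a) l) (z \<bullet> y) * riesz_kernel TYPE('a) s (x \<bullet> y) \<partial>sphere_measure)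
    = (real l + 1) powr (- s) * poly (zonal_harmonic TYPE('a) l) (x \<bullet> z)"
proof -
  let ?Z = "\<lambda>y. poly (zonal_harmonic TYPE('a) l) (z \<bullet> y)"
  let ?u = "\<lambda>y. zonal_solid (real DIM('a) / 2) l (z \<bullet> y) (y \<bullet> y)"
  have u: "?u \<in> solid_harmonics l" by (rule zonal_solid_harmonic[OF z])
  have P: "gamma_density s \<tau> * (\<integral>y. poisson TYPE('a) (exp (- \<tau>)) (x \<bullet> y) * ?Z y \<partial>sphere_measure)
    = gamma_density s \<tau> * exp (- \<tau>) powr real l * poly (zonal_harmonic TYPE('a) l) (x \<bullet> z)" for \<tau>
  proof (cases "\<tau> > 0")
    case True
    have "(\<integral>y. poisson TYPE('a) (exp (- \<tau>)) (x \<bullet> y) * ?Z y \<partial>sphere_measure)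
      = (\<integral>y. poisson TYPE('a) (exp (- \<tau>)) (x \<bullet> y) * ?u y \<partial>sphere_measure)"
      by (intro Bochner_Integration.integral_cong refl) (simp add: zonal_solid_on_sphere)
    also have "\<dots> = exp (- \<tau>) ^ l * ?u x"
      using True by (intro poisson_integral_harmonic dim x u) auto
    also have "?u x = poly (zonal_harmonic TYPE('a) l) (x \<bullet> z)"
      using zonal_solid_on_sphere[OF x, of l z] by (simp only: inner_commute[of z x])
    finally show ?thesis by (simp add: powr_realpow)
  qed (simp add: gamma_density_def)
  have "(\<integral>y. ?Z y * riesz_kernel TYPE('a) s (x \<bullet> y) \<partial>sphere_measure)
    = (\<integral>y. riesz_kernel TYPE('a) s (x \<bullet> y) * ?Z y \<partial>sphere_measure)" by (simp add: mult.commute)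
  also have "\<dots> = (\<integral>\<tau>. gamma_density s \<tau> * exp (- \<tau>) powr real l * poly (zonal_harmonic TYPE('a) l) (x \<bullet> z) \<partial>lborel)"
    unfolding P[symmetric] by (rule riesz_convolution[OF x poly_zonal_lp_space[OF conj(1)]])
  also have "\<dots> = (real l + 1) powr (- s) * poly (zonal_harmonic TYPE('a) l) (x \<bullet> z)"
    using integral_gamma_density_exp[OF riesz_order_pos, of "real l"] by simp
  finally show ?thesis .
qed

lemma poisson_convolution_continuous:
  assumes t: "\<tau> > 0" and g: "g \<in> lp_space p (sphere_measure :: 'a measure)"
  shows "continuous_on unit_sphere (\<lambda>x. \<integral>y. poisson TYPE('a) (exp (- \<tau>)) (x \<bullet> y) * g y \<partial>sphere_measure)"
proof -
  have r: "0 \<le> exp (- \<tau>)" "exp (- \<tau>) < 1" using t by auto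
  have gi: "integrable sphere_measure g" by (rule sphere.lp_space_integrable[OF conj(1) g])
  let ?S = "2 / (1 - exp (- \<tau>)) ^ (DIM('a) - 1)"
  show ?thesis
  proof (rule continuous_on_integral_dominated[where w="\<lambda>y. ?S * \<bar>g y\<bar>"])
    fix y :: 'a assume "y \<in> space sphere_measure"
    then have y: "y \<in> unit_sphere" by simp
    show "continuous_on unit_sphere (\<lambda>x. poisson TYPE('a) (exp (- \<tau>)) (x \<bullet> y) * g y)"
      using continuous_on_poisson_inner[OF y r] by (intro continuous_on_mult continuous_on_const) (simp add: inner_commute)
  next
    fix x :: 'a assume x: "x \<in> unit_sphere"
    show "(\<lambda>y. poisson TYPE('a) (exp (- \<tau>)) (x \<bullet> y) * g y) \<in> borel_measurable sphere_measure"
      using gi by (intro borel_measurable_times zonal_measurable poisson_measurable) auto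
    fix y :: 'a assume "y \<in> space sphere_measure"
    then have y: "y \<in> unit_sphere" by simp
    show "\<bar>poisson TYPE('a) (exp (- \<tau>)) (x \<bullet> y) * g y\<bar> \<le> ?S * \<bar>g y\<bar>"
      unfolding abs_mult abs_of_nonneg[OF poisson_nonneg[OF r]]
      by (intro mult_right_mono poisson_le r inner_sphere_le x y) simp
  qed (use gi in simp)
qed

text \<open>Each Poisson integral of \<open>g\<close> is continuous. The bound by
  \<open>poisson_norm_bound\<close> is uniform in \<open>x\<close> and integrable against the gamma
  density, so dominated convergence passes to the average.\<close>

lemma riesz_convolution_continuous:
  assumes g: "g \<in> lp_space p (sphere_measure :: 'a measure)"
  shows "continuous_on unit_sphere (\<lambda>x. \<integral>y. riesz_kernel TYPE('a) s (x \<bullet> y) * g y \<partial>sphere_measure)"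
proof -
  obtain G where G: "g \<in> borel_measurable sphere_measure" "G \<ge> 0" "lp_norm p sphere_measure g = ennreal G"
    using g by (rule lp_spaceE)
  let ?F = "\<lambda>x \<tau>. gamma_density s \<tau> * (\<integral>y. poisson TYPE('a) (exp (- \<tau>)) (x \<bullet> y) * g y \<partial>sphere_measure)"
  have "continuous_on unit_sphere (\<lambda>x::'a. \<integral>\<tau>. ?F x \<tau> \<partial>lborel)"
  proof (rule continuous_on_integral_dominated[where w="\<lambda>\<tau>. gamma_density s \<tau> * poisson_norm_bound (DIM('a) - 1) th \<tau> * G"])
    fix \<tau> :: real
    show "continuous_on unit_sphere (\<lambda>x. ?F x \<tau>)"
      using Gamma_real_pos[OF riesz_order_pos]
      by (cases "\<tau> > 0") (auto simp: gamma_density_def intro!: continuous_intros poisson_convolution_continuous g)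
  next
    show "integrable lborel (\<lambda>\<tau>. gamma_density s \<tau> * poisson_norm_bound (DIM('a) - 1) th \<tau> * G)"
      by (intro integrable_mult_left gamma_density_poisson_norm inverse_exponent_nonneg s)
  next
    fix x :: 'a assume x: "x \<in> unit_sphere"
    interpret pair_sigma_finite "sphere_measure :: 'a measure" "lborel :: real measure"
      unfolding pair_sigma_finite_def using sphere.sigma_finite_measure_axioms sigma_finite_lborel by blast
    have "integrable lborel (\<lambda>\<tau>. \<integral>y. gamma_density s \<tau> * poisson TYPE('a) (exp (- \<tau>)) (x \<bullet> y) * g y \<partial>sphere_measure)"
      using integrable_snd[OF riesz_joint_integrable[OF x g]] by simp
    then show "?F x \<in> borel_measurable lborel" by (simp add: mult.assoc)
    fix \<tau> :: real
    show "\<bar>?F x \<tau>\<bar> \<le> gamma_density s \<tau> * poisson_norm_bound (DIM('a) - 1) th \<tau> * G"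
    proof (cases "\<tau> > 0")
      case True
      have r: "0 \<le> exp (- \<tau>)" "exp (- \<tau>) < 1" using True by auto
      have "ennreal \<bar>\<integral>y. poisson TYPE('a) (exp (- \<tau>)) (x \<bullet> y) * g y \<partial>sphere_measure\<bar>
        \<le> (\<integral>\<^sup>+y. ennreal (norm (poisson TYPE('a) (exp (- \<tau>)) (x \<bullet> y) * g y)) \<partial>sphere_measure)"
        using integral_norm_bound_ennreal[of sphere_measure "\<lambda>y. poisson TYPE('a) (exp (- \<tau>)) (x \<bullet> y) * g y"]
        by (cases "integrable sphere_measure (\<lambda>y. poisson TYPE('a) (exp (- \<tau>)) (x \<bullet> y) * g y)")
           (auto simp: not_integrable_integral_eq)
      also have "\<dots> = (\<integral>\<^sup>+y. ennreal (poisson TYPE('a) (exp (- \<tau>)) (x \<bullet> y) * \<bar>g y\<bar>) \<partial>sphere_measure)"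
        using poisson_nonneg[OF r, where T="TYPE('a)"] by (intro nn_integral_cong) (simp add: abs_mult)
      also have "\<dots> \<le> ennreal (G * poisson_norm_bound (DIM('a) - 1) th \<tau>)"
        using G by (intro poisson_convolution_bound dim x True) auto
      finally have "\<bar>\<integral>y. poisson TYPE('a) (exp (- \<tau>)) (x \<bullet> y) * g y \<partial>sphere_measure\<bar> \<le> G * poisson_norm_bound (DIM('a) - 1) th \<tau>"
        using G(2) by (subst (asm) ennreal_le_iff) (auto simp: poisson_norm_bound_def)
      then have "gamma_density s \<tau> * \<bar>\<integral>y. poisson TYPE('a) (exp (- \<tau>)) (x \<bullet> y) * g y \<partial>sphere_measure\<bar>
        \<le> gamma_density s \<tau> * (G * poisson_norm_bound (DIM('a) - 1) th \<tau>)"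
        by (intro mult_left_mono gamma_density_nonneg riesz_order_pos)
      then show ?thesis
        unfolding abs_mult abs_of_nonneg[OF gamma_density_nonneg[OF riesz_order_pos]] by (simp only: mult_ac)
    qed (simp add: gamma_density_def)
  qed
  then show ?thesis
    by (subst continuous_on_cong[OF refl riesz_convolution[OF _ g]]) auto
qed

lemma riesz_zonal_multiplier:
  "zonal_multiplier TYPE('a) p q (\<lambda>l. (real l + 1) powr (- s)) (riesz_kernel TYPE('a) s)"
  unfolding zonal_multiplier_def
  by (intro conjI ballI allI riesz_kernel_measurable riesz_kernel_lp riesz_multiplier riesz_convolution_continuous)

end

end

subsection \<open>Uniformly convergent zonal series\<close>

text \<open>The Cauchy--Schwarz inequality for the reproducing kernel: the square of the sum or
  difference of the zonal functions at \<open>x\<close> and \<open>y\<close> has integral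
  \<open>2 * ?Z 1 + 2 * c * ?Z t\<close>, with \<open>c\<close> equal to 1 or -1.\<close>

lemma zonal_harmonic_le:
  assumes dim: "2 \<le> DIM('a::euclidean_space)" and t: "\<bar>t\<bar> \<le> 1"
  shows "\<bar>poly (zonal_harmonic TYPE('a) l) t\<bar> \<le> poly (zonal_harmonic TYPE('a) l) 1"
proof -
  let ?Z = "poly (zonal_harmonic TYPE('a) l)"
  obtain x y :: 'a where x: "x \<in> unit_sphere" and y: "y \<in> unit_sphere" "x \<bullet> y = t"
    using inner_sphere_surj[OF dim] t by metis
  have 1: "x \<bullet> x = 1" "y \<bullet> y = 1" using x y by (simp_all add: dot_square_norm)
  note conv = zonal_harmonic_convolution[OF dim, of _ _ l l, simplified]
  have i: "integrable sphere_measure (\<lambda>z. ?Z (x \<bullet> z) * ?Z (x \<bullet> z))"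
    "integrable sphere_measure (\<lambda>z. ?Z (y \<bullet> z) * ?Z (y \<bullet> z))"
    "integrable sphere_measure (\<lambda>z. ?Z (x \<bullet> z) * ?Z (y \<bullet> z))"
    by (intro continuous_on_sphere_integrable continuous_intros)+
  have "0 \<le> ?Z 1 + c * ?Z t" if c: "c\<^sup>2 = 1" for c
  proof -
    have "0 \<le> (\<integral>z. (?Z (x \<bullet> z) + c * ?Z (y \<bullet> z))\<^sup>2 \<partial>sphere_measure)" by simp
    also have "\<dots> = (\<integral>z. ?Z (x \<bullet> z) * ?Z (x \<bullet> z) + ?Z (y \<bullet> z) * ?Z (y \<bullet> z) + (2 * c) * (?Z (x \<bullet> z) * ?Z (y \<bullet> z)) \<partial>sphere_measure)"
    proof (intro Bochner_Integration.integral_cong refl)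
      fix z
      have "(a + c * b)\<^sup>2 = a * a + c\<^sup>2 * (b * b) + (2 * c) * (a * b)" for a b :: real
        by (simp add: power2_eq_square algebra_simps)
      then show "(?Z (x \<bullet> z) + c * ?Z (y \<bullet> z))\<^sup>2 = ?Z (x \<bullet> z) * ?Z (x \<bullet> z) + ?Z (y \<bullet> z) * ?Z (y \<bullet> z) + (2 * c) * (?Z (x \<bullet> z) * ?Z (y \<bullet> z))"
        by (simp add: c)
    qed
    also have "\<dots> = ?Z 1 + ?Z 1 + (2 * c) * ?Z t"
      using i zonal_harmonic_convolution[OF dim x x, of l l] zonal_harmonic_convolution[OF dim y(1) y(1), of l l]
        zonal_harmonic_convolution[OF dim x y(1), of l l] by (simp add: 1 y(2))
    finally show ?thesis by simp
  qed
  from this[of 1] this[of "-1"] show ?thesis by simp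
qed

text \<open>The Poisson series at \<open>t = 1\<close> has positive coefficients, so a single term
  is at most \<open>2 / (1 - r) ^ (DIM('a) - 1)\<close>. With \<open>r = 1 - 1 / (l + 2)\<close> the
  factor \<open>r ^ l\<close> stays above \<open>1 / exp 1\<close>.\<close>

lemma zonal_harmonic_1_growth:
  assumes dim: "2 \<le> DIM('a::euclidean_space)"
  shows "poly (zonal_harmonic TYPE('a) l) 1 \<le> 2 * exp 1 * (real l + 2) ^ (DIM('a) - 1)"
proof -
  let ?Z = "\<lambda>k. poly (zonal_harmonic TYPE('a) k) 1"
  define r where "r = 1 - 1 / (real l + 2)"
  have r: "0 \<le> r" "r < 1" by (auto simp: r_def)
  have S: "(\<lambda>k. ?Z k * r ^ k) sums poisson TYPE('a) r 1"
    unfolding zonal_harmonic_def poisson_def by (intro poisson_kernel_sums r) simp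
  have "?Z l * r ^ l \<le> poisson TYPE('a) r 1"
    unfolding sums_unique[OF S] using r zonal_harmonic_1_pos[OF dim]
    by (intro order.trans[OF _ sum_le_suminf[OF sums_summable[OF S], of "{l}"]]) (auto simp: less_imp_le)
  also have "\<dots> \<le> 2 / (1 - r) ^ (DIM('a) - 1)" by (intro poisson_le r) simp
  also have "\<dots> = 2 * (real l + 2) ^ (DIM('a) - 1)" by (simp add: r_def power_one_over power_divide)
  finally have le: "?Z l * r ^ l \<le> 2 * (real l + 2) ^ (DIM('a) - 1)" .
  have rl: "1 \<le> exp 1 * r ^ l"
  proof -
    have r0: "r > 0" by (simp add: r_def)
    have "1 / r = 1 + 1 / (real l + 1)" unfolding r_def by (simp add: field_simps)
    also have "\<dots> \<le> exp (1 / (real l + 1))" by (rule exp_ge_add_one_self)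
    finally have "(1 / r) ^ l \<le> exp (1 / (real l + 1)) ^ l" using r0 by (intro power_mono) auto
    also have "\<dots> = exp (real l / (real l + 1))" by (simp add: exp_of_nat_mult[symmetric])
    also have "\<dots> \<le> exp 1" by simp
    finally show ?thesis using r0 by (simp add: power_one_over divide_le_eq mult.commute)
  qed
  have "?Z l * 1 \<le> ?Z l * (exp 1 * r ^ l)"
    using rl zonal_harmonic_1_pos[OF dim, of l] by (intro mult_left_mono) auto
  also have "\<dots> = exp 1 * (?Z l * r ^ l)" by (simp only: mult_ac)
  also have "\<dots> \<le> exp 1 * (2 * (real l + 2) ^ (DIM('a) - 1))" using le by (intro mult_left_mono) auto
  finally show ?thesis by (simp add: mult_ac)
qed

text \<open>Clipping the argument to the interval from -1 to 1 makes the series converge on the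
  whole line for the sequences considered below, so that its sum is continuous and hence Borel
  measurable.\<close>

definition zonal_series :: "'a::euclidean_space itself \<Rightarrow> (nat \<Rightarrow> real) \<Rightarrow> real \<Rightarrow> real" where
  "zonal_series T \<rho> t = (\<Sum>l. \<rho> l * poly (zonal_harmonic T l) (max (-1) (min 1 t)))"

text \<open>Decay of order \<open>DIM('a) + 1\<close> against growth of order
  \<open>DIM('a) - 1\<close> leaves an inverse square, so the Weierstrass test gives a bounded
  continuous kernel.\<close>

lemma zonal_series_multiplier:
  fixes \<rho> :: "nat \<Rightarrow> real"
  assumes dim: "2 \<le> DIM('a::euclidean_space)" and conj: "1 \<le> p" "1 \<le> q" "1 / p + 1 / q = (1::ereal)"
    and \<rho>: "\<And>l. \<bar>\<rho> l\<bar> \<le> C / (real l + 1) ^ (DIM('a) + 1)"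
  shows "zonal_multiplier TYPE('a) p q \<rho> (zonal_series TYPE('a) \<rho>)"
proof -
  let ?Z = "\<lambda>l. poly (zonal_harmonic TYPE('a) l)"
  let ?c = "\<lambda>t::real. max (-1) (min 1 t)"
  let ?R = "zonal_series TYPE('a) \<rho>"
  define b where "b l = \<bar>\<rho> l\<bar> * ?Z l 1" for l
  have Z1: "?Z l 1 > 0" for l by (rule zonal_harmonic_1_pos[OF dim])
  have b0: "b l \<ge> 0" for l using Z1[of l] by (simp add: b_def)
  have C0: "C \<ge> 0" using \<rho>[of 0] by simp
  have bs: "summable b"
  proof (rule summable_comparison_test'[of _ 0])
    let ?K = "C * (2 * exp 1) * 2 ^ (DIM('a) - 1)"
    show "summable (\<lambda>l. ?K * (1 / (real (Suc l))\<^sup>2))"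
      using inverse_squares_sums by (intro summable_mult) (auto simp: sums_iff add.commute)
    fix l
    have "b l \<le> C / (real l + 1) ^ (DIM('a) + 1) * (2 * exp 1 * (real l + 2) ^ (DIM('a) - 1))"
      unfolding b_def using Z1[of l] C0
      by (intro mult_mono \<rho> zonal_harmonic_1_growth dim) auto
    also have "\<dots> \<le> C / (real l + 1) ^ (DIM('a) + 1) * (2 * exp 1 * (2 * (real l + 1)) ^ (DIM('a) - 1))"
      using C0 by (intro mult_left_mono power_mono) auto
    also have "\<dots> = ?K * (1 / (real (Suc l))\<^sup>2)"
    proof -
      have e: "DIM('a) + 1 = (DIM('a) - 1) + 2" using dim by simp
      have "C / (a ^ (k + 2)) * (2 * exp 1 * (2 * a) ^ k) = C * (2 * exp 1) * 2 ^ k * (1 / a\<^sup>2)" if "a \<noteq> 0" for a :: real and k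
        using that by (simp add: power_add power_mult_distrib power2_eq_square)
      from this[of "real l + 1" "DIM('a) - 1"] show ?thesis unfolding e[THEN arg_cong[of _ _ "power (real l + 1)"]] of_nat_Suc add.commute[of 1 "real l"] by simp
    qed
    finally show "norm (b l) \<le> ?K * (1 / (real (Suc l))\<^sup>2)" using b0[of l] by simp
  qed
  have tb: "\<bar>\<rho> l * ?Z l (?c t)\<bar> \<le> b l" for l t
    unfolding abs_mult b_def by (intro mult_left_mono zonal_harmonic_le dim) auto
  have Rs: "summable (\<lambda>l. \<rho> l * ?Z l (?c t))" for t
    by (rule summable_comparison_test'[OF bs, of 0]) (use tb in simp)
  have Rb: "\<bar>?R t\<bar> \<le> suminf b" for t
    unfolding zonal_series_def using tb
    by (intro order.trans[OF summable_rabs suminf_le] bs summable_comparison_test'[OF bs, of 0]) auto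
  have sb0: "suminf b \<ge> 0" using Rb[of 0] by simp
  have "uniform_limit UNIV (\<lambda>n t. \<Sum>l<n. \<rho> l * ?Z l (?c t)) ?R sequentially"
    unfolding zonal_series_def[abs_def] by (rule Weierstrass_m_test[OF _ bs]) (use tb in simp)
  then have Rc: "continuous_on UNIV ?R"
    by (rule uniform_limit_theorem[rotated]) (auto intro!: always_eventually continuous_intros)
  then have Rm [measurable]: "?R \<in> borel_measurable borel" by (rule borel_measurable_continuous_onI)
  show ?thesis
    unfolding zonal_multiplier_def
  proof (intro conjI ballI allI Rm)
    fix x :: 'a assume x: "x \<in> unit_sphere"
    show "(\<lambda>y. ?R (x \<bullet> y)) \<in> lp_space q sphere_measure"
      using Rb sb0 by (intro lp_spaceI[of _ _ _ "suminf b"] sphere.lp_space_bounded conj zonal_measurable Rm) auto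
    fix z :: 'a and k assume z: "z \<in> unit_sphere"
    let ?f = "\<lambda>l y. ?Z k (z \<bullet> y) * (\<rho> l * ?Z l (?c (x \<bullet> y)))"
    have int: "integrable sphere_measure (?f l)" for l
      by (intro continuous_on_sphere_integrable continuous_intros)
    have fb: "\<bar>?f l y\<bar> \<le> ?Z k 1 * b l" if y: "y \<in> unit_sphere" for l y
      unfolding abs_mult[of "?Z k _"] using Z1[of k] by (intro mult_mono zonal_harmonic_le dim inner_sphere_le z y tb) auto
    have "(\<integral>y. ?Z k (z \<bullet> y) * ?R (x \<bullet> y) \<partial>sphere_measure) = (\<integral>y. (\<Sum>l. ?f l y) \<partial>sphere_measure)"
      unfolding zonal_series_def by (intro Bochner_Integration.integral_cong refl suminf_mult Rs suminf_mult[symmetric])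
    also have "\<dots> = (\<Sum>l. \<integral>y. ?f l y \<partial>sphere_measure)"
    proof (rule integral_suminf[OF int])
      show "AE y in sphere_measure. summable (\<lambda>l. norm (?f l y))"
        using fb by (intro AE_I2 summable_comparison_test'[OF summable_mult[OF bs, of "?Z k 1"], of 0]) auto
      show "summable (\<lambda>l. \<integral>y. norm (?f l y) \<partial>sphere_measure)"
      proof (rule summable_comparison_test'[OF summable_mult[OF bs, of "?Z k 1"], of 0])
        fix l
        have "(\<integral>y. norm (?f l y) \<partial>sphere_measure) \<le> (\<integral>y. ?Z k 1 * b l \<partial>(sphere_measure :: 'a measure))"
          using fb by (intro integral_mono integrable_norm int) auto
        then show "norm (\<integral>y. norm (?f l y) \<partial>sphere_measure) \<le> ?Z k 1 * b l" by simp
      qed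
    qed
    also have "\<dots> = (\<Sum>l. if l = k then \<rho> k * ?Z k (x \<bullet> z) else 0)"
    proof (intro suminf_cong)
      fix l
      have "(\<integral>y. ?f l y \<partial>sphere_measure) = (\<integral>y. \<rho> l * (?Z k (z \<bullet> y) * ?Z l (x \<bullet> y)) \<partial>sphere_measure)"
      proof (intro Bochner_Integration.integral_cong refl)
        fix y :: 'a assume "y \<in> space sphere_measure"
        then have "\<bar>x \<bullet> y\<bar> \<le> 1" by (intro inner_sphere_le x) simp
        then have "?c (x \<bullet> y) = x \<bullet> y" by auto
        then show "?f l y = \<rho> l * (?Z k (z \<bullet> y) * ?Z l (x \<bullet> y))" by simp
      qed
      then show "(\<integral>y. ?f l y \<partial>sphere_measure) = (if l = k then \<rho> k * ?Z k (x \<bullet> z) else 0)"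
        using zonal_harmonic_convolution[OF dim z x, of k l] by (auto simp: inner_commute)
    qed
    also have "\<dots> = \<rho> k * ?Z k (x \<bullet> z)"
      using sums_single[of k "\<lambda>_. \<rho> k * ?Z k (x \<bullet> z)"] by (simp add: sums_iff)
    finally show "(\<integral>y. ?Z k (z \<bullet> y) * ?R (x \<bullet> y) \<partial>sphere_measure) = \<rho> k * ?Z k (x \<bullet> z)" .
  next
    fix g :: "'a \<Rightarrow> real" assume g: "g \<in> lp_space p sphere_measure"
    have gi: "integrable sphere_measure g" by (rule sphere.lp_space_integrable[OF conj(1) g])
    show "continuous_on unit_sphere (\<lambda>x. \<integral>y. ?R (x \<bullet> y) * g y \<partial>sphere_measure)"
    proof (rule continuous_on_integral_dominated[where w="\<lambda>y. suminf b * \<bar>g y\<bar>"])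
      show "continuous_on unit_sphere (\<lambda>x. ?R (x \<bullet> y) * g y)" for y
        by (intro continuous_intros continuous_on_compose2[OF Rc]) auto
      show "(\<lambda>y. ?R (x \<bullet> y) * g y) \<in> borel_measurable sphere_measure" for x
        using gi by (intro borel_measurable_times zonal_measurable Rm) auto
      show "integrable sphere_measure (\<lambda>y. suminf b * \<bar>g y\<bar>)" using gi by simp
      show "\<bar>?R (x \<bullet> y) * g y\<bar> \<le> suminf b * \<bar>g y\<bar>" for x y
        unfolding abs_mult by (intro mult_right_mono Rb) simp
    qed
  qed
qed

subsection \<open>The Bessel kernel\<close>

text \<open>The tail from index \<open>K\<close> on is \<open>w ^ K\<close> times a power series
  that converges absolutely at \<open>1 / 2\<close>.\<close>

lemma binomial_series_remainder:
  fixes a :: real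
  obtains C where "\<And>w. \<bar>w\<bar> \<le> 1 / 2 \<Longrightarrow> \<bar>(1 + w) powr a - (\<Sum>j<K. (a gchoose j) * w ^ j)\<bar> \<le> C * \<bar>w\<bar> ^ K"
proof -
  let ?f = "\<lambda>n. a gchoose n"
  \<comment> \<open>Any point strictly between \<open>1 / 2\<close> and the radius of convergence 1
    yields absolute convergence at \<open>1 / 2\<close>.\<close>
  have "summable (\<lambda>n. ?f n * (3 / 4) ^ n)"
    using gen_binomial_real[of "3/4" a] by (simp add: sums_iff)
  then have "summable (\<lambda>n. norm (?f n * (1 / 2) ^ n))" by (rule powser_insidea) simp
  then have S: "summable (\<lambda>n. norm (?f (n + K) * (1 / 2) ^ (n + K)))"
    by (rule summable_ignore_initial_segment)
  define C where "C = 2 ^ K * (\<Sum>n. norm (?f (n + K) * (1 / 2) ^ (n + K)))"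
  have "\<bar>(1 + w) powr a - (\<Sum>j<K. ?f j * w ^ j)\<bar> \<le> C * \<bar>w\<bar> ^ K" if w: "\<bar>w\<bar> \<le> 1 / 2" for w
  proof -
    have s: "(\<lambda>n. ?f n * w ^ n) sums (1 + w) powr a" using w by (intro gen_binomial_real) auto
    have "(1 + w) powr a - (\<Sum>j<K. ?f j * w ^ j) = (\<Sum>n. ?f (n + K) * w ^ (n + K))"
      using suminf_minus_initial_segment[OF sums_summable[OF s], of K] sums_unique[OF s] by simp
    moreover have le: "norm (?f (n + K) * w ^ (n + K)) \<le> norm (?f (n + K) * (1 / 2) ^ (n + K)) * (2 ^ K * \<bar>w\<bar> ^ K)" for n
    proof -
      have "\<bar>w\<bar> ^ n * \<bar>w\<bar> ^ K \<le> (1 / 2) ^ n * \<bar>w\<bar> ^ K" using w by (intro mult_right_mono power_mono) auto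
      also have "\<dots> = (1 / 2) ^ (n + K) * (2 ^ K * \<bar>w\<bar> ^ K)"
        by (simp add: power_add power_divide)
      finally have "\<bar>?f (n + K)\<bar> * (\<bar>w\<bar> ^ n * \<bar>w\<bar> ^ K) \<le> \<bar>?f (n + K)\<bar> * ((1 / 2) ^ (n + K) * (2 ^ K * \<bar>w\<bar> ^ K))"
        by (intro mult_left_mono) auto
      then show ?thesis by (simp add: abs_mult power_abs power_add mult.assoc)
    qed
    moreover have "norm (\<Sum>n. ?f (n + K) * w ^ (n + K)) \<le> (\<Sum>n. norm (?f (n + K) * (1 / 2) ^ (n + K)) * (2 ^ K * \<bar>w\<bar> ^ K))"
      by (rule norm_suminf_le[OF le summable_mult2[OF S]])
    moreover have "(\<Sum>n. norm (?f (n + K) * (1 / 2) ^ (n + K)) * (2 ^ K * \<bar>w\<bar> ^ K)) = C * \<bar>w\<bar> ^ K"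
      unfolding C_def by (subst suminf_mult2[OF S, symmetric]) (simp only: mult_ac)
    ultimately show ?thesis by simp
  qed
  then show ?thesis by (rule that)
qed

text \<open>With \<open>m = l + 1\<close>, \<open>1 + l (l + d - 1) = m\<^sup>2 (1 + (d - 3)/m + (3 - d)/m\<^sup>2)\<close>; expand the power in \<open>1/m\<close>.\<close>

lemma eigenvalue_power_expansion:
  fixes d :: nat and s :: real
  assumes s: "s > 0" and d: "d \<ge> 1"
  obtains b :: "nat \<Rightarrow> real" and N C where
    "\<And>l. \<bar>(1 + real l * (real l + real d - 1)) powr (- s / 2) - (\<Sum>i\<le>N. b i * (real l + 1) powr (- (s + real i)))\<bar>
      \<le> C / (real l + 1) ^ K"
proof -
  let ?a = "- s / 2"
  define e where "e = real d - 3"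
  obtain C0 where C0: "\<And>w. \<bar>w\<bar> \<le> 1 / 2 \<Longrightarrow> \<bar>(1 + w) powr ?a - (\<Sum>j<K. (?a gchoose j) * w ^ j)\<bar> \<le> C0 * \<bar>w\<bar> ^ K"
    using binomial_series_remainder[of ?a K] by blast
  have C0': "C0 \<ge> 0"
  proof -
    have "0 \<le> C0 * \<bar>1 / 2\<bar> ^ K" by (rule order.trans[OF abs_ge_zero C0]) simp
    moreover have "\<bar>1 / 2 :: real\<bar> ^ K > 0" by (rule zero_less_power) simp
    ultimately show ?thesis using zero_le_mult_iff not_le by (metis mult_neg_pos)
  qed
  \<comment> \<open>Evaluated at \<open>1 / m\<close>, this is the perturbation
    \<open>(d - 3)/m + (3 - d)/m^2\<close>.\<close>
  define W where "W = [:0, e, - e:]"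
  \<comment> \<open>Collecting the truncated binomial sum as one polynomial in \<open>1 / m\<close>
    makes its coefficients the numbers \<open>b i\<close> and its degree the bound
    \<open>N\<close>.\<close>
  define B where "B = (\<Sum>j<K. smult (?a gchoose j) (W ^ j))"
  define X where "X l = (1 + real l * (real l + real d - 1)) powr ?a - (\<Sum>i\<le>degree B. coeff B i * (real l + 1) powr (- (s + real i)))" for l
  \<comment> \<open>From here on \<open>m \<ge> 4 * \<bar>e\<bar>\<close>, and
    \<open>\<bar>w\<bar> \<le> 2 * \<bar>e\<bar> / m \<le> 1 / 2\<close> lies in the range of the
    remainder estimate.\<close>
  define l0 where "l0 = nat \<lceil>4 * \<bar>e\<bar>\<rceil>"
  have large: "\<bar>X l\<bar> \<le> (C0 * (2 * \<bar>e\<bar>) ^ K) / (real l + 1) ^ K" if l: "l \<ge> l0" for l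
  proof -
    define m where "m = real l + 1"
    define w where "w = poly W (1 / m)"
    have m: "m \<ge> 1" "m > 0" by (simp_all add: m_def)
    have m4: "4 * \<bar>e\<bar> \<le> m" using l unfolding l0_def m_def by linarith
    have we: "w = e / m - e / m\<^sup>2" by (simp add: w_def W_def power2_eq_square diff_divide_distrib algebra_simps)
    have wb: "\<bar>w\<bar> \<le> 2 * \<bar>e\<bar> / m"
    proof -
      have "\<bar>e / m\<^sup>2\<bar> \<le> \<bar>e\<bar> / m"
        unfolding abs_divide using m by (intro divide_left_mono) (auto simp: power2_eq_square)
      moreover have "\<bar>e / m\<bar> = \<bar>e\<bar> / m" using m by (simp add: abs_divide)
      ultimately have "\<bar>w\<bar> \<le> \<bar>e\<bar> / m + \<bar>e\<bar> / m"
        unfolding we using abs_triangle_ineq4[of "e / m" "e / m\<^sup>2"] by linarith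
      then show ?thesis by simp
    qed
    also have "2 * \<bar>e\<bar> / m \<le> 1 / 2" using m4 m by (simp add: divide_le_eq)
    finally have w2: "\<bar>w\<bar> \<le> 1 / 2" .
    have base: "1 + real l * (real l + real d - 1) = m\<^sup>2 * (1 + w)"
    proof -
      have "m\<^sup>2 * (1 + w) = m\<^sup>2 + m * (m * (e / m)) - m\<^sup>2 * (e / m\<^sup>2)"
        unfolding we by (simp add: algebra_simps power2_eq_square)
      also have "m * (e / m) = e" using m by simp
      also have "m\<^sup>2 * (e / m\<^sup>2) = e" using m by simp
      finally show ?thesis unfolding e_def m_def by (simp add: algebra_simps power2_eq_square)
    qed
    have "(1 + real l * (real l + real d - 1)) powr ?a = (m\<^sup>2) powr ?a * (1 + w) powr ?a"
      unfolding base by (rule powr_mult)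
    also have "(m\<^sup>2) powr ?a = m powr (- s)"
    proof -
      have "m\<^sup>2 = m powr 2" using m by simp
      then show ?thesis by (simp add: powr_powr del: powr_numeral)
    qed
    finally have 1: "(1 + real l * (real l + real d - 1)) powr ?a = m powr (- s) * (1 + w) powr ?a" .
    have 2: "(\<Sum>i\<le>degree B. coeff B i * m powr (- (s + real i))) = m powr (- s) * (\<Sum>j<K. (?a gchoose j) * w ^ j)"
    proof -
      have "m powr (- (s + real i)) = m powr (- s) * (1 / m) ^ i" for i
      proof -
        have "m powr (- (s + real i)) = m powr (- s) * m powr (- real i)" by (simp add: powr_add[symmetric])
        also have "m powr (- real i) = (1 / m) ^ i"
          using powr_realpow[OF m(2), of i] by (simp add: powr_minus_divide power_one_over)
        finally show ?thesis .
      qed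
      then have "(\<Sum>i\<le>degree B. coeff B i * m powr (- (s + real i))) = m powr (- s) * (\<Sum>i\<le>degree B. coeff B i * (1 / m) ^ i)"
        by (simp add: sum_distrib_left mult_ac)
      also have "(\<Sum>i\<le>degree B. coeff B i * (1 / m) ^ i) = poly B (1 / m)" by (rule poly_altdef[symmetric])
      also have "\<dots> = (\<Sum>j<K. (?a gchoose j) * w ^ j)" by (simp add: B_def w_def poly_sum)
      finally show ?thesis .
    qed
    have "\<bar>X l\<bar> = m powr (- s) * \<bar>(1 + w) powr ?a - (\<Sum>j<K. (?a gchoose j) * w ^ j)\<bar>"
      unfolding X_def 1 m_def[symmetric] 2 right_diff_distrib[symmetric] abs_mult by simp
    also have "\<dots> \<le> 1 * (C0 * \<bar>w\<bar> ^ K)"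
    proof (intro mult_mono C0 w2)
      show "m powr (- s) \<le> 1" using powr_mono[of "- s" 0 m] m s by simp
    qed auto
    also have "\<dots> \<le> C0 * (2 * \<bar>e\<bar> / m) ^ K" using wb C0' by (auto intro!: mult_left_mono power_mono)
    finally show ?thesis by (simp add: m_def power_divide)
  qed
  \<comment> \<open>The finitely many indices below \<open>l0\<close> are absorbed into the
    constant.\<close>
  define C where "C = C0 * (2 * \<bar>e\<bar>) ^ K + (\<Sum>l<l0. \<bar>X l\<bar> * (real l + 1) ^ K)"
  have "\<bar>X l\<bar> \<le> C / (real l + 1) ^ K" for l
  proof (cases "l \<ge> l0")
    case True
    have "C0 * (2 * \<bar>e\<bar>) ^ K \<le> C" unfolding C_def by (simp add: sum_nonneg)
    then show ?thesis using large[OF True] by (elim order.trans) (intro divide_right_mono, auto)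
  next
    case False
    then have "\<bar>X l\<bar> * (real l + 1) ^ K \<le> (\<Sum>l<l0. \<bar>X l\<bar> * (real l + 1) ^ K)"
      by (intro member_le_sum) auto
    also have "\<dots> \<le> C" unfolding C_def using C0' by simp
    finally show ?thesis by (simp add: le_divide_eq)
  qed
  then show ?thesis unfolding X_def by (rule that)
qed

theorem bessel_multiplier_exists:
  assumes dim: "2 \<le> DIM('a::euclidean_space)" and conj: "1 \<le> p" "1 \<le> q" "1 / p + 1 / q = (1::ereal)"
    and s: "s > real (DIM('a) - 1) * real_of_ereal (1 / p)"
  obtains h where "zonal_multiplier TYPE('a) p q (\<lambda>l. (1 + eigenvalue TYPE('a) l) powr (- s / 2)) h"
proof -
  let ?d = "DIM('a) - 1"
  have s0: "s > 0" by (rule riesz_order_pos[OF conj refl dim s])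
  have d: "?d \<ge> 1" using dim by simp
  \<comment> \<open>The order of the remainder is the decay that
    \<open>zonal_series_multiplier\<close> asks for.\<close>
  obtain b N C where b: "\<And>l. \<bar>(1 + real l * (real l + real ?d - 1)) powr (- s / 2) - (\<Sum>i\<le>N. b i * (real l + 1) powr (- (s + real i)))\<bar>
      \<le> C / (real l + 1) ^ (DIM('a) + 1)"
    using eigenvalue_power_expansion[OF s0 d, where K="DIM('a) + 1"] by blast
  define \<mu> where "\<mu> l = (1 + eigenvalue TYPE('a) l) powr (- s / 2)" for l
  define \<rho> where "\<rho> l = \<mu> l - (\<Sum>i\<le>N. b i * (real l + 1) powr (- (s + real i)))" for l
  have \<rho>: "\<bar>\<rho> l\<bar> \<le> C / (real l + 1) ^ (DIM('a) + 1)" for l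
    using b[of l] by (simp add: \<rho>_def \<mu>_def eigenvalue_def sphere_dim_def)
  have "zonal_multiplier TYPE('a) p q (\<lambda>l. \<rho> l + (\<Sum>i<n. b i * (real l + 1) powr (- (s + real i))))
    (\<lambda>t. zonal_series TYPE('a) \<rho> t + (\<Sum>i<n. b i * riesz_kernel TYPE('a) (s + real i) t))" for n
  proof (induction n)
    case 0
    show ?case using zonal_series_multiplier[OF dim conj \<rho>] by simp
  next
    case (Suc n)
    have "zonal_multiplier TYPE('a) p q (\<lambda>l. (real l + 1) powr (- (s + real n))) (riesz_kernel TYPE('a) (s + real n))"
      using s by (intro riesz_zonal_multiplier[OF conj refl dim]) simp
    from zonal_multiplier_add[OF conj Suc this, of "b n"] show ?case by (simp add: add.assoc)
  qed
  from this[of "Suc N"] show ?thesis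
    by (intro that) (simp add: \<rho>_def \<mu>_def lessThan_Suc_atMost)
qed

subsection \<open>The worst-case error\<close>

lemma harmonic_proj_diff:
  fixes f g :: "'a::euclidean_space \<Rightarrow> real"
  assumes dim: "2 \<le> DIM('a)" and f: "integrable sphere_measure f" and g: "integrable sphere_measure g"
  shows "harmonic_proj l (\<lambda>y. f y - g y) x = harmonic_proj l f x - harmonic_proj l g x"
  unfolding harmonic_proj_eq[OF dim] right_diff_distrib
  by (intro Bochner_Integration.integral_diff integrable_mult_continuous f g continuous_on_poly_inner)

lemma harmonic_proj_unique:
  fixes f g :: "'a::euclidean_space \<Rightarrow> real"
  assumes dim: "2 \<le> DIM('a)" and f: "integrable sphere_measure f" and g: "integrable sphere_measure g"
    and eq: "\<And>l x. x \<in> unit_sphere \<Longrightarrow> harmonic_proj l f x = harmonic_proj l g x"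
  shows "AE y in sphere_measure. f y = g y"
proof -
  have "AE y in sphere_measure. f y - g y = 0"
    by (rule harmonic_proj_complete[OF dim]) (use f g eq harmonic_proj_diff[OF dim f g] in auto)
  then show ?thesis by simp
qed

lemma harmonic_proj_0:
  fixes f :: "'a::euclidean_space \<Rightarrow> real"
  assumes dim: "2 \<le> DIM('a)"
  shows "harmonic_proj 0 f x = (\<integral>y. f y \<partial>sphere_measure)"
  by (simp add: harmonic_proj_eq[OF dim] zonal_harmonic_def)

lemma eigenvalue_nonneg:
  assumes "2 \<le> DIM('a::euclidean_space)"
  shows "0 \<le> eigenvalue TYPE('a) l"
  unfolding eigenvalue_def sphere_dim_def using assms by (intro mult_nonneg_nonneg) auto

lemma eigenvalue_0 [simp]: "eigenvalue T 0 = 0"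
  by (simp add: eigenvalue_def)

text \<open>The choice behind \<open>bessel_kernel\<close> depends on \<open>s\<close> alone and
  guarantees only integrable sections, whereas \<open>h\<close> is constructed for the given
  exponents. Equal projections make the sections of both agree almost everywhere, and all required
  properties are insensitive to null sets.\<close>

lemma zonal_multiplier_bessel_kernel:
  assumes dim: "2 \<le> DIM('a::euclidean_space)" and conj: "1 \<le> p" "1 \<le> q" "1 / p + 1 / q = (1::ereal)"
    and s: "s > real (DIM('a) - 1) * real_of_ereal (1 / p)"
  shows "zonal_multiplier TYPE('a) p q (\<lambda>l. (1 + eigenvalue TYPE('a) l) powr (- s / 2)) (bessel_kernel TYPE('a) s)"
proof -
  let ?m = "\<lambda>l. (1 + eigenvalue TYPE('a) l) powr (- s / 2)"
  let ?B = "bessel_kernel TYPE('a) s"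
  obtain h where h: "zonal_multiplier TYPE('a) p q ?m h"
    using bessel_multiplier_exists[OF dim conj s] .
  have hi: "integrable sphere_measure (\<lambda>y. h (x \<bullet> y))" if "x \<in> unit_sphere" for x :: 'a
    using h that by (intro sphere.lp_space_integrable[OF conj(2)]) (simp add: zonal_multiplier_def)
  have hp: "harmonic_proj l (\<lambda>z. h (x \<bullet> z)) y = ?m l * zonal_kernel TYPE('a) l (x \<bullet> y)"
    if "x \<in> unit_sphere" "y \<in> unit_sphere" for x y :: 'a and l
    using h that by (simp add: zonal_multiplier_def harmonic_proj_eq[OF dim] zonal_kernel_eq[OF dim])
  have "is_bessel_kernel TYPE('a) s h"
    unfolding is_bessel_kernel_def using h hi hp by (simp add: zonal_multiplier_def)
  then have B: "is_bessel_kernel TYPE('a) s ?B"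
    unfolding bessel_kernel_def by (rule someI[where P="is_bessel_kernel TYPE('a) s"])
  then have Bm [measurable]: "?B \<in> borel_measurable borel" by (simp add: is_bessel_kernel_def)
  have hm [measurable]: "h \<in> borel_measurable borel" using h by (simp add: zonal_multiplier_def)
  have ae: "AE y in sphere_measure. ?B (x \<bullet> y) = h (x \<bullet> y)" if x: "x \<in> unit_sphere" for x :: 'a
    using B x hp[OF x] by (intro harmonic_proj_unique dim hi) (auto simp: is_bessel_kernel_def)
  have int: "(\<integral>y. ?B (x \<bullet> y) * g y \<partial>sphere_measure) = (\<integral>y. h (x \<bullet> y) * g y \<partial>sphere_measure)"
    if x: "x \<in> unit_sphere" and g: "g \<in> borel_measurable sphere_measure" for x :: 'a and g
    using ae[OF x] g by (intro integral_cong_AE borel_measurable_times zonal_measurable Bm hm) auto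
  show ?thesis
    unfolding zonal_multiplier_def
  proof (intro conjI ballI allI Bm)
    fix x :: 'a assume x: "x \<in> unit_sphere"
    have "lp_norm q sphere_measure (\<lambda>y. ?B (x \<bullet> y)) = lp_norm q sphere_measure (\<lambda>y. h (x \<bullet> y))"
      by (intro lp_norm_cong_AE ae x zonal_measurable Bm hm)
    then show "(\<lambda>y. ?B (x \<bullet> y)) \<in> lp_space q sphere_measure"
      using h x zonal_measurable(1)[OF Bm, of x] by (simp add: zonal_multiplier_def lp_space_def)
    fix z :: 'a and l assume z: "z \<in> unit_sphere"
    show "(\<integral>y. poly (zonal_harmonic TYPE('a) l) (z \<bullet> y) * ?B (x \<bullet> y) \<partial>sphere_measure)
      = ?m l * poly (zonal_harmonic TYPE('a) l) (x \<bullet> z)"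
      using B x z by (simp add: is_bessel_kernel_def harmonic_proj_eq[OF dim] zonal_kernel_eq[OF dim])
  next
    fix g :: "'a \<Rightarrow> real" assume g: "g \<in> lp_space p sphere_measure"
    have "continuous_on unit_sphere (\<lambda>x::'a. \<integral>y. h (x \<bullet> y) * g y \<partial>sphere_measure)"
      using h g by (simp add: zonal_multiplier_def)
    then show "continuous_on unit_sphere (\<lambda>x::'a. \<integral>y. ?B (x \<bullet> y) * g y \<partial>sphere_measure)"
      by (rule continuous_on_eq) (use g in \<open>simp add: int lp_space_def\<close>)
  qed
qed

section \<open>Convolution with a zonal kernel\<close>

text \<open>Joint integrability for Fubini, although \<open>B\<close> may be unbounded: by rotation
  invariance the \<open>L_1\<close> norm of \<open>B (x \<bullet> y)\<close> in \<open>x\<close> is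
  the same constant \<open>K\<close> for all \<open>y\<close>.\<close>

lemma zonal_convolution_integrable:
  fixes z :: "'a::euclidean_space"
  assumes P: "continuous_on unit_sphere P" and B [measurable]: "B \<in> borel_measurable borel"
    and Bi: "\<And>x. x \<in> unit_sphere \<Longrightarrow> integrable sphere_measure (\<lambda>y::'a. B (x \<bullet> y))"
    and g: "integrable sphere_measure g"
  shows "integrable (sphere_measure \<Otimes>\<^sub>M sphere_measure) (\<lambda>(x, y). P x * B (x \<bullet> y) * g (y::'a) :: real)"
proof (rule integrableI_bounded)
  interpret pair_sigma_finite "sphere_measure :: 'a measure" "sphere_measure :: 'a measure"
    unfolding pair_sigma_finite_def using sphere.sigma_finite_measure_axioms by blast
  have id [measurable]: "(\<lambda>y::'a. y) \<in> borel_measurable sphere_measure" by (rule measurable_on_sphere) simp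
  have [measurable]: "(\<lambda>z. B (fst z \<bullet> snd z)) \<in> borel_measurable ((sphere_measure :: 'a measure) \<Otimes>\<^sub>M (sphere_measure :: 'a measure))"
    by (intro measurable_compose[OF borel_measurable_inner B] measurable_compose[OF measurable_fst id] measurable_compose[OF measurable_snd id])
  have Pm [measurable]: "P \<in> borel_measurable sphere_measure" by (rule continuous_on_sphere_measurable[OF P])
  have gm [measurable]: "g \<in> borel_measurable sphere_measure" using g by simp
  show M: "(\<lambda>(x, y). P x * B (x \<bullet> y) * g y) \<in> borel_measurable (sphere_measure \<Otimes>\<^sub>M sphere_measure)"
    unfolding split_beta' by measurable
  obtain C where C: "C > 0" "\<And>y. y \<in> unit_sphere \<Longrightarrow> \<bar>P y\<bar> \<le> C"
    using continuous_on_sphere_bounded[OF P] by metis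
  obtain e :: 'a where e: "e \<in> unit_sphere"
    using vector_choose_size[of 1] by auto
  define K where "K = (\<integral>\<^sup>+x. ennreal \<bar>B (e \<bullet> x)\<bar> \<partial>sphere_measure)"
  have K: "K < \<infinity>" using Bi[OF e] unfolding K_def integrable_iff_bounded by simp
  have Ky: "(\<integral>\<^sup>+x. ennreal \<bar>B (x \<bullet> y)\<bar> \<partial>sphere_measure) = K" if "y \<in> unit_sphere" for y :: 'a
    using nn_integral_zonal_cong[of "\<lambda>t. ennreal \<bar>B t\<bar>" e y] e that by (simp add: K_def inner_commute)
  have gK: "(\<integral>\<^sup>+y. ennreal \<bar>g y\<bar> \<partial>sphere_measure) < \<infinity>" using g unfolding integrable_iff_bounded by simp
  have "(\<integral>\<^sup>+w. ennreal (norm (case w of (x, y) \<Rightarrow> P x * B (x \<bullet> y) * g y)) \<partial>(sphere_measure \<Otimes>\<^sub>M sphere_measure))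
    = (\<integral>\<^sup>+w. (\<lambda>(x, y). ennreal \<bar>P x * B (x \<bullet> y) * g y\<bar>) w \<partial>(sphere_measure \<Otimes>\<^sub>M sphere_measure))"
    by (intro nn_integral_cong) auto
  also have "\<dots> = (\<integral>\<^sup>+y. \<integral>\<^sup>+x. ennreal \<bar>P x * B (x \<bullet> y) * g y\<bar> \<partial>sphere_measure \<partial>sphere_measure)"
    by (subst nn_integral_snd[symmetric]) (use M in \<open>simp_all add: split_beta'\<close>)
  also have "\<dots> \<le> (\<integral>\<^sup>+y. ennreal C * K * ennreal \<bar>g y\<bar> \<partial>sphere_measure)"
  proof (intro nn_integral_mono)
    fix y :: 'a assume "y \<in> space sphere_measure"
    then have y: "y \<in> unit_sphere" by simp
    have "(\<integral>\<^sup>+x. ennreal \<bar>P x * B (x \<bullet> y) * g y\<bar> \<partial>sphere_measure)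
      \<le> (\<integral>\<^sup>+x. ennreal C * ennreal \<bar>B (x \<bullet> y)\<bar> * ennreal \<bar>g y\<bar> \<partial>sphere_measure)"
      using C by (intro nn_integral_mono) (auto simp: abs_mult ennreal_mult intro!: mult_right_mono ennreal_leI)
    also have "\<dots> = ennreal C * K * ennreal \<bar>g y\<bar>"
      by (simp add: nn_integral_multc nn_integral_cmult Ky[OF y])
    finally show "(\<integral>\<^sup>+x. ennreal \<bar>P x * B (x \<bullet> y) * g y\<bar> \<partial>sphere_measure) \<le> ennreal C * K * ennreal \<bar>g y\<bar>" .
  qed
  also have "\<dots> = ennreal C * K * (\<integral>\<^sup>+y. ennreal \<bar>g y\<bar> \<partial>sphere_measure)"
    by (rule nn_integral_cmult) simp
  also have "\<dots> < \<infinity>" using K gK by (simp add: ennreal_mult_less_top)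
  finally show "(\<integral>\<^sup>+w. ennreal (norm (case w of (x, y) \<Rightarrow> P x * B (x \<bullet> y) * g y)) \<partial>(sphere_measure \<Otimes>\<^sub>M sphere_measure)) < \<infinity>" .
qed

text \<open>Fubini moves the zonal harmonic from the convolution onto the kernel, where the symmetry
  of \<open>x \<bullet> y\<close> lets the multiplier property apply.\<close>

lemma zonal_multiplier_harmonic_proj:
  fixes z :: "'a::euclidean_space"
  assumes dim: "2 \<le> DIM('a)" and conj: "1 \<le> p" "1 \<le> q" and B: "zonal_multiplier TYPE('a) p q m B"
    and g: "g \<in> lp_space p sphere_measure" and z: "z \<in> unit_sphere"
  shows "harmonic_proj l (\<lambda>x. \<integral>y. B (x \<bullet> y) * g y \<partial>sphere_measure) z = m l * harmonic_proj l g z"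
proof -
  interpret pair_sigma_finite "sphere_measure :: 'a measure" "sphere_measure :: 'a measure"
    unfolding pair_sigma_finite_def using sphere.sigma_finite_measure_axioms by blast
  let ?Z = "poly (zonal_harmonic TYPE('a) l)"
  have gi: "integrable sphere_measure g" by (rule sphere.lp_space_integrable[OF conj(1) g])
  have Bm: "B \<in> borel_measurable borel" using B by (simp add: zonal_multiplier_def)
  have Bi: "integrable sphere_measure (\<lambda>y::'a. B (x \<bullet> y))" if "x \<in> unit_sphere" for x
    using B that by (intro sphere.lp_space_integrable[OF conj(2)]) (simp add: zonal_multiplier_def)
  have e1: "(\<integral>y. ?Z (z \<bullet> x) * B (x \<bullet> y) * g y \<partial>sphere_measure) = ?Z (z \<bullet> x) * (\<integral>y. B (x \<bullet> y) * g y \<partial>sphere_measure)" for x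
    by (simp only: mult.assoc integral_mult_right_zero)
  have e2: "(\<integral>x. ?Z (z \<bullet> x) * B (x \<bullet> y) * g y \<partial>sphere_measure) = m l * (?Z (z \<bullet> y) * g y)" if y: "y \<in> unit_sphere" for y
  proof -
    have "(\<integral>x. ?Z (z \<bullet> x) * B (x \<bullet> y) \<partial>sphere_measure) = (\<integral>x. ?Z (z \<bullet> x) * B (y \<bullet> x) \<partial>sphere_measure)"
      by (rule Bochner_Integration.integral_cong) (simp_all only: inner_commute)
    also have "\<dots> = m l * ?Z (y \<bullet> z)"
      using B y z by (simp add: zonal_multiplier_def)
    also have "\<dots> = m l * ?Z (z \<bullet> y)" by (simp only: inner_commute)
    finally show ?thesis by simp
  qed
  have "harmonic_proj l (\<lambda>x. \<integral>y. B (x \<bullet> y) * g y \<partial>sphere_measure) z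
    = (\<integral>x. (\<integral>y. ?Z (z \<bullet> x) * B (x \<bullet> y) * g y \<partial>sphere_measure) \<partial>sphere_measure)"
    unfolding harmonic_proj_eq[OF dim] e1 ..
  also have "\<dots> = (\<integral>y. (\<integral>x. ?Z (z \<bullet> x) * B (x \<bullet> y) * g y \<partial>sphere_measure) \<partial>sphere_measure)"
    by (rule Fubini_integral[symmetric, OF zonal_convolution_integrable[OF continuous_on_poly_inner Bm Bi gi]])
  also have "\<dots> = (\<integral>y. m l * (?Z (z \<bullet> y) * g y) \<partial>sphere_measure)"
    by (rule Bochner_Integration.integral_cong[OF refl], rule e2) simp
  also have "\<dots> = m l * harmonic_proj l g z" unfolding harmonic_proj_eq[OF dim] by (rule integral_mult_right_zero)
  finally show ?thesis .
qed

text \<open>Change of variables to the uniform measure on the indices, so repeated nodes count with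
  multiplicity.\<close>

lemma integral_empirical_measure:
  fixes x :: "nat \<Rightarrow> 'a::euclidean_space" and F :: "'a \<Rightarrow> real"
  assumes x: "\<And>k. k \<in> {1..N} \<Longrightarrow> x k \<in> unit_sphere" and F: "F \<in> borel_measurable sphere_measure"
  shows "(\<integral>z. F z \<partial>empirical_measure N x) = (\<Sum>j=1..N. F (x j)) / real N"
proof -
  have [measurable]: "F \<in> borel_measurable (restrict_space borel unit_sphere)"
    using F unfolding measurable_cong_sets[OF sets_sphere_measure refl] .
  have [measurable]: "x \<in> measurable (uniform_count_measure {1..N}) (restrict_space borel unit_sphere)"
    using x by (auto simp: measurable_def space_restrict_space sets_uniform_count_measure space_uniform_count_measure)
  have "(\<integral>z. F z \<partial>empirical_measure N x) = (\<integral>k. F (x k) \<partial>uniform_count_measure {1..N})"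
    unfolding empirical_measure_def by (rule integral_distr) measurable
  also have "\<dots> = (\<Sum>j=1..N. F (x j)) / real N" by (subst integral_uniform_count_measure) auto
  finally show ?thesis .
qed

section \<open>The quadrature error as a pairing with the Bessel error function\<close>

context
  fixes p q :: ereal and s :: real and N :: nat and x :: "nat \<Rightarrow> 'a::euclidean_space"
  assumes dim: "2 \<le> DIM('a)" and conj: "1 \<le> p" "1 \<le> q" "1 / p + 1 / q = 1"
    and s: "s > real (DIM('a) - 1) * real_of_ereal (1 / p)"
    and N: "N \<ge> 1" and x: "\<And>k. k \<in> {1..N} \<Longrightarrow> x k \<in> unit_sphere"
begin

lemma bessel_kernel_multiplier: "zonal_multiplier TYPE('a) p q (\<lambda>l. (1 + eigenvalue TYPE('a) l) powr (- s / 2)) (bessel_kernel TYPE('a) s)"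
  by (rule zonal_multiplier_bessel_kernel[OF dim conj s])

lemma bessel_kernel_measurable [measurable]: "bessel_kernel TYPE('a) s \<in> borel_measurable borel"
  using bessel_kernel_multiplier by (simp add: zonal_multiplier_def)

lemma bessel_kernel_lp_space: "z \<in> unit_sphere \<Longrightarrow> (\<lambda>y::'a. bessel_kernel TYPE('a) s (z \<bullet> y)) \<in> lp_space q sphere_measure"
  using bessel_kernel_multiplier by (simp add: zonal_multiplier_def)

text \<open>The zonal harmonic of degree 0 is 1 and its eigenvalue is 0, so the kernel has mean 1;
  this is the subtracted constant.\<close>

lemma integral_mu_eq_bessel_error:
  assumes y: "y \<in> unit_sphere"
  shows "integral_mu N x (\<lambda>z. bessel_kernel TYPE('a) s (z \<bullet> y)) = bessel_error N x s y"
proof -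
  have "(\<integral>z. bessel_kernel TYPE('a) s (y \<bullet> z) \<partial>sphere_measure) = 1"
    using bessel_kernel_multiplier y unfolding zonal_multiplier_def
    by (auto simp: zonal_harmonic_def dest!: bspec[OF _ y] spec[of _ 0])
  then have "(\<integral>z. bessel_kernel TYPE('a) s (z \<bullet> y) \<partial>sphere_measure) = 1" by (simp only: inner_commute)
  then show ?thesis
    unfolding integral_mu_def bessel_error_def
    by (subst integral_empirical_measure[OF x]) (auto intro: zonal_measurable)
qed

lemma bessel_error_lp: "bessel_error N x s \<in> lp_space q (sphere_measure :: 'a measure)"
proof -
  have "(\<lambda>y::'a. (1 / real N) * (\<Sum>j=1..N. bessel_kernel TYPE('a) s (x j \<bullet> y)) + (-1)) \<in> lp_space q sphere_measure"
    using poly_zonal_lp_space[OF conj(2), of "[:-1:]" 0]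
    by (intro lp_space_add lp_space_cmult sphere.lp_space_sum conj bessel_kernel_lp_space x) auto
  then show ?thesis by (simp add: bessel_error_def[abs_def])
qed

abbreviation "potential g \<equiv> \<lambda>z. \<integral>y. bessel_kernel TYPE('a) s (z \<bullet> y) * g y \<partial>(sphere_measure :: 'a measure)"

lemma potential_continuous:
  "g \<in> lp_space p sphere_measure \<Longrightarrow> continuous_on unit_sphere (potential g)"
  using bessel_kernel_multiplier by (simp add: zonal_multiplier_def)

lemma potential_bessel_image:
  assumes g: "g \<in> lp_space p sphere_measure"
  shows "is_bessel_image p s (potential g) g"
  unfolding is_bessel_image_def
proof (intro conjI allI ballI g)
  fix l and z :: 'a assume z: "z \<in> sphere 0 1"
  have "(1 + eigenvalue TYPE('a) l) powr (s / 2) * (1 + eigenvalue TYPE('a) l) powr (- s / 2) = 1"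
    using eigenvalue_nonneg[OF dim, of l] by (simp add: powr_add[symmetric])
  then show "harmonic_proj l g z = (1 + eigenvalue TYPE('a) l) powr (s / 2) * harmonic_proj l (potential g) z"
    unfolding zonal_multiplier_harmonic_proj[OF dim conj(1,2) bessel_kernel_multiplier g z] mult.assoc[symmetric] by simp
qed

text \<open>The multiplier factors are positive, so \<open>f\<close> and the potential of
  \<open>g\<close> have the same projections; both are continuous, hence they agree at every point,
  the nodes included.\<close>

lemma potential_unique:
  assumes g: "is_bessel_image p s f g" and f: "f \<in> lp_space p sphere_measure" "continuous_on unit_sphere f"
    and z: "z \<in> unit_sphere"
  shows "f z = potential g z"
proof (rule continuous_AE_eq_sphere[OF f(2) potential_continuous _ z])
  show gl: "g \<in> lp_space p sphere_measure" using g by (simp add: is_bessel_image_def)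
  have e: "(1 + eigenvalue TYPE('a) l) powr (s / 2) > 0" for l
    using eigenvalue_nonneg[OF dim, of l] by simp
  show "AE y in sphere_measure. f y = potential g y"
  proof (rule harmonic_proj_unique[OF dim])
    show "integrable sphere_measure f" by (rule sphere.lp_space_integrable[OF conj(1) f(1)])
    show "integrable sphere_measure (potential g)"
      by (rule continuous_on_sphere_integrable[OF potential_continuous[OF gl]])
    fix l and w :: 'a assume w: "w \<in> unit_sphere"
    have "harmonic_proj l g w = (1 + eigenvalue TYPE('a) l) powr (s / 2) * harmonic_proj l f w"
      using g w unfolding is_bessel_image_def by blast
    moreover have "harmonic_proj l g w = (1 + eigenvalue TYPE('a) l) powr (s / 2) * harmonic_proj l (potential g) w"
      using potential_bessel_image[OF gl] w unfolding is_bessel_image_def by blast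
    ultimately have "(1 + eigenvalue TYPE('a) l) powr (s / 2) * harmonic_proj l f w
      = (1 + eigenvalue TYPE('a) l) powr (s / 2) * harmonic_proj l (potential g) w" by (rule trans[OF sym])
    then show "harmonic_proj l f w = harmonic_proj l (potential g) w"
      unfolding mult_cancel_left using e[of l] by (elim disjE) (simp, assumption)
  qed
qed

text \<open>Convolution with the kernel preserves the mean because the multiplier of degree 0 is 1.
  The integral of \<open>f\<close> is therefore that of \<open>g\<close>, which accounts for the
  \<open>- 1\<close> in \<open>bessel_error\<close>.\<close>

lemma qmc_error:
  assumes g: "g \<in> lp_space p sphere_measure" and f: "\<And>z. z \<in> unit_sphere \<Longrightarrow> f z = potential g z"
  shows "qmc N x f - (\<integral>y. f y \<partial>sphere_measure) = (\<integral>y. bessel_error N x s y * g y \<partial>sphere_measure)"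
proof -
  obtain e :: 'a where e: "e \<in> unit_sphere"
    using vector_choose_size[of 1] by auto
  have gi: "integrable sphere_measure g" by (rule sphere.lp_space_integrable[OF conj(1) g])
  have conj': "1 \<le> q" "1 \<le> p" "1 / q + 1 / p = 1" using conj by (simp_all add: add.commute)
  have Bi: "integrable sphere_measure (\<lambda>y. bessel_kernel TYPE('a) s (x k \<bullet> y) * g y)" if "k \<in> {1..N}" for k
    by (intro sphere.lp_space_integrable_mult[OF conj'] bessel_kernel_lp_space x that g)
  have "(\<integral>y. f y \<partial>sphere_measure) = (\<integral>y. potential g y \<partial>sphere_measure)"
    by (intro Bochner_Integration.integral_cong refl) (simp add: f)
  also have "\<dots> = (\<integral>y. g y \<partial>sphere_measure)"
    using zonal_multiplier_harmonic_proj[OF dim conj(1,2) bessel_kernel_multiplier g e, of 0]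
    by (simp add: harmonic_proj_0[OF dim])
  finally have I: "(\<integral>y. f y \<partial>sphere_measure) = (\<integral>y. g y \<partial>sphere_measure)" .
  have "qmc N x f = (\<Sum>k=1..N. potential g (x k)) / real N"
    unfolding qmc_def using f x by simp
  also have "\<dots> = (\<integral>y. (\<Sum>k=1..N. bessel_kernel TYPE('a) s (x k \<bullet> y) * g y) \<partial>sphere_measure) / real N"
    using Bi by (subst Bochner_Integration.integral_sum) auto
  also have "\<dots> = (\<integral>y. (\<Sum>k=1..N. bessel_kernel TYPE('a) s (x k \<bullet> y) * g y) / real N \<partial>sphere_measure)"
    by (rule integral_divide_zero[symmetric])
  finally have Q: "qmc N x f = (\<integral>y. (\<Sum>k=1..N. bessel_kernel TYPE('a) s (x k \<bullet> y) * g y) / real N \<partial>sphere_measure)" .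
  have iS: "integrable sphere_measure (\<lambda>y. (\<Sum>k=1..N. bessel_kernel TYPE('a) s (x k \<bullet> y) * g y) / real N)"
    by (intro integrable_divide_zero impI Bochner_Integration.integrable_sum Bi)
  have "qmc N x f - (\<integral>y. f y \<partial>sphere_measure)
    = (\<integral>y. (\<Sum>k=1..N. bessel_kernel TYPE('a) s (x k \<bullet> y) * g y) / real N - g y \<partial>sphere_measure)"
    unfolding I Q by (rule Bochner_Integration.integral_diff[OF iS gi, symmetric])
  also have "\<dots> = (\<integral>y. bessel_error N x s y * g y \<partial>sphere_measure)"
    by (simp add: bessel_error_def left_diff_distrib sum_distrib_right)
  finally show ?thesis .
qed

text \<open>By completeness two Bessel images of \<open>f\<close> agree almost everywhere, so the
  chosen one has the norm of any other.\<close>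

lemma sobolev_norm_eq:
  fixes f :: "'a \<Rightarrow> real"
  assumes g: "is_bessel_image p s f g"
  shows "sobolev_norm p s f = lp_norm p sphere_measure g"
  unfolding sobolev_norm_def
proof (rule lp_norm_cong_AE)
  let ?g = "SOME g. is_bessel_image p s f g"
  have g': "is_bessel_image p s f ?g" using g by (rule someI[where P="is_bessel_image p s f"])
  show "?g \<in> borel_measurable sphere_measure" "g \<in> borel_measurable sphere_measure"
    using g g' by (simp_all add: is_bessel_image_def lp_space_def)
  show "AE y in sphere_measure. ?g y = g y"
    using g g' by (intro harmonic_proj_unique dim sphere.lp_space_integrable[OF conj(1)])
      (simp_all add: is_bessel_image_def)
qed

theorem wce_eq_lp_norm_bessel_error:
  "wce N x p s = lp_norm q sphere_measure (bessel_error N x s)"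
proof (rule antisym)
  let ?b = "bessel_error N x s"
  obtain b where b: "?b \<in> borel_measurable sphere_measure" "b \<ge> 0" "lp_norm q sphere_measure ?b = ennreal b"
    using bessel_error_lp by (rule lp_spaceE)
  show "wce N x p s \<le> lp_norm q sphere_measure ?b"
    unfolding wce_def
  proof (rule SUP_least)
    fix f :: "'a \<Rightarrow> real" assume f: "f \<in> {f \<in> sobolev_space p s. continuous_on (sphere 0 1) f \<and> sobolev_norm p s f \<le> 1}"
    then obtain g where g: "is_bessel_image p s f g" and fl: "f \<in> lp_space p sphere_measure"
      by (auto simp: sobolev_space_def)
    then have gl: "g \<in> lp_space p sphere_measure" by (simp add: is_bessel_image_def)
    have g1: "lp_norm p sphere_measure g \<le> ennreal 1" using f sobolev_norm_eq[OF g] by simp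
    have gm: "g \<in> borel_measurable sphere_measure" using gl by (simp add: lp_space_def)
    have i: "integrable sphere_measure (\<lambda>y. g y * ?b y)"
      by (rule sphere.lp_space_integrable_mult[OF conj gl bessel_error_lp])
    have "qmc N x f - (\<integral>y. f y \<partial>sphere_measure) = (\<integral>y. ?b y * g y \<partial>sphere_measure)"
      by (rule qmc_error[OF gl potential_unique[OF g fl]]) (use f in auto)
    also have "\<dots> = (\<integral>y. g y * ?b y \<partial>sphere_measure)" by (simp only: mult.commute)
    finally have "ennreal \<bar>qmc N x f - (\<integral>y. f y \<partial>sphere_measure)\<bar> \<le> (\<integral>\<^sup>+y. ennreal \<bar>g y * ?b y\<bar> \<partial>sphere_measure)"
      using integral_norm_bound_ennreal[OF i] by simp
    also have "\<dots> \<le> ennreal (1 * b)"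
      by (rule holder_lp[OF conj gm b(1) g1]) (use b in auto)
    finally show "ennreal \<bar>qmc N x f - (\<integral>y. f y \<partial>sphere_measure)\<bar> \<le> lp_norm q sphere_measure ?b" by (simp add: b)
  qed
  \<comment> \<open>Approximation from below, since the norm may fail to be attained. The potential
    of a near-extremal \<open>g\<close> is continuous and has Sobolev norm equal to the norm of
    \<open>g\<close>, hence competes in the supremum.\<close>
  show "lp_norm q sphere_measure ?b \<le> wce N x p s"
  proof (rule dense_le)
    fix c assume "c < lp_norm q sphere_measure ?b"
    then obtain g where g: "g \<in> lp_space p sphere_measure" "lp_norm p sphere_measure g \<le> 1"
        "c \<le> ennreal (\<integral>y. ?b y * g y \<partial>sphere_measure)"
      using sphere.lp_dual_attained[OF conj bessel_error_lp] by metis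
    let ?f = "potential g"
    have cont: "continuous_on unit_sphere ?f" by (rule potential_continuous[OF g(1)])
    obtain C where "C > 0" "\<And>y. y \<in> unit_sphere \<Longrightarrow> \<bar>?f y\<bar> \<le> C"
      using continuous_on_sphere_bounded[OF cont] by metis
    then have "?f \<in> lp_space p sphere_measure"
      by (intro lp_spaceI[of _ _ _ C] sphere.lp_space_bounded conj continuous_on_sphere_measurable cont) auto
    then have f: "?f \<in> {f \<in> sobolev_space p s. continuous_on (sphere 0 1) f \<and> sobolev_norm p s f \<le> 1}"
      using potential_bessel_image[OF g(1)] sobolev_norm_eq[OF potential_bessel_image[OF g(1)]] cont g(2)
      by (auto simp: sobolev_space_def)
    have "c \<le> ennreal (qmc N x ?f - (\<integral>y. ?f y \<partial>sphere_measure))"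
      using g(3) qmc_error[OF g(1) refl] by simp
    also have "\<dots> \<le> ennreal \<bar>qmc N x ?f - (\<integral>y. ?f y \<partial>sphere_measure)\<bar>" by (intro ennreal_leI) simp
    also have "\<dots> \<le> wce N x p s" unfolding wce_def by (rule SUP_upper[OF f])
    finally show "c \<le> wce N x p s" .
  qed
qed

text \<open>The two functions are known to agree on the sphere only, which is the space of the
  measure, so the equality is passed through null sets.\<close>

lemma lp_norm_integral_mu_eq:
  "lp_norm q sphere_measure (\<lambda>y. integral_mu N x (\<lambda>z. bessel_kernel TYPE('a) s (z \<bullet> y))) = lp_norm q sphere_measure (bessel_error N x s)"
proof (rule lp_norm_cong_AE)
  show b: "bessel_error N x s \<in> borel_measurable sphere_measure"
    using bessel_error_lp by (simp add: lp_space_def)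
  show "(\<lambda>y. integral_mu N x (\<lambda>z. bessel_kernel TYPE('a) s (z \<bullet> y))) \<in> borel_measurable sphere_measure"
    by (subst measurable_cong[OF integral_mu_eq_bessel_error]) (use b in auto)
  show "AE y in sphere_measure. integral_mu N x (\<lambda>z. bessel_kernel TYPE('a) s (z \<bullet> y)) = bessel_error N x s y"
    by (intro AE_I2 integral_mu_eq_bessel_error) simp
qed

end

theorem theorem4p1:
  fixes d N :: nat and p q :: ereal and s :: real and x :: "nat \<Rightarrow> real ^ 'n"
  assumes "d \<ge> 1" and "CARD('n) = d + 1"
    and "1 \<le> p" and "1 \<le> q" and "1 / p + 1 / q = 1"
    and "ereal s > ereal (real d) / p"
    and "N \<ge> 1" and "\<And>k. k \<in> {1..N} \<Longrightarrow> x k \<in> sphere 0 1"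
  shows "wce N x p s =
      lp_norm q sphere_measure
        (\<lambda>y. integral_mu N x (\<lambda>z. bessel_kernel TYPE(real ^ 'n) s (z \<bullet> y)))
    \<and> lp_norm q sphere_measure
        (\<lambda>y. integral_mu N x (\<lambda>z. bessel_kernel TYPE(real ^ 'n) s (z \<bullet> y))) =
      lp_norm q sphere_measure (bessel_error N x s)"
proof -
  have dim: "2 \<le> DIM(real ^ 'n)" and d: "DIM(real ^ 'n) - 1 = d" using assms(1,2) by simp_all
  \<comment> \<open>For \<open>p = \<infinity>\<close> both quotients are 0, in accordance with the
    convention for the reciprocal of infinity.\<close>
  have "s > real d * real_of_ereal (1 / p)"
    using assms(3,6) by (cases p) (auto simp: one_ereal_def divide_ereal_def)
  then have s: "s > real (DIM(real ^ 'n) - 1) * real_of_ereal (1 / p)" unfolding d .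
  note hyps = dim assms(3-5) s assms(7,8)
  show ?thesis
    using wce_eq_lp_norm_bessel_error[OF hyps] lp_norm_integral_mu_eq[OF hyps] by simp
qed

end
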